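(* If the Reidemeister zeta function $R_f(z)$ is defined for a homeomorphism $f$ on an infra-solvmanifold $M$ of type $(\mathrm{R})$, then $M$ is an infra-nilmanifold.
   Context: A connected, simply connected solvable Lie group $S$ with Lie algebra $\mathfrak{S}$ is of type $(\mathrm{R})$ if for every $X\in\mathfrak{S}$ all eigenvalues of $\mathrm{ad}\,X$ are real. Let $C$ be a compact subgroup of $\mathrm{Aut}(S)$ and let $\Pi\subset S\rtimes C$ be a torsion-free discrete subgroup which is a finite extension of the lattice $\Gamma=\Pi\cap S$ of $S$. Then $M=\Pi\backslash S$ is called an infra-solvmanifold of type $(\mathrm{R})$. It is an infra-nilmanifold when $S$ is nilpotent (i.e. $M=\Pi\backslash G$ with $G$ a connected, simply connected nilpotent Lie group and $\Pi\subset G\rtimes\mathrm{Aut}(G)$ an almost Bieberbach group). The Reidemeister number $R(f)$ is the number (possibly $\infty$) of conjugacy classes, under deck transformations, of lifts of $f$ to the universal cover. The Reidemeister zeta function is $R_f(z)=\exp(\sum_{n\ge1}\frac{R(f^n)}{n}z^n)$; it is defined when $R(f^n)<\infty$ for all $n>0$. *)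

theory Defs
  imports "HOL-Analysis.Analysis" "HOL-Algebra.Solvable_Groups" "HOL-Algebra.Bij"
begin

section \<open>Smooth manifolds\<close>

text \<open>\<open>Ck_on k U f\<close>: the map \<open>f\<close> is of class \<open>C\<^sup>k\<close> on the open set \<open>U\<close>
  (meaningful for open \<open>U\<close> and finite-dimensional domain).\<close>

primrec Ck_on :: "nat \<Rightarrow> 'a::real_normed_vector set \<Rightarrow> ('a \<Rightarrow> 'b::real_normed_vector) \<Rightarrow> bool" where
  "Ck_on 0 U f \<longleftrightarrow> continuous_on U f"
| "Ck_on (Suc k) U f \<longleftrightarrow>
     (\<forall>x\<in>U. f differentiable (at x)) \<and> (\<forall>v. Ck_on k U (\<lambda>x. frechet_derivative f (at x) v))"

definition smooth_on :: "'a::real_normed_vector set \<Rightarrow> ('a \<Rightarrow> 'b::real_normed_vector) \<Rightarrow> bool" where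
  "smooth_on U f \<longleftrightarrow> (\<forall>k. Ck_on k U f)"

text \<open>An atlas is a set of charts \<open>(U, \<phi>)\<close>; it need not be maximal. Only the values of \<open>\<phi>\<close> on
  \<open>U\<close> matter, and the inverse chart is \<^term>\<open>inv_into U \<phi>\<close>.\<close>

type_synonym ('a, 'e) atlas = "('a set \<times> ('a \<Rightarrow> 'e)) set"

definition smooth_map ::
  "('a::topological_space, 'e::euclidean_space) atlas \<Rightarrow>
   ('b::topological_space, 'f::euclidean_space) atlas \<Rightarrow> ('a \<Rightarrow> 'b) \<Rightarrow> bool" where
  "smooth_map A B g \<longleftrightarrow> continuous_on UNIV g \<and>
     (\<forall>(U, \<phi>)\<in>A. \<forall>(V, \<psi>)\<in>B. smooth_on (\<phi> ` (U \<inter> g -` V)) (\<psi> \<circ> g \<circ> inv_into U \<phi>))"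

definition smooth_manifold ::
  "('a::{t2_space, second_countable_topology}, 'e::euclidean_space) atlas \<Rightarrow> bool" where
  "smooth_manifold A \<longleftrightarrow>
     (\<forall>(U, \<phi>)\<in>A. open U \<and> open (\<phi> ` U) \<and> (\<exists>\<phi>'. homeomorphism U (\<phi> ` U) \<phi> \<phi>')) \<and>
     (\<Union>(U, \<phi>)\<in>A. U) = UNIV \<and>
     (\<forall>(U, \<phi>)\<in>A. \<forall>(V, \<psi>)\<in>A. smooth_on (\<phi> ` (U \<inter> V)) (\<psi> \<circ> inv_into U \<phi>))"

definition prod_atlas :: "('a, 'e) atlas \<Rightarrow> ('b, 'f) atlas \<Rightarrow> ('a \<times> 'b, 'e \<times> 'f) atlas" where
  "prod_atlas A B = {(U \<times> V, map_prod \<phi> \<psi>) | U \<phi> V \<psi>. (U, \<phi>) \<in> A \<and> (V, \<psi>) \<in> B}"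


section \<open>Lie groups\<close>

text \<open>The dimension of the Lie group is \<open>CARD('n)\<close>, hence positive. The underlying manifold is the whole type
  \<open>'s\<close>, with its type class topology.\<close>

definition lie_group ::
  "'s::{t2_space, second_countable_topology} monoid \<Rightarrow> ('s, real^'n) atlas \<Rightarrow> bool" where
  "lie_group G A \<longleftrightarrow> group G \<and> carrier G = UNIV \<and> smooth_manifold A \<and>
     smooth_map (prod_atlas A A) A (\<lambda>(x, y). x \<otimes>\<^bsub>G\<^esub> y) \<and>
     smooth_map A A (\<lambda>x. inv\<^bsub>G\<^esub> x)"

text \<open>The Lie algebra is the tangent space at the identity, identified with \<open>\<real>\<^sup>n\<close> by a chart
  \<open>(U, \<phi>)\<close> around the identity. \<open>left_inv_field G (U, \<phi>) X\<close> is, in this chart, the left-invariant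
  vector field with value \<open>X\<close> at the identity: its value at \<open>g\<close> is the image of \<open>X\<close> under the
  differential at the identity of left translation by \<open>g\<close>. The bracket of \<open>X\<close> and \<open>Y\<close> is the
  value at the identity of the bracket of the corresponding vector fields.\<close>

definition vector_field_bracket ::
  "('e::real_normed_vector \<Rightarrow> 'e) \<Rightarrow> ('e \<Rightarrow> 'e) \<Rightarrow> 'e \<Rightarrow> 'e" where
  "vector_field_bracket V W p =
     frechet_derivative W (at p) (V p) - frechet_derivative V (at p) (W p)"

definition left_inv_field ::
  "'s monoid \<Rightarrow> 's set \<times> ('s \<Rightarrow> 'e::real_normed_vector) \<Rightarrow> 'e \<Rightarrow> 'e \<Rightarrow> 'e" where
  "left_inv_field G = (\<lambda>(U, \<phi>) X x.
     frechet_derivative (\<lambda>y. \<phi> (inv_into U \<phi> x \<otimes>\<^bsub>G\<^esub> inv_into U \<phi> y)) (at (\<phi> \<one>\<^bsub>G\<^esub>)) X)"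

definition lie_bracket ::
  "'s monoid \<Rightarrow> 's set \<times> ('s \<Rightarrow> 'e::real_normed_vector) \<Rightarrow> 'e \<Rightarrow> 'e \<Rightarrow> 'e" where
  "lie_bracket G c X Y =
     vector_field_bracket (left_inv_field G c X) (left_inv_field G c Y) (snd c \<one>\<^bsub>G\<^esub>)"

definition complex_eigenvalue :: "(real^'n \<Rightarrow> real^'n) \<Rightarrow> complex \<Rightarrow> bool" where
  "complex_eigenvalue L z \<longleftrightarrow>
     (\<exists>v::complex^'n. v \<noteq> 0 \<and> (\<chi> i j. complex_of_real (matrix L $ i $ j)) *v v = z *s v)"

text \<open>Different charts around the identity give isomorphic Lie algebras, hence the same
  eigenvalues.\<close>

definition type_R :: "'s monoid \<Rightarrow> ('s, real^'n) atlas \<Rightarrow> bool" where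
  "type_R G A \<longleftrightarrow>
     (\<forall>c\<in>A. \<one>\<^bsub>G\<^esub> \<in> fst c \<longrightarrow>
        (\<forall>X z. complex_eigenvalue (lie_bracket G c X) z \<longrightarrow> z \<in> \<real>))"

primrec lower_central :: "'s monoid \<Rightarrow> nat \<Rightarrow> 's set" where
  "lower_central G 0 = carrier G"
| "lower_central G (Suc k) =
     generate G {h \<otimes>\<^bsub>G\<^esub> g \<otimes>\<^bsub>G\<^esub> inv\<^bsub>G\<^esub> h \<otimes>\<^bsub>G\<^esub> inv\<^bsub>G\<^esub> g | h g.
                   h \<in> lower_central G k \<and> g \<in> carrier G}"

definition nilpotent_group :: "'s monoid \<Rightarrow> bool" where
  "nilpotent_group G \<longleftrightarrow> (\<exists>k. lower_central G k = {\<one>\<^bsub>G\<^esub>})"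


section \<open>Automorphisms and semidirect products\<close>

definition lie_automorphisms ::
  "'s::topological_space monoid \<Rightarrow> ('s, real^'n) atlas \<Rightarrow> ('s \<Rightarrow> 's) set" where
  "lie_automorphisms G A =
     {\<alpha> \<in> auto G. smooth_map A A \<alpha> \<and> smooth_map A A (inv_into UNIV \<alpha>)}"

text \<open>The topology of the automorphism group is the compact-open topology.\<close>

definition compact_open_topology ::
  "('a::topological_space \<Rightarrow> 'b::topological_space) topology" where
  "compact_open_topology =
     topology_generated_by {{h. h ` K \<subseteq> U} | K U. compact K \<and> open U}"

definition semidirect :: "'s monoid \<Rightarrow> ('s \<Rightarrow> 's) set \<Rightarrow> ('s \<times> ('s \<Rightarrow> 's)) monoid" where
  "semidirect G C =
     \<lparr>carrier = carrier G \<times> C,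
      mult = (\<lambda>(s, \<alpha>) (t, \<beta>). (s \<otimes>\<^bsub>G\<^esub> \<alpha> t, \<alpha> \<circ> \<beta>)),
      one = (\<one>\<^bsub>G\<^esub>, id)\<rparr>"

definition semidirect_topology ::
  "('s::topological_space \<Rightarrow> 's) set \<Rightarrow> ('s \<times> ('s \<Rightarrow> 's)) topology" where
  "semidirect_topology C = prod_topology euclidean (subtopology compact_open_topology C)"

definition affine_action :: "'s monoid \<Rightarrow> 's \<times> ('s \<Rightarrow> 's) \<Rightarrow> 's \<Rightarrow> 's" where
  "affine_action G = (\<lambda>(s, \<alpha>) x. s \<otimes>\<^bsub>G\<^esub> \<alpha> x)"

definition discrete_in :: "'a topology \<Rightarrow> 'a set \<Rightarrow> bool" where
  "discrete_in X D \<longleftrightarrow> subtopology X D = discrete_topology D"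

definition torsion_free :: "('a, 'm) monoid_scheme \<Rightarrow> bool" where
  "torsion_free H \<longleftrightarrow>
     (\<forall>x\<in>carrier H. \<forall>n::nat. n > 0 \<and> x [^]\<^bsub>H\<^esub> n = \<one>\<^bsub>H\<^esub> \<longrightarrow> x = \<one>\<^bsub>H\<^esub>)"


section \<open>Quotient spaces, lattices, infra-solvmanifolds\<close>

definition quotient_topology :: "'a topology \<Rightarrow> ('a \<Rightarrow> 'b) \<Rightarrow> 'b topology" where
  "quotient_topology X q =
     topology (\<lambda>V. V \<subseteq> q ` topspace X \<and> openin X {x \<in> topspace X. q x \<in> V})"

lemma openin_quotient_topology:
  "openin (quotient_topology X q) V \<longleftrightarrow>
     V \<subseteq> q ` topspace X \<and> openin X {x \<in> topspace X. q x \<in> V}"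
proof -
  have "istopology (\<lambda>V. V \<subseteq> q ` topspace X \<and> openin X {x \<in> topspace X. q x \<in> V})"
    unfolding istopology_def
  proof (rule conjI; intro allI impI)
    fix S T
    assume S: "S \<subseteq> q ` topspace X \<and> openin X {x \<in> topspace X. q x \<in> S}"
      and T: "T \<subseteq> q ` topspace X \<and> openin X {x \<in> topspace X. q x \<in> T}"
    have "{x \<in> topspace X. q x \<in> S \<inter> T} = {x \<in> topspace X. q x \<in> S} \<inter> {x \<in> topspace X. q x \<in> T}"
      by auto
    then show "S \<inter> T \<subseteq> q ` topspace X \<and> openin X {x \<in> topspace X. q x \<in> S \<inter> T}"
      using S T by auto
  next
    fix K
    assume K: "\<forall>V\<in>K. V \<subseteq> q ` topspace X \<and> openin X {x \<in> topspace X. q x \<in> V}"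
    have "{x \<in> topspace X. q x \<in> \<Union>K} = (\<Union>V\<in>K. {x \<in> topspace X. q x \<in> V})"
      by auto
    then show "\<Union>K \<subseteq> q ` topspace X \<and> openin X {x \<in> topspace X. q x \<in> \<Union>K}"
      using K by auto
  qed
  then show ?thesis
    unfolding quotient_topology_def by (simp add: topology_inverse')
qed

lemma topspace_quotient_topology: "topspace (quotient_topology X q) = q ` topspace X"
proof (rule antisym)
  show "topspace (quotient_topology X q) \<subseteq> q ` topspace X"
    using openin_topspace openin_quotient_topology by metis
  have "{x \<in> topspace X. q x \<in> q ` topspace X} = topspace X"
    by auto
  then show "q ` topspace X \<subseteq> topspace (quotient_topology X q)"
    by (intro openin_subset) (simp add: openin_quotient_topology)
qed

lemma quotient_map_quotient_topology: "quotient_map X (quotient_topology X q) q"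
  by (auto simp: quotient_map_def topspace_quotient_topology openin_quotient_topology)

text \<open>A lattice is a discrete cocompact subgroup; the points of \<open>\<Gamma>\<close>\textbackslash\<open>S\<close> are the orbits of
  \<open>\<Gamma>\<close> acting by left translations. (In a solvable Lie group a discrete subgroup of finite
  covolume is automatically cocompact.)\<close>

definition lattice_in :: "'s::topological_space set \<Rightarrow> 's monoid \<Rightarrow> bool" where
  "lattice_in \<Gamma> G \<longleftrightarrow> subgroup \<Gamma> G \<and> discrete_in euclidean \<Gamma> \<and>
     compact_space (quotient_topology euclidean (\<lambda>x. \<Gamma> #>\<^bsub>G\<^esub> x))"

text \<open>\<open>infra_solvmanifold G A C P\<close> says that the data define an infra-solvmanifold
  \<open>M = P\<close>\textbackslash\<open>G\<close>. The intersection of \<open>P\<close> with \<open>G\<close> is taken with respect to the embedding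
  \<open>s \<mapsto> (s, id)\<close>.\<close>

definition infra_solvmanifold ::
  "'s::{t2_space, second_countable_topology} monoid \<Rightarrow> ('s, real^'n) atlas \<Rightarrow>
   ('s \<Rightarrow> 's) set \<Rightarrow> ('s \<times> ('s \<Rightarrow> 's)) set \<Rightarrow> bool" where
  "infra_solvmanifold G A C P \<longleftrightarrow>
     lie_group G A \<and> connected (UNIV :: 's set) \<and> simply_connected (UNIV :: 's set) \<and>
     solvable G \<and>
     subgroup C (AutoGroup G) \<and> C \<subseteq> lie_automorphisms G A \<and>
     compactin compact_open_topology C \<and>
     subgroup P (semidirect G C) \<and>
     torsion_free ((semidirect G C)\<lparr>carrier := P\<rparr>) \<and>
     discrete_in (semidirect_topology C) P \<and>
     lattice_in {s. (s, id) \<in> P} G \<and>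
     finite (rcosets\<^bsub>(semidirect G C)\<lparr>carrier := P\<rparr>\<^esub> {\<gamma> \<in> P. snd \<gamma> = id})"

definition infra_solvmanifold_type_R ::
  "'s::{t2_space, second_countable_topology} monoid \<Rightarrow> ('s, real^'n) atlas \<Rightarrow>
   ('s \<Rightarrow> 's) set \<Rightarrow> ('s \<times> ('s \<Rightarrow> 's)) set \<Rightarrow> bool" where
  "infra_solvmanifold_type_R G A C P \<longleftrightarrow> infra_solvmanifold G A C P \<and> type_R G A"

definition infra_nilmanifold ::
  "'s::{t2_space, second_countable_topology} monoid \<Rightarrow> ('s, real^'n) atlas \<Rightarrow>
   ('s \<Rightarrow> 's) set \<Rightarrow> ('s \<times> ('s \<Rightarrow> 's)) set \<Rightarrow> bool" where
  "infra_nilmanifold G A C P \<longleftrightarrow> infra_solvmanifold G A C P \<and> nilpotent_group G"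

definition orbit_map :: "'s monoid \<Rightarrow> ('s \<times> ('s \<Rightarrow> 's)) set \<Rightarrow> 's \<Rightarrow> 's set" where
  "orbit_map G P x = {affine_action G \<gamma> x | \<gamma>. \<gamma> \<in> P}"

definition orbit_space ::
  "'s::topological_space monoid \<Rightarrow> ('s \<times> ('s \<Rightarrow> 's)) set \<Rightarrow> 's set topology" where
  "orbit_space G P = quotient_topology euclidean (orbit_map G P)"


section \<open>Reidemeister numbers and the Reidemeister zeta function\<close>

text \<open>Here \<open>p\<close> is the universal covering map, whose domain is the whole type \<open>'s\<close>, and \<open>f\<close> is a
  self-map of the base.\<close>

definition deck_transformations :: "('s::topological_space \<Rightarrow> 'm) \<Rightarrow> ('s \<Rightarrow> 's) set" where
  "deck_transformations p = {h. (\<exists>h'. homeomorphism UNIV UNIV h h') \<and> p \<circ> h = p}"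

definition lifts :: "('s::topological_space \<Rightarrow> 'm) \<Rightarrow> ('m \<Rightarrow> 'm) \<Rightarrow> ('s \<Rightarrow> 's) set" where
  "lifts p f = {F. continuous_on UNIV F \<and> p \<circ> F = f \<circ> p}"

definition lift_conjugacy ::
  "('s::topological_space \<Rightarrow> 'm) \<Rightarrow> ('m \<Rightarrow> 'm) \<Rightarrow> (('s \<Rightarrow> 's) \<times> ('s \<Rightarrow> 's)) set" where
  "lift_conjugacy p f =
     {(F, F'). F \<in> lifts p f \<and> F' \<in> lifts p f \<and>
        (\<exists>h\<in>deck_transformations p. F' = h \<circ> F \<circ> inv_into UNIV h)}"

definition reidemeister_number :: "('s::topological_space \<Rightarrow> 'm) \<Rightarrow> ('m \<Rightarrow> 'm) \<Rightarrow> enat" where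
  "reidemeister_number p f =
     (let K = lifts p f // lift_conjugacy p f in if finite K then enat (card K) else \<infinity>)"

text \<open>The zeta function is a formal power series; the value \<^term>\<open>None\<close> means that it is not
  defined. The coefficient of index \<open>0\<close> in the exponent is \<open>0\<close> because of division by \<open>0\<close>.\<close>

definition reidemeister_zeta ::
  "('s::topological_space \<Rightarrow> 'm) \<Rightarrow> ('m \<Rightarrow> 'm) \<Rightarrow> complex fps option" where
  "reidemeister_zeta p f =
     (if \<forall>n>0. reidemeister_number p (f ^^ n) < \<infinity>
      then Some (fps_exp 1 oo
             Abs_fps (\<lambda>n. of_nat (the_enat (reidemeister_number p (f ^^ n))) / of_nat n))
      else None)"

end

theory Submission
  imports Defs "HOL-Computational_Algebra.Fundamental_Theorem_Algebra"
begin

text \<open>The adjoint representation of \<open>S\<close> is triangularised over the complex numbers; type (R) makes the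
  diagonal characters positive. If \<open>S\<close> is not nilpotent, then two distinct diagonal characters have a
  quotient \<open>\<xi>\<close> that admits a cocycle which is not a coboundary. The homeomorphism induces an automorphism
  \<open>\<phi>\<close> of the deck group, which preserves the subgroup \<open>\<Lambda>\<close> of the lattice generated by \<open>m\<close>-th powers.
  Each such \<open>\<xi>\<close> comes with a nonzero homomorphism \<open>[\<Lambda>, \<Lambda>] \<rightarrow> \<complex>\<close> on which \<open>\<Lambda>\<close> acts
  through \<open>\<xi>\<close>. As words in unipotent matrices grow polynomially and the lattice is discrete, there are
  only boundedly many such characters, so some power \<open>\<phi>\<^sup>k\<close> with \<open>k > 0\<close> fixes \<open>\<xi>\<close>. Then \<open>\<xi>\<close> separates
  infinitely many twisted conjugacy classes unless it is trivial on \<open>\<Lambda>\<close>, and a positive continuous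
  character that is trivial there is bounded on \<open>S\<close>, hence trivial.\<close>

section \<open>Growth in triangular representations\<close>

text \<open>The adjoint image of the lattice need not be discrete, so separation of matrices has to
  come from commutation: if the matrix of x in \<Lambda> is near the identity, conjugation by x
  moves a given h in \<Lambda> only slightly, hence not at all, and a homomorphism on which h acts
  by a factor other than 1 vanishes at x. The homomorphism is the cocycle itself, normalised to
  vanish at some a in \<Lambda> with \<xi>(a) \<noteq> 1. On [\<Lambda>, \<Lambda>], where \<xi> is
  1, it is additive; if it vanished there, it would vanish on all of \<Lambda>, since its value at
  the commutator of x and a is (1 - \<xi>(a)) times its value at x, and then it would vanish
  everywhere. For distinct characters such homomorphisms are linearly independent, so r of them tell
  apart (L + 1)^r products of r fixed elements, while the matrices of these products fall into boxes
  whose number is at most a constant times L^(4 n^3). This bounds the number of characters.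
  Nilpotency follows once every cocycle for two distinct weights is a coboundary: the representation
  then splits by weights, and the lower central series reaches the kernel of Ad, which is
  central.\<close>

locale tri_rep = group G for G (structure) +
  fixes n :: nat and T :: "'a \<Rightarrow> nat \<Rightarrow> nat \<Rightarrow> complex"
  assumes T_mult: "\<lbrakk>s \<in> carrier G; t \<in> carrier G; i < n; j < n\<rbrakk> \<Longrightarrow>
      T (s \<otimes> t) i j = (\<Sum>k<n. T s i k * T t k j)"
    and T_one: "\<lbrakk>i < n; j < n\<rbrakk> \<Longrightarrow> T \<one> i j = (if i = j then 1 else 0)"
    and T_upper: "\<lbrakk>s \<in> carrier G; j < i; i < n\<rbrakk> \<Longrightarrow> T s i j = 0"
begin

lemma T_mult_range:
  assumes "s \<in> carrier G" "t \<in> carrier G" "i < n" "j < n"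
  shows "T (s \<otimes> t) i j = (\<Sum>k=i..j. T s i k * T t k j)"
proof -
  have "(\<Sum>k<n. T s i k * T t k j) = (\<Sum>k=i..j. T s i k * T t k j)"
    by (rule sum.mono_neutral_right) (use assms T_upper in \<open>auto simp: not_le\<close>)
  then show ?thesis
    using T_mult[OF assms] by simp
qed

lemma T_diag_mult:
  assumes "s \<in> carrier G" "t \<in> carrier G" "i < n"
  shows "T (s \<otimes> t) i i = T s i i * T t i i"
  using T_mult_range[OF assms(1,2,3,3)] by simp

lemma T_diag_inv:
  assumes "s \<in> carrier G" "i < n"
  shows "T s i i * T (inv s) i i = 1"
  using T_diag_mult[of s "inv s" i] assms T_one[of i i] by simp

lemma T_diag_nonzero: "s \<in> carrier G \<Longrightarrow> i < n \<Longrightarrow> T s i i \<noteq> 0"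
  using T_diag_inv by fastforce

lemma T_diag_commutator:
  assumes "s \<in> carrier G" "t \<in> carrier G" "i < n"
  shows "T (s \<otimes> t \<otimes> inv s \<otimes> inv t) i i = 1"
proof -
  have "T (s \<otimes> t \<otimes> inv s \<otimes> inv t) i i = (T s i i * T (inv s) i i) * (T t i i * T (inv t) i i)"
    using assms by (simp add: T_diag_mult)
  then show ?thesis
    using assms T_diag_inv by simp
qed

lemma T_diag_derived:
  assumes "H \<subseteq> carrier G" "x \<in> derived G H" "i < n"
  shows "T x i i = 1"
proof -
  have "x \<in> generate G (derived_set G H)"
    using assms by (simp add: derived_def)
  then show ?thesis
  proof (induction rule: generate.induct)
    case one
    then show ?case using assms T_one by simp
  next
    case (incl h)
    then show ?case using assms T_diag_commutator subsetD[OF assms(1)] by auto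
  next
    case (inv h)
    then obtain s t where "s \<in> H" "t \<in> H" "h = s \<otimes> t \<otimes> inv s \<otimes> inv t" by auto
    moreover from this have "s \<in> carrier G" "t \<in> carrier G"
      using assms by auto
    ultimately show ?case
      using assms T_diag_commutator[of s t i] T_diag_inv[of h i] by simp
  next
    case (eng h1 h2)
    moreover have "generate G (derived_set G H) \<subseteq> carrier G"
      by (rule generate_incl) (use derived_set_in_carrier[OF assms(1)] in simp)
    ultimately show ?case
      using assms T_diag_mult[of h1 h2 i] by auto
  qed
qed

section \<open>Words in unipotent elements\<close>

definition word :: "'a list \<Rightarrow> 'a" where
  "word xs = foldr (\<otimes>) xs \<one>"

lemma word_Nil [simp]: "word [] = \<one>"
  by (simp add: word_def)

lemma word_Cons [simp]: "word (x # xs) = x \<otimes> word xs"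
  by (simp add: word_def)

lemma word_closed: "subgroup H G \<Longrightarrow> set xs \<subseteq> H \<Longrightarrow> word xs \<in> H"
  by (induction xs) (auto simp: subgroup.one_closed subgroup.m_closed)

lemma word_append:
  "set xs \<subseteq> carrier G \<Longrightarrow> set ys \<subseteq> carrier G \<Longrightarrow> word (xs @ ys) = word xs \<otimes> word ys"
  by (induction xs) (auto simp: m_assoc word_closed[OF subgroup_self])

lemma inv_word:
  "set xs \<subseteq> carrier G \<Longrightarrow> inv (word xs) = word (rev (map (\<lambda>x. inv x) xs))"
proof (induction xs)
  case (Cons x xs)
  moreover have "set (rev (map (\<lambda>x. inv x) xs)) \<subseteq> carrier G"
    using Cons by auto
  moreover have "word xs \<in> carrier G"
    using Cons word_closed[OF subgroup_self] by simp
  ultimately show ?case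
    by (simp add: word_append inv_mult_group)
qed simp

text \<open>The exponent does not depend on the number of generators: this is what bounds the rank of a
  group of unipotent matrices.\<close>

lemma word_bound:
  fixes B :: real
  assumes X: "X \<subseteq> carrier G" "\<And>x i. x \<in> X \<Longrightarrow> i < n \<Longrightarrow> T x i i = 1"
    and B: "\<And>x i j. x \<in> X \<Longrightarrow> i < n \<Longrightarrow> j < n \<Longrightarrow> cmod (T x i j) \<le> B"
    and K: "K \<ge> 1" "K \<ge> real n * B" and B0: "B \<ge> 0"
    and xs: "set xs \<subseteq> X" and ij: "i < n" "j < n" "i \<le> j"
  shows "cmod (T (word xs) i j) \<le> (K * real (length xs + 1)) ^ (j - i)"
  using xs ij
proof (induction xs arbitrary: i j)
  case Nil
  then show ?case using T_one K by auto
next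
  case (Cons x xs)
  have x: "x \<in> X" "x \<in> carrier G" and w: "word xs \<in> carrier G"
    using Cons X word_closed[OF subgroup_self] by auto
  define Y where "Y = K * real (length xs + 1)"
  have Y: "Y \<ge> 1"
    unfolding Y_def using K by (metis le_add2 mult_mono' mult_1 of_nat_1 of_nat_le_iff zero_le_one)
  have IH: "cmod (T (word xs) k l) \<le> Y ^ (l - k)" if "k < n" "l < n" "k \<le> l" for k l
    using Cons that by (simp add: Y_def)
  have "T (word (x # xs)) i j = (\<Sum>k=i..j. T x i k * T (word xs) k j)"
    using T_mult_range[OF x(2) w] Cons.prems by simp
  also have "\<dots> = T (word xs) i j + (\<Sum>k=Suc i..j. T x i k * T (word xs) k j)"
    using Cons.prems X(2)[OF x(1)] by (subst sum.atLeast_Suc_atMost) auto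
  finally have eq: "T (word (x # xs)) i j = T (word xs) i j + (\<Sum>k=Suc i..j. T x i k * T (word xs) k j)" .
  show ?case
  proof (cases "i = j")
    case True
    then show ?thesis using eq IH[of i j] Cons.prems by simp
  next
    case False
    \<comment> \<open>The term k = i has been split off because T x i i = 1. Each remaining term
      loses at least one power of Y, and the at most n of them cost n B \<le> K. So Y^(d+1) grows by
      K Y^d, which (Y + K)^(d+1) absorbs, and Y + K is the same expression for a word longer by
      one.\<close>
    have "cmod (\<Sum>k=Suc i..j. T x i k * T (word xs) k j) \<le> (\<Sum>k=Suc i..j. B * Y ^ (j - Suc i))"
    proof (rule sum_norm_le)
      fix k assume k: "k \<in> {Suc i..j}"
      have "cmod (T (word xs) k j) \<le> Y ^ (j - k)"
        using IH k Cons.prems by simp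
      also have "\<dots> \<le> Y ^ (j - Suc i)"
        using k Y by (intro power_increasing) auto
      finally show "cmod (T x i k * T (word xs) k j) \<le> B * Y ^ (j - Suc i)"
        using B[OF x(1), of i k] k Cons.prems B0 by (auto simp: norm_mult intro!: mult_mono)
    qed
    also have "\<dots> = real (j - i) * B * Y ^ (j - Suc i)"
      by simp
    also have "\<dots> \<le> real n * B * Y ^ (j - Suc i)"
      using Cons.prems B0 Y by (intro mult_right_mono) auto
    also have "\<dots> \<le> K * Y ^ (j - Suc i)"
      using K Y by (intro mult_right_mono) auto
    finally have 1: "cmod (\<Sum>k=Suc i..j. T x i k * T (word xs) k j) \<le> K * Y ^ (j - Suc i)" .
    obtain d where d: "j - i = Suc d"
      using False Cons.prems by (metis Suc_diff_Suc le_neq_implies_less)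
    have "cmod (T (word (x # xs)) i j) \<le> Y ^ Suc d + K * Y ^ d"
    proof -
      have "j - Suc i = d" using d by simp
      then show ?thesis
        unfolding eq using 1 IH[of i j] Cons.prems d
        by (intro order_trans[OF norm_triangle_ineq] add_mono) auto
    qed
    also have "\<dots> = (Y + K) * Y ^ d"
      by (simp add: algebra_simps)
    also have "\<dots> \<le> (Y + K) * (Y + K) ^ d"
      using Y K by (intro mult_left_mono power_mono) auto
    also have "\<dots> = (K * real (length (x # xs) + 1)) ^ (j - i)"
      by (simp add: d Y_def algebra_simps)
    finally show ?thesis .
  qed
qed

lemma word_hom:
  fixes c :: "'a \<Rightarrow> complex"
  assumes H: "subgroup H G" and add: "\<And>x y. x \<in> H \<Longrightarrow> y \<in> H \<Longrightarrow> c (x \<otimes> y) = c x + c y"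
    and xs: "set xs \<subseteq> H"
  shows "c (word xs) = sum_list (map c xs)"
  using xs
proof (induction xs)
  case Nil
  have "c \<one> = c \<one> + c \<one>"
    using add[of \<one> \<one>] subgroup.one_closed[OF H] by simp
  then show ?case by simp
next
  case (Cons x xs)
  then show ?case using add word_closed[OF H] by simp
qed

text \<open>Writing the identity as T (inv x \<otimes> x) gives the factorisation T (inv x) (T y - T
  x). A bound on the inverse thus turns closeness of x and y into closeness of their quotient to the
  identity.\<close>

lemma T_close:
  assumes x: "x \<in> carrier G" "y \<in> carrier G"
    and M: "\<And>i j. i < n \<Longrightarrow> j < n \<Longrightarrow> cmod (T (inv x) i j) \<le> M"
    and d: "\<And>i j. i < n \<Longrightarrow> j < n \<Longrightarrow> cmod (T y i j - T x i j) \<le> d"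
    and M0: "M \<ge> 0" and ij: "i < n" "j < n"
  shows "cmod (T (inv x \<otimes> y) i j - (if i = j then 1 else 0)) \<le> real n * (M * d)"
proof -
  have "T (inv x \<otimes> y) i j - (if i = j then 1 else 0) = T (inv x \<otimes> y) i j - T (inv x \<otimes> x) i j"
    using x ij T_one by (simp add: l_inv)
  also have "\<dots> = (\<Sum>k<n. T (inv x) i k * (T y k j - T x k j))"
    using T_mult[of "inv x" y i j] T_mult[of "inv x" x i j] x ij
    by (simp del: l_inv add: sum_subtractf right_diff_distrib)
  also have "cmod \<dots> \<le> (\<Sum>k<n. M * d)"
    by (rule sum_norm_le) (auto simp: norm_mult intro!: mult_mono M d ij M0)
  finally show ?thesis by simp
qed

end

text \<open>Gaussian elimination turns linear independence of functions into r points with an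
  invertible evaluation matrix. The conclusion is phrased for combinations of the points, because
  these will be the exponents of a word.\<close>

lemma independent_evaluation:
  fixes c :: "nat \<Rightarrow> 'x \<Rightarrow> complex"
  assumes "\<And>t. (\<And>x. x \<in> X \<Longrightarrow> (\<Sum>i<r. t i * c i x) = 0) \<Longrightarrow> \<forall>i<r. t i = 0"
  shows "\<exists>x. (\<forall>j<r. x j \<in> X) \<and> (\<forall>a. (\<forall>i<r. (\<Sum>j<r. a j * c i (x j)) = 0) \<longrightarrow> (\<forall>j<r. a j = 0))"
  using assms
proof (induction r arbitrary: c)
  case 0
  then show ?case by auto
next
  case (Suc r)
  obtain y where y: "y \<in> X" "c r y \<noteq> 0"
  proof (rule ccontr)
    assume "\<not> thesis"
    then have "\<And>x. x \<in> X \<Longrightarrow> c r x = 0" using that by blast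
    then have "\<And>x. x \<in> X \<Longrightarrow> (\<Sum>i<Suc r. (if i = r then 1 else 0) * c i x) = 0"
      by simp
    from Suc.prems[of "\<lambda>i. if i = r then 1 else 0", OF this] show False by auto
  qed
  \<comment> \<open>The multiple of the pivot function subtracted here cancels the value at y. A
    relation among the \<open>d i\<close> becomes one among the \<open>c i\<close> whose last
    coefficient is \<open>t' r\<close>.\<close>
  define d where "d i x = c i x - c i y / c r y * c r x" for i x
  have "\<forall>i<r. t i = 0" if t: "\<And>x. x \<in> X \<Longrightarrow> (\<Sum>i<r. t i * d i x) = 0" for t
  proof -
    define t' where "t' i = (if i < r then t i else - (\<Sum>i<r. t i * (c i y / c r y)))" for i
    have "\<forall>i<Suc r. t' i = 0"
    proof (rule Suc.prems)
      fix x assume "x \<in> X"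
      then have "(\<Sum>i<r. t i * c i x) = (\<Sum>i<r. t i * (c i y / c r y)) * c r x"
        using t[of x] by (simp add: d_def sum_subtractf algebra_simps sum_distrib_left sum_distrib_right)
      then show "(\<Sum>i<Suc r. t' i * c i x) = 0"
        by (simp add: t'_def)
    qed
    then show ?thesis
      unfolding t'_def by (metis less_SucI)
  qed
  from Suc.IH[of d, OF this] obtain x where x: "\<forall>j<r. x j \<in> X"
    "\<And>a. (\<forall>i<r. (\<Sum>j<r. a j * d i (x j)) = 0) \<Longrightarrow> (\<forall>j<r. a j = 0)"
    by blast
  define x' where "x' j = (if j < r then x j else y)" for j
  have "\<forall>j<Suc r. a j = 0" if a: "\<forall>i<Suc r. (\<Sum>j<Suc r. a j * c i (x' j)) = 0" for a
  proof -
    have a': "(\<Sum>j<r. a j * c i (x j)) = - a r * c i y" if "i < Suc r" for i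
      using a that by (simp add: x'_def eq_neg_iff_add_eq_0)
    have "(\<Sum>j<r. a j * d i (x j)) = 0" if "i < r" for i
    proof -
      have "(\<Sum>j<r. a j * d i (x j)) = (\<Sum>j<r. a j * c i (x j)) - c i y / c r y * (\<Sum>j<r. a j * c r (x j))"
        by (simp add: d_def sum_subtractf sum_distrib_left algebra_simps)
      then show ?thesis
        using a'[of i] a'[of r] that y by simp
    qed
    then have "\<forall>j<r. a j = 0" using x(2) by blast
    moreover from this have "a r = 0"
      using a'[of r] y by simp
    ultimately show ?thesis by (auto simp: less_Suc_eq)
  qed
  moreover have "\<forall>j<Suc r. x' j \<in> X"
    using x(1) y by (auto simp: x'_def)
  ultimately show ?case by blast
qed

context tri_rep
begin

text \<open>Products of powers of r fixed elements, with exponents at most L, are told apart by the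
  \<open>c i\<close>, so their matrices are separated. Their entries and those of the inverses are
  of order at most L^n, hence a box of side of order L^(-n) holds at most one of them. About L^(2n)
  boxes along each of 2 n^2 real coordinates make L^(4 n^3) boxes against (L + 1)^r
  products.\<close>

lemma growth_bound:
  fixes c :: "nat \<Rightarrow> 'a \<Rightarrow> complex"
  assumes D: "subgroup D G" and diag: "\<And>x i. x \<in> D \<Longrightarrow> i < n \<Longrightarrow> T x i i = 1"
    and add: "\<And>i x y. i < r \<Longrightarrow> x \<in> D \<Longrightarrow> y \<in> D \<Longrightarrow> c i (x \<otimes> y) = c i x + c i y"
    and indep: "\<And>t. (\<And>x. x \<in> D \<Longrightarrow> (\<Sum>i<r. t i * c i x) = 0) \<Longrightarrow> \<forall>i<r. t i = 0"
    and eps: "\<epsilon> > 0"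
    and near: "\<And>x i. x \<in> D \<Longrightarrow> i < r \<Longrightarrow>
      (\<And>p q. p < n \<Longrightarrow> q < n \<Longrightarrow> cmod (T x p q - (if p = q then 1 else 0)) < \<epsilon>) \<Longrightarrow> c i x = 0"
  shows "r \<le> 4 * n ^ 3"
proof (rule ccontr)
  assume "\<not> r \<le> 4 * n ^ 3"
  then have r: "r \<ge> Suc (4 * n ^ 3)" by simp
  have "\<exists>x. (\<forall>j<r. x j \<in> D) \<and> (\<forall>a. (\<forall>i<r. (\<Sum>j<r. a j * c i (x j)) = 0) \<longrightarrow> (\<forall>j<r. a j = 0))"
    by (rule independent_evaluation) (rule indep)
  then obtain x where x: "\<forall>j<r. x j \<in> D"
    "\<And>a. (\<forall>i<r. (\<Sum>j<r. a j * c i (x j)) = 0) \<Longrightarrow> (\<forall>j<r. a j = 0)"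
    by blast
  have Dc: "D \<subseteq> carrier G" using D subgroup.subset by blast
  \<comment> \<open>Inverses are included so that one bound on words serves both \<open>W a\<close>
    and \<open>inv (W a)\<close>.\<close>
  define X where "X = x ` {..<r} \<union> (\<lambda>j. inv (x j)) ` {..<r}"
  have XD: "X \<subseteq> D"
    using x(1) D by (auto simp: X_def subgroup.m_inv_closed)
  define B where "B = Max (insert 0 ((\<lambda>(y, i, j). cmod (T y i j)) ` (X \<times> {..<n} \<times> {..<n})))"
  have fin: "finite ((\<lambda>(y, i, j). cmod (T y i j)) ` (X \<times> {..<n} \<times> {..<n}))"
    by (intro finite_imageI finite_cartesian_product) (auto simp: X_def)
  have B: "cmod (T y i j) \<le> B" if "y \<in> X" "i < n" "j < n" for y i j
    unfolding B_def using fin that by (intro Max_ge) force+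
  have B0: "B \<ge> 0"
    unfolding B_def using fin by (intro Max_ge) auto
  define K where "K = max 1 (real n * B)"
  have K: "K \<ge> 1" "K \<ge> real n * B" by (auto simp: K_def)
  define W where "W a = word (concat (map (\<lambda>j. replicate (a j) (x j)) [0..<r]))" for a :: "nat \<Rightarrow> nat"
  have setW: "set (concat (map (\<lambda>j. replicate (a j) (x j)) [0..<r])) \<subseteq> x ` {..<r}" for a :: "nat \<Rightarrow> nat"
    by auto
  have WD: "W a \<in> D" for a
    unfolding W_def using x(1) setW by (intro word_closed[OF D]) fastforce
  have cW: "c i (W a) = (\<Sum>j<r. of_nat (a j) * c i (x j))" if "i < r" for i a
  proof -
    have "c i (W a) = sum_list (map (c i) (concat (map (\<lambda>j. replicate (a j) (x j)) [0..<r])))"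
      unfolding W_def by (rule word_hom[OF D add[OF that]]) (use x(1) in auto)
    also have "\<dots> = sum_list (map (\<lambda>j. of_nat (a j) * c i (x j)) [0..<r])"
    proof -
      have "sum_list (concat yss) = sum_list (map sum_list yss)" for yss :: "complex list list"
        by (induction yss) auto
      then show ?thesis
        by (simp add: map_concat o_def sum_list_replicate)
    qed
    also have "\<dots> = (\<Sum>j<r. of_nat (a j) * c i (x j))"
      by (simp add: interv_sum_list_conv_sum_set_nat atLeast0LessThan)
    finally show ?thesis .
  qed
  define Y where "Y L = K * real (r * L + 1)" for L :: nat
  have Y1: "Y L \<ge> 1" for L
    unfolding Y_def using K by (metis le_add2 mult_mono' mult_1 of_nat_1 of_nat_le_iff zero_le_one)
  have bnd: "cmod (T (word xs) i j) \<le> Y L ^ n"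
    if "set xs \<subseteq> X" "length xs \<le> r * L" "i < n" "j < n" for xs L i j
  proof (cases "i \<le> j")
    case True
    have "cmod (T (word xs) i j) \<le> (K * real (length xs + 1)) ^ (j - i)"
      by (rule word_bound[OF _ _ B K B0 that(1,3,4) True]) (use XD Dc diag in auto)
    also have "\<dots> \<le> Y L ^ (j - i)"
      unfolding Y_def using that K of_nat_mono[OF that(2), where 'a = real]
      by (intro power_mono mult_left_mono) auto
    also have "\<dots> \<le> Y L ^ n"
      using that Y1 by (intro power_increasing) auto
    finally show ?thesis .
  next
    case False
    then show ?thesis
      using T_upper[of "word xs" j i] that XD Dc Y1[of L] word_closed[OF subgroup_self, of xs]
      by auto
  qed
  have len: "length (concat (map (\<lambda>j. replicate (a j) (x j)) [0..<r])) \<le> r * L"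
    if "\<forall>j<r. a j \<le> L" for a L
  proof -
    have "length (concat (map (\<lambda>j. replicate (a j) (x j)) [0..<r])) = (\<Sum>j<r. a j)"
      by (simp add: length_concat o_def interv_sum_list_conv_sum_set_nat atLeast0LessThan)
    also have "\<dots> \<le> (\<Sum>j<r. L)" using that by (intro sum_mono) auto
    finally show ?thesis by simp
  qed
  have bW: "cmod (T (W a) i j) \<le> Y L ^ n" "cmod (T (inv (W a)) i j) \<le> Y L ^ n"
    if a: "\<forall>j<r. a j \<le> L" and ij: "i < n" "j < n" for a L i j
  proof -
    let ?xs = "concat (map (\<lambda>j. replicate (a j) (x j)) [0..<r])"
    show "cmod (T (W a) i j) \<le> Y L ^ n"
      unfolding W_def by (rule bnd[OF _ len[OF a] ij]) (use setW in \<open>auto simp: X_def\<close>)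
    have "inv (W a) = word (rev (map (\<lambda>x. inv x) ?xs))"
      unfolding W_def by (rule inv_word) (use x(1) Dc in auto)
    moreover have "cmod (T (word (rev (map (\<lambda>x. inv x) ?xs))) i j) \<le> Y L ^ n"
      by (rule bnd[OF _ _ ij]) (use setW len[OF a] in \<open>auto simp: X_def\<close>)
    ultimately show "cmod (T (inv (W a)) i j) \<le> Y L ^ n" by simp
  qed
  \<comment> \<open>For n = 0 the nearness premise of \<open>near\<close> is empty, so every
    \<open>c i\<close> would vanish on D, against independence because r > 0.\<close>
  have n0: "n > 0"
  proof (rule ccontr)
    assume "\<not> n > 0"
    then have "c 0 y = 0" if "y \<in> D" for y
      using near[OF that, of 0] r by auto
    then have "\<forall>i<r. (if i = 0 then 1 else 0 :: complex) = 0"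
      by (intro indep) (use r in \<open>auto simp: if_distrib if_distribR sum.delta cong: if_cong\<close>)
    then show False using r by auto
  qed
  \<comment> \<open>Entries of two matrices in one box differ by at most 2 \<delta> in modulus, from
    the real and the imaginary part. The bound of \<open>T_close\<close> is then n Y^n (2 \<delta>),
    which this value makes \<epsilon> / 2.\<close>
  define \<delta> where "\<delta> L = \<epsilon> / (4 * real n * Y L ^ n)" for L
  have \<delta>: "\<delta> L > 0" for L
    using n0 eps Y1[of L] by (simp add: \<delta>_def)
  define N where "N L = nat (\<lceil>Y L ^ n / \<delta> L\<rceil> + 1)" for L
  define box where "box L g = (\<lambda>(i, j) \<in> {..<n} \<times> {..<n}. (\<lfloor>Re (T g i j) / \<delta> L\<rfloor>, \<lfloor>Im (T g i j) / \<delta> L\<rfloor>))" for L g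
  define A where "A L = ({..<r} \<rightarrow>\<^sub>E {..L})" for L :: nat
  define Bx where "Bx L = ({..<n} \<times> {..<n} \<rightarrow>\<^sub>E {- int (N L)..int (N L)} \<times> {- int (N L)..int (N L)})" for L
  have flr: "\<lfloor>z / \<delta> L\<rfloor> \<in> {- int (N L)..int (N L)}" if "\<bar>z\<bar> \<le> Y L ^ n" for z L
  proof -
    have "\<bar>z / \<delta> L\<bar> \<le> Y L ^ n / \<delta> L"
      using that \<delta>[of L] by (simp add: abs_divide divide_right_mono)
    moreover have "Y L ^ n / \<delta> L \<ge> 0"
      using \<delta>[of L] Y1[of L] by simp
    ultimately show ?thesis
      unfolding N_def atLeastAtMost_iff by linarith
  qed
  have inbox: "box L (W a) \<in> Bx L" if "a \<in> A L" for L :: nat and a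
  proof -
    have a: "\<forall>j<r. a j \<le> L" using that by (auto simp: A_def)
    have "\<bar>Re (T (W a) i j)\<bar> \<le> Y L ^ n" "\<bar>Im (T (W a) i j)\<bar> \<le> Y L ^ n" if "i < n" "j < n" for i j
      using bW(1)[OF a that] abs_Re_le_cmod abs_Im_le_cmod order_trans by blast+
    then show ?thesis
      unfolding box_def Bx_def by (intro restrict_PiE_iff[THEN iffD2]) (use flr in auto)
  qed
  have inj: "inj_on (\<lambda>a. box L (W a)) (A L)" for L :: nat
  proof (rule inj_onI)
    fix a b assume ab: "a \<in> A L" "b \<in> A L" "box L (W a) = box L (W b)"
    have aL: "\<forall>j<r. a j \<le> L" "\<forall>j<r. b j \<le> L" using ab by (auto simp: A_def)
    have d: "cmod (T (W b) i j - T (W a) i j) \<le> 2 * \<delta> L" if ij: "i < n" "j < n" for i j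
    proof -
      have fl: "\<bar>u - v\<bar> \<le> \<delta> L" if "\<lfloor>u / \<delta> L\<rfloor> = \<lfloor>v / \<delta> L\<rfloor>" for u v
      proof -
        have "\<bar>u / \<delta> L - v / \<delta> L\<bar> \<le> 1"
          using that by linarith
        then have "\<bar>(u - v) / \<delta> L\<bar> \<le> 1" by (simp add: diff_divide_distrib)
        then show ?thesis using \<delta>[of L] by (simp add: abs_divide divide_le_eq)
      qed
      have "box L (W a) (i, j) = box L (W b) (i, j)" using ab by simp
      then have "\<bar>Re (T (W b) i j) - Re (T (W a) i j)\<bar> \<le> \<delta> L" "\<bar>Im (T (W b) i j) - Im (T (W a) i j)\<bar> \<le> \<delta> L"
        using ij by (auto simp: box_def intro: fl)
      then show ?thesis
        using cmod_le[of "T (W b) i j - T (W a) i j"] by simp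
    qed
    have car: "W a \<in> carrier G" "W b \<in> carrier G" using WD Dc by auto
    have M0: "Y L ^ n \<ge> 0" using Y1[of L] by simp
    have lt: "cmod (T (inv (W a) \<otimes> W b) i j - (if i = j then 1 else 0)) < \<epsilon>" if ij: "i < n" "j < n" for i j
    proof -
      have "cmod (T (inv (W a) \<otimes> W b) i j - (if i = j then 1 else 0)) \<le> real n * (Y L ^ n * (2 * \<delta> L))"
        by (rule T_close[OF car bW(2)[OF aL(1)] d M0 ij])
      also have "\<dots> = \<epsilon> / 2"
        using n0 Y1[of L] by (simp add: \<delta>_def)
      finally show ?thesis using eps by simp
    qed
    have iD: "inv (W a) \<in> D" "inv (W a) \<otimes> W b \<in> D"
      using WD D by (auto simp: subgroup.m_inv_closed subgroup.m_closed)
    \<comment> \<open>The quotient of two words in one box is so near the identity that every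
      \<open>c i\<close> vanishes on it; the evaluation being invertible, the exponents
      agree.\<close>
    have "(\<Sum>j<r. (of_nat (b j) - of_nat (a j)) * c i (x j)) = 0" if i: "i < r" for i
    proof -
      have "c i (W b) = c i (W a \<otimes> (inv (W a) \<otimes> W b))"
        using car by (simp add: m_assoc[symmetric])
      also have "\<dots> = c i (W a) + c i (inv (W a) \<otimes> W b)"
        using add[OF i WD iD(2)] .
      also have "c i (inv (W a) \<otimes> W b) = 0"
        by (rule near[OF iD(2) i lt])
      finally show ?thesis
        using cW[OF i] by (simp add: algebra_simps sum_subtractf)
    qed
    then have "\<forall>j<r. (of_nat (b j) - of_nat (a j) :: complex) = 0"
      using x(2)[of "\<lambda>j. of_nat (b j) - of_nat (a j)"] by simp
    then show "a = b"
      using ab by (intro PiE_ext[of a "{..<r}" "\<lambda>_. {..L}"]) (auto simp: A_def)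
  qed
  have card: "(L + 1) ^ r \<le> ((2 * N L + 1) ^ 2) ^ (n * n)" for L
  proof -
    have "card (A L) \<le> card (Bx L)"
      by (rule card_inj_on_le[OF inj]) (use inbox in \<open>auto simp: Bx_def intro!: finite_PiE\<close>)
    then show ?thesis
    proof -
      have "card (A L) = (L + 1) ^ r"
        by (simp add: A_def card_PiE)
      moreover have "card {- int (N L)..int (N L)} = 2 * N L + 1"
        unfolding card_atLeastAtMost_int by linarith
      then have "card ({- int (N L)..int (N L)} \<times> {- int (N L)..int (N L)}) = (2 * N L + 1) ^ 2"
        by (simp only: card_cartesian_product power2_eq_square)
      then have "card (Bx L) = ((2 * N L + 1) ^ 2) ^ (n * n)"
        by (simp add: Bx_def card_PiE)
      ultimately show ?thesis
        using \<open>card (A L) \<le> card (Bx L)\<close> by simp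
    qed
  qed
  \<comment> \<open>The 8 and the 7 come from 2 N + 1 \<le> 2 (Y^n / \<delta> + 3) + 1 with Y^n /
    \<delta> = (4 n / \<epsilon>) Y^(2n); the factor K (r + 1) comes from Y \<le> K (r + 1) (L +
    1).\<close>
  define Q where "Q = 8 * real n / \<epsilon> * (K * (real r + 1)) ^ (2 * n) + 7"
  have Q: "real (2 * N L + 1) \<le> Q * real (L + 1) ^ (2 * n)" for L
  proof -
    have 1: "Y L ^ n / \<delta> L = 4 * real n / \<epsilon> * Y L ^ (2 * n)"
    proof -
      have "4 * real n / \<epsilon> * Y L ^ (2 * n) = Y L ^ n * (Y L ^ n * (4 * real n / \<epsilon>))"
        by (simp add: mult_2 power_add)
      then show ?thesis
        using n0 eps Y1[of L] by (simp add: \<delta>_def)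
    qed
    have "0 \<le> Y L ^ n / \<delta> L" using \<delta>[of L] Y1[of L] by simp
    then have "real (N L) \<le> Y L ^ n / \<delta> L + 3"
      unfolding N_def by linarith
    then have "real (2 * N L + 1) \<le> 8 * real n / \<epsilon> * Y L ^ (2 * n) + 7"
      using 1 by simp
    also have "\<dots> \<le> 8 * real n / \<epsilon> * (K * (real r + 1) * real (L + 1)) ^ (2 * n) + 7 * real (L + 1) ^ (2 * n)"
    proof (intro add_mono mult_left_mono power_mono)
      show "Y L \<le> K * (real r + 1) * real (L + 1)"
        unfolding Y_def using K by (simp add: algebra_simps)
      show "7 \<le> 7 * real (L + 1) ^ (2 * n)"
        by (simp add: one_le_power)
    qed (use eps Y1[of L] in auto)
    also have "\<dots> = Q * real (L + 1) ^ (2 * n)"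
      by (simp only: Q_def power_mult_distrib distrib_right[of _ 7] mult.assoc)
    finally show ?thesis .
  qed
  have key: "real (L + 1) ^ r \<le> Q ^ (2 * (n * n)) * real (L + 1) ^ (4 * n ^ 3)" for L
  proof -
    have "real (L + 1) ^ r \<le> real (2 * N L + 1) ^ (2 * (n * n))"
      using card[of L] by (metis of_nat_le_iff of_nat_power power_mult)
    also have "\<dots> \<le> (Q * real (L + 1) ^ (2 * n)) ^ (2 * (n * n))"
      using Q by (intro power_mono) auto
    also have "\<dots> = Q ^ (2 * (n * n)) * real (L + 1) ^ (4 * n ^ 3)"
      by (simp add: power_mult_distrib power3_eq_cube algebra_simps flip: power_mult)
    finally show ?thesis .
  qed
  \<comment> \<open>As r exceeds 4 n^3, the count bounds L + 1 by a constant independent of L; this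
    L violates the bound.\<close>
  define L where "L = nat \<lceil>Q ^ (2 * (n * n))\<rceil>"
  have L: "Q ^ (2 * (n * n)) < real (L + 1)"
    unfolding L_def by linarith
  have "real (L + 1) * real (L + 1) ^ (4 * n ^ 3) \<le> real (L + 1) ^ r"
    using power_increasing[OF r, of "real (L + 1)"] by simp
  also have "\<dots> \<le> Q ^ (2 * (n * n)) * real (L + 1) ^ (4 * n ^ 3)"
    by (rule key)
  finally have "real (L + 1) \<le> Q ^ (2 * (n * n))"
    by simp
  then show False using L by simp
qed

section \<open>Characters and twisted conjugacy\<close>

lemma derived_conj_closed:
  assumes L: "subgroup L G" and "g \<in> L" "x \<in> derived G L"
  shows "g \<otimes> x \<otimes> inv g \<in> derived G L"
proof -
  have "derived G L \<lhd> G \<lparr> carrier := L \<rparr>"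
    by (rule derived_subgroup_is_normal[OF L])
  then have "g \<otimes> x \<otimes> inv\<^bsub>G \<lparr> carrier := L \<rparr>\<^esub> g \<in> derived G L"
    using normal.inv_op_closed2[of "derived G L" "G \<lparr> carrier := L \<rparr>" g x] assms by simp
  then show ?thesis
    using m_inv_consistent[OF L assms(2)] by simp
qed

text \<open>Artin's argument for the independence of characters: conjugating the argument of a
  relation by g multiplies its i-th term by \<xi> i g, and subtracting \<xi> r g times the relation
  removes the last term.\<close>

lemma eigenhoms_independent:
  fixes c :: "nat \<Rightarrow> 'a \<Rightarrow> complex" and \<xi> :: "nat \<Rightarrow> 'a \<Rightarrow> real"
  assumes L: "subgroup L G"
    and nonzero: "\<And>i. i < r \<Longrightarrow> \<exists>x\<in>derived G L. c i x \<noteq> 0"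
    and conj: "\<And>i g x. i < r \<Longrightarrow> g \<in> L \<Longrightarrow> x \<in> derived G L \<Longrightarrow> c i (g \<otimes> x \<otimes> inv g) = \<xi> i g * c i x"
    and distinct: "\<And>i j. i < j \<Longrightarrow> j < r \<Longrightarrow> \<exists>g\<in>L. \<xi> i g \<noteq> \<xi> j g"
    and t: "\<And>x. x \<in> derived G L \<Longrightarrow> (\<Sum>i<r. t i * c i x) = 0"
  shows "\<forall>i<r. t i = 0"
  using assms(2-)
proof (induction r arbitrary: t)
  case (Suc r)
  have 1: "t i = 0" if i: "i < r" for i
  proof -
    obtain g where g: "g \<in> L" "\<xi> i g \<noteq> \<xi> r g"
      using Suc.prems(3)[OF i] by blast
    have "\<forall>j<r. t j * (\<xi> j g - \<xi> r g) = 0"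
    proof (rule Suc.IH)
      fix x assume x: "x \<in> derived G L"
      have "(\<Sum>j<Suc r. t j * (\<xi> j g * c j x)) = (\<Sum>j<Suc r. t j * c j (g \<otimes> x \<otimes> inv g))"
        using Suc.prems(2) g x by simp
      also have "\<dots> = 0"
        by (rule Suc.prems(4)[OF derived_conj_closed[OF L g(1) x]])
      finally have "(\<Sum>j<Suc r. t j * (\<xi> j g * c j x)) - \<xi> r g * (\<Sum>j<Suc r. t j * c j x) = 0"
        using Suc.prems(4)[OF x] by simp
      then show "(\<Sum>j<r. t j * (\<xi> j g - \<xi> r g) * c j x) = 0"
        by (simp add: sum_distrib_left sum_subtractf algebra_simps)
    qed (use Suc.prems in auto)
    then show ?thesis using g i by auto
  qed
  obtain x where "x \<in> derived G L" "c r x \<noteq> 0"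
    using Suc.prems(1) by blast
  then have "t r = 0"
    using Suc.prems(4)[of x] 1 by simp
  then show ?case using 1 by (auto simp: less_Suc_eq)
qed simp

text \<open>The derived group has unit diagonal, so \<open>growth_bound\<close> applies to it. An x
  near the identity commutes with an h at which \<xi> i differs from 1; then c i x = \<xi> i h * c i
  x, so c i x = 0. One h for each i suffices, so a common \<epsilon> exists.\<close>

lemma eigenhoms_bound:
  fixes c :: "nat \<Rightarrow> 'a \<Rightarrow> complex" and \<xi> :: "nat \<Rightarrow> 'a \<Rightarrow> real"
  assumes L: "subgroup L G"
    and nonzero: "\<And>i. i < r \<Longrightarrow> \<exists>x\<in>derived G L. c i x \<noteq> 0"
    and add: "\<And>i x y. i < r \<Longrightarrow> x \<in> derived G L \<Longrightarrow> y \<in> derived G L \<Longrightarrow> c i (x \<otimes> y) = c i x + c i y"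
    and conj: "\<And>i g x. i < r \<Longrightarrow> g \<in> L \<Longrightarrow> x \<in> derived G L \<Longrightarrow> c i (g \<otimes> x \<otimes> inv g) = \<xi> i g * c i x"
    and distinct: "\<And>i j. i < j \<Longrightarrow> j < r \<Longrightarrow> \<exists>g\<in>L. \<xi> i g \<noteq> \<xi> j g"
    and nontrivial: "\<And>i. i < r \<Longrightarrow> \<exists>g\<in>L. \<xi> i g \<noteq> 1"
    and discrete: "\<And>h. h \<in> L \<Longrightarrow> \<exists>\<epsilon>>0. \<forall>x\<in>L.
      (\<forall>p<n. \<forall>q<n. cmod (T x p q - (if p = q then 1 else 0)) < \<epsilon>) \<longrightarrow> x \<otimes> h = h \<otimes> x"
  shows "r \<le> 4 * n ^ 3"
proof -
  have D: "subgroup (derived G L) G"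
    using derived_is_subgroup subgroup.subset[OF L] by blast
  have DL: "derived G L \<subseteq> L"
    by (rule derived_incl[OF order_refl L])
  have "\<forall>i<r. \<exists>g\<in>L. \<xi> i g \<noteq> 1" using nontrivial by blast
  then obtain h where h: "\<And>i. i < r \<Longrightarrow> h i \<in> L \<and> \<xi> i (h i) \<noteq> 1"
    by metis
  have "\<forall>i<r. \<exists>\<epsilon>>0. \<forall>x\<in>L.
      (\<forall>p<n. \<forall>q<n. cmod (T x p q - (if p = q then 1 else 0)) < \<epsilon>) \<longrightarrow> x \<otimes> h i = h i \<otimes> x"
    using discrete h by blast
  then obtain e where e: "\<And>i. i < r \<Longrightarrow> e i > (0::real)"
    "\<And>i x. i < r \<Longrightarrow> x \<in> L \<Longrightarrow>
      (\<forall>p<n. \<forall>q<n. cmod (T x p q - (if p = q then 1 else 0)) < e i) \<Longrightarrow> x \<otimes> h i = h i \<otimes> x"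
    by metis
  define \<epsilon> where "\<epsilon> = Min (insert 1 (e ` {..<r}))"
  have \<epsilon>: "\<epsilon> > 0" "\<And>i. i < r \<Longrightarrow> \<epsilon> \<le> e i"
    using e(1) by (auto simp: \<epsilon>_def)
  show ?thesis
  proof (rule growth_bound[OF D _ add _ \<epsilon>(1)])
    show "T x i i = 1" if "x \<in> derived G L" "i < n" for x i
      using T_diag_derived[OF subgroup.subset[OF L]] that by blast
    show "\<forall>i<r. t i = 0" if "\<And>x. x \<in> derived G L \<Longrightarrow> (\<Sum>i<r. t i * c i x) = 0" for t
      by (rule eigenhoms_independent[OF L nonzero conj distinct that])
    fix x i assume x: "x \<in> derived G L" and i: "i < r"
      and lt: "\<And>p q. p < n \<Longrightarrow> q < n \<Longrightarrow> cmod (T x p q - (if p = q then 1 else 0)) < \<epsilon>"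
    have "x \<otimes> h i = h i \<otimes> x"
    proof (rule e(2)[OF i])
      show "\<forall>p<n. \<forall>q<n. cmod (T x p q - (if p = q then 1 else 0)) < e i"
        using lt \<epsilon>(2)[OF i] by (meson order_less_le_trans)
    qed (use x DL in auto)
    then have "h i \<otimes> x \<otimes> inv (h i) = x"
      using h[OF i] x DL subgroup.subset[OF L] by (metis inv_solve_right' subsetD m_closed)
    then have "c i x = \<xi> i (h i) * c i x"
      using conj[OF i _ x, of "h i"] h[OF i] by simp
    then show "c i x = 0"
      using h[OF i] by auto
  qed
qed

lemma hom_derived:
  assumes L: "subgroup L G" and \<phi>: "\<phi> ` L \<subseteq> L"
    and hom: "\<And>x y. x \<in> L \<Longrightarrow> y \<in> L \<Longrightarrow> \<phi> (x \<otimes> y) = \<phi> x \<otimes> \<phi> y"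
  shows "\<phi> ` derived G L = derived G (\<phi> ` L)"
proof -
  have eq: "derived G L = derived (G\<lparr>carrier := L\<rparr>) L"
    using derived_consistent[OF order_refl L] by simp
  interpret group_hom "G\<lparr>carrier := L\<rparr>" G \<phi>
    using \<phi> hom L subgroup.subset[OF L] subgroup.subgroup_is_group[OF L]
    by (intro group_hom.intro group_hom_axioms.intro) (auto simp: hom_def)
  show ?thesis
    using derived_img[of L] eq by simp
qed

text \<open>Composing c and \<xi> with powers of \<phi> preserves all conditions of
  \<open>eigenhoms_bound\<close>, because \<phi> maps L and its derived group onto themselves.
  Without a period these characters would be pairwise distinct, and 4 n^3 + 1 of them are too
  many.\<close>

lemma character_periodic:
  fixes c :: "'a \<Rightarrow> complex" and \<xi> :: "'a \<Rightarrow> real"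
  assumes L: "subgroup L G"
    and \<phi>: "\<phi> ` L = L" "\<And>x y. x \<in> L \<Longrightarrow> y \<in> L \<Longrightarrow> \<phi> (x \<otimes> y) = \<phi> x \<otimes> \<phi> y"
    and nonzero: "\<exists>x\<in>derived G L. c x \<noteq> 0"
    and add: "\<And>x y. x \<in> derived G L \<Longrightarrow> y \<in> derived G L \<Longrightarrow> c (x \<otimes> y) = c x + c y"
    and conj: "\<And>g x. g \<in> L \<Longrightarrow> x \<in> derived G L \<Longrightarrow> c (g \<otimes> x \<otimes> inv g) = \<xi> g * c x"
    and nontrivial: "\<exists>g\<in>L. \<xi> g \<noteq> 1"
    and discrete: "\<And>h. h \<in> L \<Longrightarrow> \<exists>\<epsilon>>0. \<forall>x\<in>L.
      (\<forall>p<n. \<forall>q<n. cmod (T x p q - (if p = q then 1 else 0)) < \<epsilon>) \<longrightarrow> x \<otimes> h = h \<otimes> x"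
  shows "\<exists>k>0. \<forall>x\<in>L. \<xi> ((\<phi> ^^ k) x) = \<xi> x"
proof (rule ccontr)
  assume neg: "\<not> ?thesis"
  have img: "(\<phi> ^^ i) ` L = L" for i
  proof (induction i)
    case (Suc i)
    then show ?case
      using \<phi>(1) by (metis funpow.simps(2) image_comp)
  qed simp
  have hom: "(\<phi> ^^ i) (x \<otimes> y) = (\<phi> ^^ i) x \<otimes> (\<phi> ^^ i) y" if "x \<in> L" "y \<in> L" for i x y
  proof (induction i)
    case (Suc i)
    have "(\<phi> ^^ i) x \<in> L" "(\<phi> ^^ i) y \<in> L"
      using that img by blast+
    then show ?case
      using Suc \<phi>(2) by simp
  qed simp
  have inv: "(\<phi> ^^ i) (inv x) = inv ((\<phi> ^^ i) x)" if "x \<in> L" for i x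
  proof -
    have "inv x \<in> L" "\<one> \<in> L"
      using that L by (auto simp: subgroup.m_inv_closed subgroup.one_closed)
    then have 1: "(\<phi> ^^ i) x \<in> L" "(\<phi> ^^ i) (inv x) \<in> L" "inv x \<in> L" "(\<phi> ^^ i) \<one> \<in> L"
      using that img by blast+
    then have c: "(\<phi> ^^ i) x \<in> carrier G" "(\<phi> ^^ i) (inv x) \<in> carrier G" "x \<in> carrier G" "(\<phi> ^^ i) \<one> \<in> carrier G"
      using subgroup.subset[OF L] that by auto
    have "(\<phi> ^^ i) \<one> \<otimes> (\<phi> ^^ i) \<one> = (\<phi> ^^ i) \<one>"
      using hom[of \<one> \<one> i] subgroup.one_closed[OF L] by simp
    then have "(\<phi> ^^ i) \<one> = \<one>"
      using c by (simp add: l_cancel_one)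
    then show ?thesis
      using hom[OF 1(3) that, of i] c by (simp add: inv_equality)
  qed
  have der: "(\<phi> ^^ i) ` derived G L = derived G L" for i
    using hom_derived[OF L, of "\<phi> ^^ i"] img hom by simp
  have "Suc (4 * n ^ 3) \<le> 4 * n ^ 3"
  proof (rule eigenhoms_bound[OF L, where c = "\<lambda>i. c \<circ> (\<phi> ^^ i)" and \<xi> = "\<lambda>i. \<xi> \<circ> (\<phi> ^^ i)"])
    fix i
    show "\<exists>x\<in>derived G L. (c \<circ> (\<phi> ^^ i)) x \<noteq> 0"
      using nonzero der[of i] by (metis comp_apply imageE)
    show "\<exists>g\<in>L. (\<xi> \<circ> (\<phi> ^^ i)) g \<noteq> 1"
      using nontrivial img[of i] by (metis comp_apply imageE)
  next
    fix i x y assume "x \<in> derived G L" "y \<in> derived G L"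
    moreover from this have "(\<phi> ^^ i) x \<in> derived G L" "(\<phi> ^^ i) y \<in> derived G L"
      using der by blast+
    ultimately show "(c \<circ> (\<phi> ^^ i)) (x \<otimes> y) = (c \<circ> (\<phi> ^^ i)) x + (c \<circ> (\<phi> ^^ i)) y"
      using subsetD[OF derived_incl[OF order_refl L]] hom[of x y i] add by auto
  next
    fix i g x assume gx: "g \<in> L" "x \<in> derived G L"
    then have x: "x \<in> L" using derived_incl[OF order_refl L] by auto
    have "(\<phi> ^^ i) (g \<otimes> x \<otimes> inv g) = (\<phi> ^^ i) g \<otimes> (\<phi> ^^ i) x \<otimes> inv ((\<phi> ^^ i) g)"
      using hom inv gx x L by (simp add: subgroup.m_closed subgroup.m_inv_closed)
    then show "(c \<circ> (\<phi> ^^ i)) (g \<otimes> x \<otimes> inv g) = (\<xi> \<circ> (\<phi> ^^ i)) g * (c \<circ> (\<phi> ^^ i)) x"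
      using conj[of "(\<phi> ^^ i) g" "(\<phi> ^^ i) x"] gx img[of i] der[of i] by auto
  next
    fix i j :: nat assume ij: "i < j"
    show "\<exists>g\<in>L. (\<xi> \<circ> (\<phi> ^^ i)) g \<noteq> (\<xi> \<circ> (\<phi> ^^ j)) g"
    proof (rule ccontr)
      assume "\<not> ?thesis"
      then have eq: "\<xi> ((\<phi> ^^ i) g) = \<xi> ((\<phi> ^^ (j - i)) ((\<phi> ^^ i) g))" if "g \<in> L" for g
        using that ij by (auto simp flip: funpow_add comp_apply[of "\<phi> ^^ (j - i)"])
      \<comment> \<open>The i-th power is onto L and can be cancelled, which leaves the period j - i
        > 0.\<close>
      have "\<forall>y\<in>L. \<xi> ((\<phi> ^^ (j - i)) y) = \<xi> y"
      proof
        fix y assume "y \<in> L"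
        then obtain g where "g \<in> L" "y = (\<phi> ^^ i) g" using img[of i] by blast
        then show "\<xi> ((\<phi> ^^ (j - i)) y) = \<xi> y" using eq by simp
      qed
      then show False using neg ij by (meson zero_less_diff)
    qed
  qed (use discrete in blast)
  then show False by simp
qed

end

section \<open>Invariant characters and finiteness of twisted conjugacy classes\<close>

lemma positive_character_finite_range:
  fixes x :: real
  assumes "x > 0" "finite F" "\<And>i::nat. x ^ i \<in> F"
  shows "x = 1"
proof (rule ccontr)
  assume "x \<noteq> 1"
  then have "inj (\<lambda>i. x ^ i)"
    using assms(1) by (auto intro!: injI simp: power_inject_exp')
  moreover have "finite (range (\<lambda>i. x ^ i))"
    using assms(2,3) by (auto intro: finite_subset)
  ultimately show False
    using finite_imageD by blast
qed

text \<open>Only \<open>L\<close> need be invariant under \<open>\<psi>\<close>; its values on the larger group \<open>\<Gamma>\<close> are controlled through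
  the powers \<open>x [^] m \<in> L\<close>, because positive reals have unique roots.\<close>

lemma (in group) twisted_conjugacy_finite_trivial_character:
  fixes \<xi> :: "'a \<Rightarrow> real"
  assumes \<Gamma>: "subgroup \<Gamma> G" and R: "finite R" "R \<subseteq> carrier G" "\<And>\<delta>. \<delta> \<in> carrier G \<Longrightarrow> \<exists>\<epsilon>\<in>\<Gamma>. \<exists>\<rho>\<in>R. \<delta> = \<epsilon> \<otimes> \<rho>"
    and \<psi>: "\<psi> \<in> hom G G"
    and F: "finite F" "F \<subseteq> carrier G"
      "\<And>\<gamma>. \<gamma> \<in> carrier G \<Longrightarrow> \<exists>\<gamma>0\<in>F. \<exists>\<delta>\<in>carrier G. \<gamma> = \<delta> \<otimes> \<gamma>0 \<otimes> inv (\<psi> \<delta>)"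
    and L: "subgroup L G" "L \<subseteq> \<Gamma>" and m: "m > 0" "\<And>x. x \<in> \<Gamma> \<Longrightarrow> x [^] (m::nat) \<in> L"
    and \<xi>: "\<And>x. x \<in> \<Gamma> \<Longrightarrow> \<xi> x > 0" "\<And>x y. x \<in> \<Gamma> \<Longrightarrow> y \<in> \<Gamma> \<Longrightarrow> \<xi> (x \<otimes> y) = \<xi> x * \<xi> y"
    and inv: "\<And>x. x \<in> L \<Longrightarrow> \<xi> (\<psi> x) = \<xi> x"
    and x: "x \<in> L"
  shows "\<xi> x = 1"
proof -
  interpret \<psi>: group_hom G G \<psi>
    by unfold_locales (rule \<psi>)
  have \<Gamma>c: "\<Gamma> \<subseteq> carrier G" and Lc: "L \<subseteq> carrier G"
    using \<Gamma> L subgroup.subset by blast+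
  have pow: "x [^] (i::nat) \<in> \<Gamma> \<and> \<xi> (x [^] i) = \<xi> x ^ i" if "x \<in> \<Gamma>" for x i
  proof (induction i)
    case 0
    have "\<xi> \<one> = \<xi> \<one> * \<xi> \<one>" using \<xi>(2)[of \<one> \<one>] subgroup.one_closed[OF \<Gamma>] by simp
    then show ?case using subgroup.one_closed[OF \<Gamma>] \<xi>(1)[of \<one>] by simp
  next
    case (Suc i)
    then show ?case using that \<xi>(2) subgroup.m_closed[OF \<Gamma>] by simp
  qed
  \<comment> \<open>Absorbing the coset representative \<rho> of \<delta> into the class
    representative leaves finitely many pairs (\<gamma>0, \<rho>), and the remaining twisting
    element \<epsilon> lies in \<Gamma>.\<close>
  have "\<forall>\<gamma>\<in>L. \<exists>\<gamma>0\<in>F. \<exists>\<rho>\<in>R. \<exists>\<epsilon>\<in>\<Gamma>. \<gamma> = \<epsilon> \<otimes> (\<rho> \<otimes> \<gamma>0 \<otimes> inv (\<psi> \<rho>)) \<otimes> inv (\<psi> \<epsilon>)"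
  proof
    fix \<gamma> assume "\<gamma> \<in> L"
    then obtain \<gamma>0 \<delta> where 1: "\<gamma>0 \<in> F" "\<delta> \<in> carrier G" "\<gamma> = \<delta> \<otimes> \<gamma>0 \<otimes> inv (\<psi> \<delta>)"
      using F(3) Lc by blast
    obtain \<epsilon> \<rho> where 2: "\<epsilon> \<in> \<Gamma>" "\<rho> \<in> R" "\<delta> = \<epsilon> \<otimes> \<rho>"
      using R(3)[OF 1(2)] by blast
    have "\<gamma>0 \<in> carrier G" "\<epsilon> \<in> carrier G" "\<rho> \<in> carrier G"
      using 1 2 F(2) R(2) \<Gamma>c by auto
    then have "\<gamma> = \<epsilon> \<otimes> (\<rho> \<otimes> \<gamma>0 \<otimes> inv (\<psi> \<rho>)) \<otimes> inv (\<psi> \<epsilon>)"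
      by (simp add: 1(3) 2(3) inv_mult_group m_assoc)
    then show "\<exists>\<gamma>0\<in>F. \<exists>\<rho>\<in>R. \<exists>\<epsilon>\<in>\<Gamma>. \<gamma> = \<epsilon> \<otimes> (\<rho> \<otimes> \<gamma>0 \<otimes> inv (\<psi> \<rho>)) \<otimes> inv (\<psi> \<epsilon>)"
      using 1 2 by blast
  qed
  then obtain f g e where fge: "\<And>\<gamma>. \<gamma> \<in> L \<Longrightarrow> f \<gamma> \<in> F \<and> g \<gamma> \<in> R \<and> e \<gamma> \<in> \<Gamma> \<and>
      \<gamma> = e \<gamma> \<otimes> (g \<gamma> \<otimes> f \<gamma> \<otimes> inv (\<psi> (g \<gamma>))) \<otimes> inv (\<psi> (e \<gamma>))"
    by metis
  have same: "\<xi> \<gamma> = \<xi> \<gamma>'" if \<gamma>: "\<gamma> \<in> L" "\<gamma>' \<in> L" and eq: "f \<gamma> = f \<gamma>'" "g \<gamma> = g \<gamma>'" for \<gamma> \<gamma>'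
  proof -
    define a where "a = g \<gamma> \<otimes> f \<gamma> \<otimes> inv (\<psi> (g \<gamma>))"
    have a: "a \<in> carrier G" "\<gamma> = e \<gamma> \<otimes> a \<otimes> inv (\<psi> (e \<gamma>))" "\<gamma>' = e \<gamma>' \<otimes> a \<otimes> inv (\<psi> (e \<gamma>'))"
    proof -
      have "f \<gamma>' \<in> carrier G" "g \<gamma>' \<in> carrier G"
        using fge[OF \<gamma>(2)] F(2) R(2) by auto
      then show "a \<in> carrier G"
        using eq by (simp add: a_def)
    qed (use fge[OF \<gamma>(1)] fge[OF \<gamma>(2)] eq in \<open>auto simp: a_def\<close>)
    have ec: "e \<gamma> \<in> carrier G" "e \<gamma>' \<in> carrier G" "\<gamma> \<in> carrier G" "\<gamma>' \<in> carrier G"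
      using fge[OF \<gamma>(1)] fge[OF \<gamma>(2)] \<Gamma>c Lc \<gamma> by auto
    define \<eta> where "\<eta> = e \<gamma>' \<otimes> inv (e \<gamma>)"
    have \<eta>: "\<eta> \<in> \<Gamma>" "\<eta> \<in> carrier G"
      using fge[OF \<gamma>(1)] fge[OF \<gamma>(2)] \<Gamma> \<Gamma>c by (auto simp: \<eta>_def subgroup.m_closed subgroup.m_inv_closed)
    have "inv (e \<gamma>) \<otimes> \<gamma> \<otimes> \<psi> (e \<gamma>) = a"
      by (subst a(2)) (use a(1) ec in \<open>simp add: m_assoc inv_solve_left'\<close>)
    then have "\<gamma>' = e \<gamma>' \<otimes> (inv (e \<gamma>) \<otimes> \<gamma> \<otimes> \<psi> (e \<gamma>)) \<otimes> inv (\<psi> (e \<gamma>'))"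
      using a(3) by simp
    then have \<gamma>': "\<gamma>' = \<eta> \<otimes> \<gamma> \<otimes> inv (\<psi> \<eta>)"
      using ec by (simp add: \<eta>_def inv_mult_group m_assoc)
    \<comment> \<open>This puts \<psi> \<eta> into \<Gamma>, although \<Gamma> need not be
      invariant: it is a product of three elements of \<Gamma>.\<close>
    have "\<psi> \<eta> = inv \<gamma>' \<otimes> \<eta> \<otimes> \<gamma>"
      by (subst \<gamma>') (use \<eta> ec in \<open>simp add: inv_mult_group m_assoc\<close>)
    then have \<psi>\<eta>: "\<psi> \<eta> \<in> \<Gamma>"
      using \<eta> \<gamma> L(2) \<Gamma> by (auto intro!: subgroup.m_closed subgroup.m_inv_closed)
    have "\<xi> (\<psi> \<eta>) ^ m = \<xi> (\<psi> \<eta> [^] m)"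
      using pow[OF \<psi>\<eta>] by simp
    also have "\<dots> = \<xi> (\<psi> (\<eta> [^] m))"
      using \<eta> by (simp add: \<psi>.hom_nat_pow)
    also have "\<dots> = \<xi> \<eta> ^ m"
      using inv[OF m(2)[OF \<eta>(1)]] pow[OF \<eta>(1)] by simp
    finally have eq\<xi>: "\<xi> (\<psi> \<eta>) = \<xi> \<eta>"
      using m(1) \<xi>(1)[OF \<eta>(1)] \<xi>(1)[OF \<psi>\<eta>] by (meson less_imp_le power_eq_imp_eq_base)
    have "\<gamma>' \<otimes> \<psi> \<eta> = \<eta> \<otimes> \<gamma>"
      by (subst \<gamma>') (use \<eta> ec in \<open>simp add: m_assoc\<close>)
    then have "\<xi> \<gamma>' * \<xi> (\<psi> \<eta>) = \<xi> \<eta> * \<xi> \<gamma>"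
      using \<xi>(2) \<gamma> L(2) \<eta>(1) \<psi>\<eta> by (metis subsetD)
    then show ?thesis
      using eq\<xi> \<xi>(1)[OF \<eta>(1)] by simp
  qed
  \<comment> \<open>On L the value of \<xi> depends only on the pair (f \<gamma>, g \<gamma>), which
    ranges over a finite set.\<close>
  have "finite (\<xi> ` L)"
  proof (rule finite_subset)
    define val where "val a = \<xi> (SOME \<gamma>. \<gamma> \<in> L \<and> (f \<gamma>, g \<gamma>) = a)" for a
    show "finite (val ` (F \<times> R))"
      using F(1) R(1) by simp
    show "\<xi> ` L \<subseteq> val ` (F \<times> R)"
    proof
      fix v assume "v \<in> \<xi> ` L"
      then obtain \<gamma> where \<gamma>: "\<gamma> \<in> L" "v = \<xi> \<gamma>" by blast
      define \<gamma>' where "\<gamma>' = (SOME \<gamma>'. \<gamma>' \<in> L \<and> (f \<gamma>', g \<gamma>') = (f \<gamma>, g \<gamma>))"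
      have "\<gamma>' \<in> L \<and> (f \<gamma>', g \<gamma>') = (f \<gamma>, g \<gamma>)"
        unfolding \<gamma>'_def by (rule someI[of _ \<gamma>]) (use \<gamma> in simp)
      then have "v = val (f \<gamma>, g \<gamma>)"
        using same[of \<gamma>' \<gamma>] \<gamma> by (simp add: val_def \<gamma>'_def)
      moreover have "(f \<gamma>, g \<gamma>) \<in> F \<times> R"
        using fge[OF \<gamma>(1)] by blast
      ultimately show "v \<in> val ` (F \<times> R)" by (rule image_eqI)
    qed
  qed
  moreover have "x [^] i \<in> L" for i :: nat
    by (induction i) (use x L(1) in \<open>auto simp: subgroup.one_closed subgroup.m_closed\<close>)
  then have "\<xi> x ^ i \<in> \<xi> ` L" for i
    using pow[of x i] x L(2) by (metis imageI subsetD)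
  ultimately show ?thesis
    using positive_character_finite_range[of "\<xi> x" "\<xi> ` L"] \<xi>(1) x L(2) by blast
qed

section \<open>Cocycles on cocompact subgroups\<close>

text \<open>The function descends to the compact quotient. Points there are cosets, and the
  descended function evaluates h at a chosen member; by invariance the choice does not
  matter.\<close>

lemma coset_invariant_bounded:
  fixes h :: "'s::topological_space \<Rightarrow> complex" and G :: "'s monoid"
  assumes G: "group G" "carrier G = UNIV" and \<Gamma>: "subgroup \<Gamma> G"
    and compact: "compact_space (quotient_topology euclidean (\<lambda>x. \<Gamma> #>\<^bsub>G\<^esub> x))"
    and h: "continuous_on UNIV h" "\<And>\<gamma> s. \<gamma> \<in> \<Gamma> \<Longrightarrow> h (\<gamma> \<otimes>\<^bsub>G\<^esub> s) = h s"
  shows "bounded (range h)"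
proof -
  interpret group G by (rule G(1))
  let ?q = "\<lambda>x. \<Gamma> #>\<^bsub>G\<^esub> x"
  let ?Y = "quotient_topology euclidean ?q"
  define h' where "h' A = h (SOME x. x \<in> A)" for A
  have h': "h' (?q x) = h x" for x
  proof -
    have "x \<in> ?q x"
      using rcos_self[OF _ \<Gamma>, of x] G(2) by simp
    then have "(SOME y. y \<in> ?q x) \<in> ?q x" by (rule someI)
    then obtain \<gamma> where "\<gamma> \<in> \<Gamma>" "(SOME y. y \<in> ?q x) = \<gamma> \<otimes>\<^bsub>G\<^esub> x"
      unfolding r_coset_def by blast
    then show ?thesis using h(2) by (simp add: h'_def)
  qed
  have "continuous_map ?Y euclidean h'"
    by (rule continuous_compose_quotient_map[OF quotient_map_quotient_topology])
      (use h(1) h' in \<open>simp add: o_def\<close>)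
  then have "compactin euclidean (h' ` topspace ?Y)"
    using compact image_compactin by (metis compact_space_def)
  then have "compact (h' ` range ?q)"
    by (simp add: topspace_quotient_topology)
  then have "compact (range h)"
    by (simp add: image_image h')
  then show ?thesis by (rule compact_imp_bounded)
qed

text \<open>A value above 1 is amplified by powers, and a value below 1 makes the value at the
  inverse exceed 1.\<close>

lemma positive_character_bounded:
  fixes \<xi> :: "'s \<Rightarrow> real" and G (structure)
  assumes G: "group G" "carrier G = UNIV" and pos: "\<And>s. \<xi> s > 0"
    and mult: "\<And>s t. \<xi> (s \<otimes> t) = \<xi> s * \<xi> t" and bdd: "bounded (range \<xi>)"
  shows "\<xi> s = 1"
proof -
  interpret group G by (rule G(1))
  obtain B where B: "\<And>s. \<xi> s \<le> B"
    using bdd unfolding bounded_iff by (metis abs_le_D1 rangeI real_norm_def)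
  have le: "\<xi> t \<le> 1" for t
  proof (rule ccontr)
    assume t: "\<not> \<xi> t \<le> 1"
    have "\<xi> (t [^] i) = \<xi> t ^ i" for i :: nat
    proof (induction i)
      case 0
      have "\<xi> \<one> = \<xi> \<one> * \<xi> \<one>" using mult[of \<one> \<one>] G(2) by simp
      then show ?case using pos[of \<one>] by simp
    qed (simp add: mult)
    then have "\<xi> t ^ i \<le> B" for i using B by metis
    moreover obtain i where "B < \<xi> t ^ i"
      using real_arch_pow t by (metis not_le)
    ultimately show False by (metis not_le)
  qed
  have "\<xi> s * \<xi> (inv s) = \<xi> \<one>" using mult[of s "inv s"] G(2) by simp
  moreover have "\<xi> \<one> = 1"
    using mult[of \<one> \<one>] pos[of \<one>] G(2) by simp
  ultimately have "\<xi> s * \<xi> (inv s) = 1" by simp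
  moreover have "\<xi> s * \<xi> (inv s) \<le> \<xi> s * 1"
    using le[of "inv s"] pos[of s] by (intro mult_left_mono) auto
  ultimately show ?thesis using le[of s] by simp
qed

text \<open>A cocycle for \<open>\<xi>\<close> is a homomorphism to the affine group of the line, and a coboundary is one with
  a fixed point. If \<open>\<xi>\<close> is nontrivial, the fixed point of a hyperbolic element of \<open>L\<close> is moved to the
  origin; when the commutators of \<open>L\<close> act trivially, all of \<open>L\<close>, hence \<open>\<Gamma>\<close>, fixes the origin, and
  cocompactness extends this to the whole group.\<close>

lemma cocycle_coboundary:
  fixes G :: "'s::topological_space monoid" (structure)
    and \<xi> :: "'s \<Rightarrow> real" and b :: "'s \<Rightarrow> complex"
  assumes G: "group G" "carrier G = UNIV" and \<Gamma>: "subgroup \<Gamma> G"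
    and compact: "compact_space (quotient_topology euclidean (\<lambda>x. \<Gamma> #>\<^bsub>G\<^esub> x))"
    and L: "subgroup L G" "L \<subseteq> \<Gamma>" and m: "m > 0" "\<And>x. x \<in> \<Gamma> \<Longrightarrow> x [^] (m::nat) \<in> L"
    and rigid: "\<And>c :: 's \<Rightarrow> complex. \<lbrakk>\<exists>x\<in>derived G L. c x \<noteq> (0::complex);
        \<And>x y. x \<in> derived G L \<Longrightarrow> y \<in> derived G L \<Longrightarrow> c (x \<otimes> y) = c x + c y;
        \<And>g x. g \<in> L \<Longrightarrow> x \<in> derived G L \<Longrightarrow> c (g \<otimes> x \<otimes> inv g) = \<xi> g * c x\<rbrakk>
        \<Longrightarrow> \<forall>g\<in>L. \<xi> g = 1"
    and \<xi>: "continuous_on UNIV \<xi>" "\<And>s. \<xi> s > 0" "\<And>s t. \<xi> (s \<otimes> t) = \<xi> s * \<xi> t"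
    and nontrivial: "\<exists>s. \<xi> s \<noteq> 1"
    and b: "continuous_on UNIV b" "\<And>s t. b (s \<otimes> t) = b s + \<xi> s * b t"
  shows "\<exists>\<kappa>::complex. \<forall>s. b s = \<kappa> * (1 - \<xi> s)"
proof -
  interpret group G by (rule G(1))
  have c[simp]: "x \<in> carrier G" for x using G(2) by simp
  have \<xi>1: "\<xi> \<one> = 1" using \<xi>(3)[of \<one> \<one>] \<xi>(2)[of \<one>] by simp
  have \<xi>inv: "\<xi> (inv s) = 1 / \<xi> s" for s
    using \<xi>(3)[of s "inv s"] \<xi>(2)[of s] \<xi>1 by (simp add: field_simps)
  have \<xi>pow: "\<xi> (s [^] i) = \<xi> s ^ i" for s and i :: nat
    by (induction i) (auto simp: \<xi>1 \<xi>)
  obtain \<gamma> where \<gamma>: "\<gamma> \<in> \<Gamma>" "\<xi> \<gamma> \<noteq> 1"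
  proof (rule ccontr)
    assume "\<not> thesis"
    then have "\<xi> \<gamma> = 1" if "\<gamma> \<in> \<Gamma>" for \<gamma> using that \<open>\<And>\<gamma>. \<gamma> \<in> \<Gamma> \<Longrightarrow> \<xi> \<gamma> \<noteq> 1 \<Longrightarrow> thesis\<close> by blast
    then have "bounded (range (\<lambda>s. complex_of_real (\<xi> s)))"
      by (intro coset_invariant_bounded[OF G \<Gamma> compact]) (auto simp: \<xi> intro!: continuous_intros)
    then have "bounded (range \<xi>)"
      by (simp add: bounded_iff)
    then show False
      using nontrivial positive_character_bounded[OF G \<xi>(2,3)] by blast
  qed
  define a where "a = \<gamma> [^] m"
  have a: "a \<in> L" "\<xi> a \<noteq> 1"
    using m \<gamma> \<xi>(2)[of \<gamma>] power_eq_imp_eq_base[of "\<xi> \<gamma>" m 1] by (auto simp: a_def \<xi>pow)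
  \<comment> \<open>The fixed point of the affine map attached to a: its translation part divided by
    1 minus its linear part.\<close>
  define \<kappa> where "\<kappa> = b a / (1 - \<xi> a)"
  define d where "d s = b s - \<kappa> * (1 - \<xi> s)" for s
  have d_mult: "d (s \<otimes> t) = d s + \<xi> s * d t" for s t
    by (simp add: d_def b \<xi> algebra_simps)
  have ne: "1 - complex_of_real (\<xi> a) \<noteq> 0"
    using a(2) by (metis of_real_1 of_real_eq_iff right_minus_eq)
  then have da: "d a = 0"
    by (simp add: d_def \<kappa>_def)
  have d1: "d \<one> = 0"
    using d_mult[of \<one> \<one>] \<xi>1 by simp
  have dinv: "d (inv s) = - d s / \<xi> s" for s
    using d_mult[of s "inv s"] d1 \<xi>(2)[of s] by (simp add: field_simps eq_neg_iff_add_eq_0)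
  have \<xi>der: "\<xi> x = 1" if "x \<in> derived G L" for x
  proof -
    have "x \<in> generate G (derived_set G L)"
      using that by (simp add: derived_def)
    then show ?thesis
    proof (induction rule: generate.induct)
      case (incl h)
      then show ?case using \<xi>(2) by (auto simp: \<xi> \<xi>inv less_imp_neq[symmetric])
    next
      case (inv h)
      then show ?case using \<xi>(2) by (auto simp: \<xi> \<xi>inv less_imp_neq[symmetric])
    qed (auto simp: \<xi>1 \<xi>)
  qed
  have zero_der: "d x = 0" if "x \<in> derived G L" for x
  proof (rule ccontr)
    assume "d x \<noteq> 0"
    then have "\<forall>g\<in>L. \<xi> g = 1"
      using that
    proof (intro rigid[of d])
      show "d (x \<otimes> y) = d x + d y" if "x \<in> derived G L" "y \<in> derived G L" for x y
        using that by (simp add: d_mult \<xi>der)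
      show "d (g \<otimes> x \<otimes> inv g) = \<xi> g * d x" if "g \<in> L" "x \<in> derived G L" for g x
        using that \<xi>(2)[of g] by (simp add: d_mult \<xi>der dinv \<xi> field_simps less_imp_neq[symmetric])
    qed auto
    then show False using a by blast
  qed
  have zero_L: "d x = 0" if "x \<in> L" for x
  proof -
    have "x \<otimes> a \<otimes> inv x \<otimes> inv a \<in> derived G L"
      unfolding derived_def by (rule generate.incl) (use that a(1) in blast)
    from zero_der[OF this] have "(1 - complex_of_real (\<xi> a)) * d x = 0"
      using \<xi>(2)[of x] \<xi>(2)[of a] by (simp add: d_mult dinv \<xi> \<xi>inv da field_simps)
    then show ?thesis using ne by simp
  qed
  have zero_\<Gamma>: "d x = 0" if x: "x \<in> \<Gamma>" for x
  proof -
    \<comment> \<open>Along powers a cocycle adds up to a geometric sum. Positivity of \<xi> x keeps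
      this sum away from 0, so d x vanishes as soon as d does at the m-th power of x.\<close>
    have "d (x [^] i) = d x * of_real (\<Sum>j<i. \<xi> x ^ j)" for i :: nat
      by (induction i) (simp_all add: d1 d_mult \<xi>pow algebra_simps)
    then have "d x * of_real (\<Sum>j<m. \<xi> x ^ j) = 0"
      using zero_L[OF m(2)[OF x]] by metis
    moreover have "(\<Sum>j<m. \<xi> x ^ j) > 0"
      using \<xi>(2)[of x] m(1) by (intro sum_pos) auto
    ultimately show ?thesis by (metis less_irrefl mult_eq_0_iff of_real_eq_0_iff)
  qed
  \<comment> \<open>As d vanishes on \<Gamma>, left translation by \<gamma> multiplies d and \<xi>
    by the same factor. Evaluating the bounded quotient at inv s then bounds d itself, because d
    (inv s) / \<xi> (inv s) = - d s.\<close>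
  have "bounded (range (\<lambda>s. d s / \<xi> s))"
  proof (rule coset_invariant_bounded[OF G \<Gamma> compact])
    show "continuous_on UNIV (\<lambda>s. d s / \<xi> s)"
      unfolding d_def using \<xi>(1,2) b(1) by (intro continuous_intros) (auto simp: less_imp_neq[symmetric])
    fix \<gamma> s assume "\<gamma> \<in> \<Gamma>"
    then show "d (\<gamma> \<otimes> s) / \<xi> (\<gamma> \<otimes> s) = d s / \<xi> s"
      using \<xi>(2)[of \<gamma>] by (simp add: d_mult \<xi> zero_\<Gamma> less_imp_neq[symmetric])
  qed
  then obtain B where B: "\<And>s. cmod (d s / \<xi> s) \<le> B"
    unfolding bounded_iff by blast
  have dB: "cmod (d s) \<le> B" for s
    using B[of "inv s"] \<xi>(2)[of s] by (simp add: dinv \<xi>inv norm_divide)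
  have "d s = 0" for s
  proof (rule ccontr)
    assume s: "d s \<noteq> 0"
    \<comment> \<open>The hyperbolic element oriented so as to expand: its powers multiply d s by
      \<xi> a' ^ i, against boundedness of d.\<close>
    define a' where "a' = (if \<xi> a > 1 then a else inv a)"
    have a': "\<xi> a' > 1" "d a' = 0"
      using a(2) da \<xi>(2)[of a] by (auto simp: a'_def \<xi>inv dinv)
    have "d (a' [^] i) = 0" for i :: nat
      by (induction i) (auto simp: d1 d_mult a')
    then have "cmod (d (a' [^] i \<otimes> s)) = \<xi> a' ^ i * cmod (d s)" for i :: nat
      using a'(1) by (simp add: d_mult \<xi>pow norm_mult norm_power)
    then have "\<xi> a' ^ i \<le> B / cmod (d s)" for i
      using dB s by (metis le_divide_eq zero_less_norm_iff)
    then show False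
      using real_arch_pow[OF a'(1), of "B / cmod (d s)"] by (meson not_le)
  qed
  then show ?thesis
    by (intro exI[of _ \<kappa>]) (simp add: d_def)
qed

section \<open>Splitting by weights and nilpotency\<close>

context tri_rep
begin

text \<open>The entries of (I - \<kappa> E) T (I + \<kappa> E), where E is the matrix unit at (i,
  j). The term in the square of \<kappa> carries the factor T s j i, which is 0 for i < j in a
  triangular representation.\<close>

definition elementary_conj :: "complex \<Rightarrow> nat \<Rightarrow> nat \<Rightarrow> 'a \<Rightarrow> nat \<Rightarrow> nat \<Rightarrow> complex" where
  "elementary_conj \<kappa> i j s a b =
     T s a b + (if b = j then \<kappa> * T s a i else 0) - (if a = i then \<kappa> * T s j b else 0)"

lemma tri_rep_elementary_conj:
  assumes ij: "i < j" "j < n"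
  shows "tri_rep G n (elementary_conj \<kappa> i j)"
proof unfold_locales
  fix s t a b assume st: "s \<in> carrier G" "t \<in> carrier G" and ab: "a < n" "b < n"
  have i: "i < n" using ij by simp
  have 0: "T s j i = 0" "T t j i = 0" "(\<Sum>k<n. T s j k * T t k i) = 0"
    using T_upper[OF _ ij] st T_mult[OF st ij(2) i] by auto
  \<comment> \<open>The terms supported at k = j and at k = i arise from the corrections in column j
    of the left factor and row i of the right one. Up to multiples of the entry (j, i), which is 0,
    they cancel.\<close>
  have "(\<Sum>k<n. elementary_conj \<kappa> i j s a k * elementary_conj \<kappa> i j t k b) =
    (\<Sum>k<n. T s a k * T t k b + (if b = j then \<kappa> * (T s a k * T t k i) else 0)
       - (if a = i then \<kappa> * (T s j k * T t k b) else 0)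
       - (if a = i \<and> b = j then \<kappa> * \<kappa> * (T s j k * T t k i) else 0)
       + (if k = j then \<kappa> * T s a i * (T t j b + (if b = j then \<kappa> * T t j i else 0)) else 0)
       - (if k = i then \<kappa> * T s a i * T t j b - (if a = i then \<kappa> * \<kappa> * T s j i * T t j b else 0) else 0))"
    by (rule sum.cong) (use ij in \<open>auto simp: elementary_conj_def algebra_simps\<close>)
  also have "\<dots> = elementary_conj \<kappa> i j (s \<otimes> t) a b"
    using st ab ij i 0
    by (simp add: sum.distrib sum_subtractf T_mult elementary_conj_def sum_distrib_left[symmetric]
        if_distrib[of "sum _"] cong: if_cong)
  finally show "elementary_conj \<kappa> i j (s \<otimes> t) a b =
    (\<Sum>k<n. elementary_conj \<kappa> i j s a k * elementary_conj \<kappa> i j t k b)" ..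
next
  fix a b assume "a < n" "b < n"
  then show "elementary_conj \<kappa> i j \<one> a b = (if a = b then 1 else 0)"
    using T_one ij by (simp add: elementary_conj_def)
next
  fix s a b assume "s \<in> carrier G" "b < a" "a < n"
  then show "elementary_conj \<kappa> i j s a b = 0"
    using T_upper ij by (auto simp: elementary_conj_def)
qed

lemma elementary_conj_diag:
  "s \<in> carrier G \<Longrightarrow> i < j \<Longrightarrow> j < n \<Longrightarrow> elementary_conj \<kappa> i j s a a = T s a a"
  using T_upper by (auto simp: elementary_conj_def)

text \<open>Row j and column i are left alone by the conjugation because T s j i = 0. Once they are
  known to be those of the identity, the two corrections in any other entry cancel.\<close>

lemma elementary_conj_eq_one:
  assumes s: "s \<in> carrier G" and ij: "i < j" "j < n"
    and one: "\<And>a b. a < n \<Longrightarrow> b < n \<Longrightarrow> elementary_conj \<kappa> i j s a b = (if a = b then 1 else 0)"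
    and ab: "a < n" "b < n"
  shows "T s a b = (if a = b then 1 else 0)"
proof -
  have i: "i < n" using ij by simp
  have 0: "T s j i = 0" using T_upper[OF s ij] .
  have 1: "T s j b = (if j = b then 1 else 0)"
    using one[OF ij(2) ab(2)] 0 ij by (simp add: elementary_conj_def split: if_splits)
  have 2: "T s a i = (if a = i then 1 else 0)"
    using one[OF ab(1) i] 0 ij by (simp add: elementary_conj_def split: if_splits)
  show ?thesis
    using one[OF ab] 1 2 by (simp add: elementary_conj_def split: if_splits)
qed

text \<open>Entries are cleared column by column, and upwards within a column: then the entry treated next
  is, after division by a diagonal entry, a cocycle.\<close>

lemma split_weights:
  fixes w :: "nat \<Rightarrow> 'a \<Rightarrow> real"
  assumes UNIV: "carrier G = UNIV"
    and w: "\<And>s i. s \<in> carrier G \<Longrightarrow> i < n \<Longrightarrow> w i s > 0 \<and> T s i i = w i s"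
    and adm: "\<And>i j. i < n \<Longrightarrow> j < n \<Longrightarrow> A (\<lambda>s. T s i j)"
    and A: "\<And>f g \<kappa>. A f \<Longrightarrow> A g \<Longrightarrow> A (\<lambda>s. f s + \<kappa> * g s)"
    and coboundary: "\<And>i j (b :: 'a \<Rightarrow> complex). \<lbrakk>i < n; j < n; \<exists>s\<in>carrier G. w i s \<noteq> w j s; A (\<lambda>s. b s * w j s);
        \<And>s t. s \<in> carrier G \<Longrightarrow> t \<in> carrier G \<Longrightarrow> b (s \<otimes> t) = b s + (w i s / w j s) * b t\<rbrakk>
        \<Longrightarrow> \<exists>\<kappa>::complex. \<forall>s\<in>carrier G. b s = \<kappa> * (1 - w i s / w j s)"
  shows "\<exists>T'. tri_rep G n T' \<and> (\<forall>s\<in>carrier G. \<forall>i<n. T' s i i = T s i i)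
     \<and> (\<forall>s\<in>carrier G. (\<forall>a<n. \<forall>b<n. T' s a b = (if a = b then 1 else 0)) \<longrightarrow>
          (\<forall>a<n. \<forall>b<n. T s a b = (if a = b then 1 else 0)))
     \<and> (\<forall>b<n. \<forall>a<b. (\<exists>s\<in>carrier G. w a s \<noteq> w b s) \<longrightarrow> (\<forall>s\<in>carrier G. T' s a b = 0))"
proof -
  \<comment> \<open>\<open>Q\<close> collects what every clearing step preserves; its last clause
    keeps the entries in the class A that the hypothesis on cocycles asks for.\<close>
  define Q where "Q T' \<longleftrightarrow> tri_rep G n T' \<and> (\<forall>s\<in>carrier G. \<forall>i<n. T' s i i = T s i i)
     \<and> (\<forall>s\<in>carrier G. (\<forall>a<n. \<forall>b<n. T' s a b = (if a = b then 1 else 0)) \<longrightarrow>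
          (\<forall>a<n. \<forall>b<n. T s a b = (if a = b then 1 else 0)))
     \<and> (\<forall>i<n. \<forall>j<n. A (\<lambda>s. T' s i j))" for T'
  define Z where "Z T' a b \<longleftrightarrow> ((\<exists>s\<in>carrier G. w a s \<noteq> w b s) \<longrightarrow> (\<forall>s\<in>carrier G. T' s a b = 0))"
    for T' :: "'a \<Rightarrow> nat \<Rightarrow> nat \<Rightarrow> complex" and a b
  have Q0: "Q T"
    using adm tri_rep_axioms by (auto simp: Q_def)
  have step: "\<exists>T''. Q T'' \<and> (\<forall>b<j. \<forall>a<b. Z T'' a b) \<and> (\<forall>a. p \<le> a \<and> a < j \<longrightarrow> Z T'' a j)"
    if j: "j < n" and p: "p < j" and Q: "Q T'" and cols: "\<forall>b<j. \<forall>a<b. Z T' a b"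
      and col: "\<forall>a. p < a \<and> a < j \<longrightarrow> Z T' a j" for T' j p
  proof (cases "\<exists>s\<in>carrier G. w p s \<noteq> w j s")
    case False
    then show ?thesis
      using Q cols col by (intro exI[of _ T']) (auto simp: Z_def le_less)
  next
    case True
    note Q' = Q[unfolded Q_def]
    note Q1 = Q'[THEN conjunct1] and Q2 = Q'[THEN conjunct2, THEN conjunct1]
      and Q3 = Q'[THEN conjunct2, THEN conjunct2, THEN conjunct1]
      and Q4 = Q'[THEN conjunct2, THEN conjunct2, THEN conjunct2]
    interpret T': tri_rep G n T' by (rule Q1)
    have pn: "p < n" using p j by simp
    have diag: "T' s i i = w i s" "w i s > 0" if "s \<in> carrier G" "i < n" for s i
      using Q2 w that by auto
    have wm: "w i (s \<otimes> t) = w i s * w i t" if "s \<in> carrier G" "t \<in> carrier G" "i < n" for s t i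
      using T'.T_diag_mult[OF that] diag that by (simp flip: of_real_mult)
    define b where "b s = T' s p j / w j s" for s
    have cocycle: "b (s \<otimes> t) = b s + (w p s / w j s) * b t" if st: "s \<in> carrier G" "t \<in> carrier G" for s t
    proof -
      have "T' (s \<otimes> t) p j = (\<Sum>k=p..j. T' s p k * T' t k j)"
        by (rule T'.T_mult_range[OF st pn j])
      \<comment> \<open>For p < k < j the weight at k differs from that at p or from that at j;
        accordingly the entry (p, k), in an earlier column, or (k, j), lower in this column, has
        been cleared. The two surviving terms give the cocycle rule after division by w j.\<close>
      also have "\<dots> = (\<Sum>k\<in>{p, j}. T' s p k * T' t k j)"
      proof (rule sum.mono_neutral_right)
        show "\<forall>k\<in>{p..j} - {p, j}. T' s p k * T' t k j = 0"
        proof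
          fix k assume "k \<in> {p..j} - {p, j}"
          then have k: "p < k" "k < j" by auto
          then have "Z T' p k" "Z T' k j" using cols col by auto
          moreover have "(\<exists>s\<in>carrier G. w p s \<noteq> w k s) \<or> (\<exists>s\<in>carrier G. w k s \<noteq> w j s)"
            using True by metis
          ultimately show "T' s p k * T' t k j = 0"
            using st by (auto simp: Z_def)
        qed
      qed (use p in auto)
      finally have "T' (s \<otimes> t) p j = w p s * T' t p j + T' s p j * w j t"
        using p diag st j pn by simp
      then show ?thesis
        using diag(2)[OF st(1) j] diag(2)[OF st(2) j] wm[OF st j] by (simp add: b_def field_simps)
    qed
    have Ab: "A (\<lambda>s. b s * w j s)"
    proof -
      have "(\<lambda>s. b s * w j s) = (\<lambda>s. T' s p j)"
        using diag(2)[OF _ j] UNIV by (auto simp: b_def less_imp_neq[symmetric])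
      then show ?thesis
        using Q4 pn j by simp
    qed
    from coboundary[where b = b, OF pn j True Ab cocycle]
    obtain \<kappa> :: complex where \<kappa>: "\<forall>s\<in>carrier G. b s = \<kappa> * (1 - w p s / w j s)"
      by blast
    define T'' where "T'' = T'.elementary_conj \<kappa> p j"
    have "Q T''"
      unfolding Q_def
    proof (intro conjI)
      show "tri_rep G n T''"
        unfolding T''_def by (rule T'.tri_rep_elementary_conj[OF p j])
      show "\<forall>s\<in>carrier G. \<forall>i<n. T'' s i i = T s i i"
        unfolding T''_def using T'.elementary_conj_diag[OF _ p j] Q2 by simp
      show "\<forall>s\<in>carrier G. (\<forall>a<n. \<forall>b<n. T'' s a b = (if a = b then 1 else 0)) \<longrightarrow>
          (\<forall>a<n. \<forall>b<n. T s a b = (if a = b then 1 else 0))"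
      proof (intro ballI impI)
        fix s assume s: "s \<in> carrier G" "\<forall>a<n. \<forall>b<n. T'' s a b = (if a = b then 1 else 0)"
        have "\<forall>a<n. \<forall>b<n. T' s a b = (if a = b then 1 else 0)"
          using T'.elementary_conj_eq_one[OF s(1) p j, of \<kappa>] s(2) by (simp add: T''_def)
        then show "\<forall>a<n. \<forall>b<n. T s a b = (if a = b then 1 else 0)"
          using Q3 s(1) by blast
      qed
      show "\<forall>i<n. \<forall>k<n. A (\<lambda>s. T'' s i k)"
      proof (intro allI impI)
        fix i k assume ik: "i < n" "k < n"
        have A': "A (\<lambda>s. T' s i k)" if "i < n" "k < n" for i k using Q4 that by blast
        have "A (\<lambda>s. T' s i k + (if k = j then \<kappa> else 0) * T' s i p + (if i = p then - \<kappa> else 0) * T' s j k)"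
          by (intro A A' ik pn j)
        moreover have "(\<lambda>s. T' s i k + (if k = j then \<kappa> else 0) * T' s i p + (if i = p then - \<kappa> else 0) * T' s j k) = (\<lambda>s. T'' s i k)"
          by (auto simp: T''_def T'.elementary_conj_def)
        ultimately show "A (\<lambda>s. T'' s i k)" by simp
      qed
    qed
    \<comment> \<open>Cleared entries stay cleared: row p changes by a multiple of row j and column
      j by a multiple of column p, and at the positions concerned these contribute entries from
      below the diagonal.\<close>
    moreover have "Z T'' a b" if "b < j" "a < b" for a b
      using cols that T'.T_upper[of _ b j] j by (auto simp: Z_def T''_def T'.elementary_conj_def)
    moreover have "Z T'' a j" if "p < a" "a < j" for a
      using col that T'.T_upper[of _ p a] j by (auto simp: Z_def T''_def T'.elementary_conj_def)
    moreover have "Z T'' p j"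
      unfolding Z_def
    proof (intro impI ballI)
      fix s assume s: "s \<in> carrier G"
      have "T' s p j = \<kappa> * (w j s - w p s)"
        using \<kappa>[rule_format, OF s] diag(2)[OF s j] by (simp add: b_def field_simps)
      then show "T'' s p j = 0"
        using p diag(1)[OF s pn] diag(1)[OF s j] by (simp add: T''_def T'.elementary_conj_def algebra_simps)
    qed
    ultimately show ?thesis
      by (intro exI[of _ T'']) (auto simp: le_less)
  qed
  \<comment> \<open>The number d counts cleared positions from the diagonal upwards; truncated
    subtraction makes d = j stand for the whole column.\<close>
  have inner: "\<exists>T''. Q T'' \<and> (\<forall>b<j. \<forall>a<b. Z T'' a b) \<and> (\<forall>a. j - d \<le> a \<and> a < j \<longrightarrow> Z T'' a j)"
    if "j < n" "Q T'" "\<forall>b<j. \<forall>a<b. Z T' a b" for j T' d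
  proof (induction d)
    case 0
    then show ?case using that by auto
  next
    case (Suc d)
    then obtain T'' where T'': "Q T''" "\<forall>b<j. \<forall>a<b. Z T'' a b" "\<forall>a. j - d \<le> a \<and> a < j \<longrightarrow> Z T'' a j"
      by blast
    show ?case
    proof (cases "d < j")
      case True
      then have "\<forall>a. j - Suc d < a \<and> a < j \<longrightarrow> Z T'' a j"
        using T''(3) by auto
      from step[OF that(1) _ T''(1,2) this] True show ?thesis by simp
    next
      case False
      then show ?thesis using T'' by (intro exI[of _ T'']) auto
    qed
  qed
  have "\<exists>T''. Q T'' \<and> (\<forall>b<j. \<forall>a<b. Z T'' a b)" if "j \<le> n" for j
    using that
  proof (induction j)
    case 0
    then show ?case using Q0 by auto
  next
    case (Suc j)
    then obtain T' where "Q T'" "\<forall>b<j. \<forall>a<b. Z T' a b" by auto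
    from inner[OF _ this, of j] Suc.prems obtain T'' where
      "Q T''" "\<forall>b<j. \<forall>a<b. Z T'' a b" "\<forall>a. j - j \<le> a \<and> a < j \<longrightarrow> Z T'' a j" by auto
    then show ?case by (intro exI[of _ T'']) (auto simp: less_Suc_eq)
  qed
  from this[of n] obtain T'' where "Q T''" "\<forall>b<n. \<forall>a<b. Z T'' a b" by auto
  then show ?thesis
    unfolding Q_def Z_def by blast
qed

text \<open>The filtration of the unipotent part by superdiagonals. Levels 0 and 1 both say only
  that the diagonal is 1, since b - a < 1 excludes a < b; passing from a level d \<ge> 1 to the next
  one clears distance d from the diagonal.\<close>

definition unipotent_level :: "nat \<Rightarrow> 'a set" where
  "unipotent_level d = {x \<in> carrier G. (\<forall>a<n. T x a a = 1) \<and> (\<forall>b<n. \<forall>a<b. b - a < d \<longrightarrow> T x a b = 0)}"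

lemma subgroup_unipotent_level: "subgroup (unipotent_level d) G"
proof
  show "unipotent_level d \<subseteq> carrier G"
    by (auto simp: unipotent_level_def)
  show "\<one> \<in> unipotent_level d"
    using T_one by (auto simp: unipotent_level_def)
next
  fix x y assume x: "x \<in> unipotent_level d" and y: "y \<in> unipotent_level d"
  have c: "x \<in> carrier G" "y \<in> carrier G"
    using x y by (auto simp: unipotent_level_def)
  have "T (x \<otimes> y) a b = 0" if "b < n" "a < b" "b - a < d" for a b
  proof -
    have "T x a k * T y k b = 0" if k: "k \<in> {a..b}" for k
    proof (cases "k = b")
      case True
      then show ?thesis using x that \<open>b < n\<close> \<open>a < b\<close> \<open>b - a < d\<close> by (simp add: unipotent_level_def)
    next
      case False
      then have "k < b" "b - k < d" using k \<open>b - a < d\<close> by auto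
      then show ?thesis using y \<open>b < n\<close> by (simp add: unipotent_level_def)
    qed
    then have "(\<Sum>k=a..b. T x a k * T y k b) = 0"
      by (intro sum.neutral) auto
    then show ?thesis using T_mult_range[OF c, of a b] that by simp
  qed
  then show "x \<otimes> y \<in> unipotent_level d"
    using x y c T_diag_mult[OF c] by (simp add: unipotent_level_def)
next
  fix x assume x: "x \<in> unipotent_level d"
  have c: "x \<in> carrier G" using x by (auto simp: unipotent_level_def)
  have "T (inv x) a b = 0" if "b < n" "a < b" "b - a < d" for a b
  proof -
    have "T (x \<otimes> inv x) a b = (\<Sum>k=a..b. T x a k * T (inv x) k b)"
      using c that by (intro T_mult_range) auto
    also have "\<dots> = (\<Sum>k\<in>{a}. T x a k * T (inv x) k b)"
      using x that by (intro sum.mono_neutral_right) (auto simp: unipotent_level_def)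
    finally show ?thesis
      using c x that T_one[of a b] by (simp add: unipotent_level_def)
  qed
  moreover have "T (inv x) a a = 1" if "a < n" for a
    using T_diag_inv[OF c that] x that by (simp add: unipotent_level_def)
  ultimately show "inv x \<in> unipotent_level d"
    using c by (simp add: unipotent_level_def)
qed

text \<open>At distance d the matrices of h g and g h differ by T h a b (T g b b - T g a a): either
  the two weights agree, or the entry of h is 0 by the splitting. So the products agree up to that
  distance, and c (g h) = h g with c of unit diagonal forces the entries of c there to
  vanish.\<close>

lemma commutator_unipotent_level:
  assumes split: "\<And>a b. b < n \<Longrightarrow> a < b \<Longrightarrow> (\<exists>s\<in>carrier G. T s a a \<noteq> T s b b) \<Longrightarrow> \<forall>s\<in>carrier G. T s a b = 0"
    and h: "h \<in> unipotent_level d" and g: "g \<in> carrier G"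
  shows "h \<otimes> g \<otimes> inv h \<otimes> inv g \<in> unipotent_level (Suc d)"
proof -
  define c where "c = h \<otimes> g \<otimes> inv h \<otimes> inv g"
  have hc: "h \<in> carrier G" using h by (simp add: unipotent_level_def)
  have c: "c \<in> carrier G" "c \<otimes> (g \<otimes> h) = h \<otimes> g"
    using hc g by (auto simp: c_def m_assoc) (simp add: m_assoc[symmetric])
  have diag: "T c a a = 1" if "a < n" for a
    unfolding c_def by (rule T_diag_commutator[OF hc g that])
  have swap: "T (g \<otimes> h) a b = T (h \<otimes> g) a b" if ab: "b < n" "a < b" "b - a \<le> d" for a b
  proof -
    have "T (h \<otimes> g) a b = (\<Sum>k=a..b. T h a k * T g k b)"
      using hc g ab by (intro T_mult_range) auto
    also have "\<dots> = (\<Sum>k\<in>{a, b}. T h a k * T g k b)"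
      using h ab by (intro sum.mono_neutral_right) (auto simp: unipotent_level_def)
    finally have 1: "T (h \<otimes> g) a b = T g a b + T h a b * T g b b"
      using h ab by (simp add: unipotent_level_def)
    have "T (g \<otimes> h) a b = (\<Sum>k=a..b. T g a k * T h k b)"
      using hc g ab by (intro T_mult_range) auto
    also have "\<dots> = (\<Sum>k\<in>{a, b}. T g a k * T h k b)"
      using h ab by (intro sum.mono_neutral_right) (auto simp: unipotent_level_def)
    finally have 2: "T (g \<otimes> h) a b = T g a b + T h a b * T g a a"
      using h ab by (simp add: unipotent_level_def)
    show ?thesis
    proof (cases "\<exists>s\<in>carrier G. T s a a \<noteq> T s b b")
      case True
      then have "T h a b = 0" using split ab hc by blast
      then show ?thesis using 1 2 by simp
    next
      case False
      then show ?thesis using 1 2 g by auto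
    qed
  qed
  have "T c a b = 0" if "b < n" "a < b" "b - a \<le> d" for a b
    using that
  proof (induction "b - a" arbitrary: a b rule: less_induct)
    case less
    have "T (c \<otimes> (g \<otimes> h)) a b = (\<Sum>k=a..b. T c a k * T (g \<otimes> h) k b)"
      using hc g c less.prems by (intro T_mult_range) auto
    also have "\<dots> = (\<Sum>k\<in>{a, b}. T c a k * T (g \<otimes> h) k b)"
    proof (rule sum.mono_neutral_right)
      show "\<forall>k\<in>{a..b} - {a, b}. T c a k * T (g \<otimes> h) k b = 0"
      proof
        fix k assume "k \<in> {a..b} - {a, b}"
        then have "T c a k = 0"
          using less.prems by (intro less.hyps) auto
        then show "T c a k * T (g \<otimes> h) k b = 0" by simp
      qed
    qed (use less.prems in auto)
    finally have "T c a b * T (g \<otimes> h) b b = 0"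
      using c(2) swap[OF less.prems] diag[of a] less.prems by simp
    then show ?case
      using T_diag_nonzero[of "g \<otimes> h" b] hc g less.prems by simp
  qed
  then show ?thesis
    using c diag by (simp add: unipotent_level_def c_def less_Suc_eq_le)
qed

end

text \<open>After n + 1 steps the series consists of elements whose matrix is the identity. By
  \<open>ker\<close> these are central, so one more commutator step ends the series.\<close>

lemma nilpotent_if_split:
  fixes G :: "'a monoid"
  assumes rep: "tri_rep G n T"
    and split: "\<And>a b. b < n \<Longrightarrow> a < b \<Longrightarrow> (\<exists>s\<in>carrier G. T s a a \<noteq> T s b b) \<Longrightarrow> \<forall>s\<in>carrier G. T s a b = 0"
    and ker: "\<And>x g. \<lbrakk>x \<in> carrier G; g \<in> carrier G; \<forall>a<n. \<forall>b<n. T x a b = (if a = b then 1 else 0)\<rbrakk>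
        \<Longrightarrow> x \<otimes>\<^bsub>G\<^esub> g = g \<otimes>\<^bsub>G\<^esub> x"
  shows "nilpotent_group G"
proof -
  interpret tri_rep G n T by (rule rep)
  \<comment> \<open>The induction starts with the commutators: the group itself need not have unit
    diagonal, but its derived group does.\<close>
  have step: "lower_central G (Suc k) \<subseteq> unipotent_level (Suc k)" for k
  proof (induction k)
    case 0
    have "{h \<otimes>\<^bsub>G\<^esub> g \<otimes>\<^bsub>G\<^esub> inv\<^bsub>G\<^esub> h \<otimes>\<^bsub>G\<^esub> inv\<^bsub>G\<^esub> g | h g. h \<in> carrier G \<and> g \<in> carrier G} \<subseteq> unipotent_level (Suc 0)"
      using T_diag_commutator by (auto simp: unipotent_level_def)
    then show ?case
      using generate_subgroup_incl[OF _ subgroup_unipotent_level] by simp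
  next
    case (Suc k)
    have "{h \<otimes>\<^bsub>G\<^esub> g \<otimes>\<^bsub>G\<^esub> inv\<^bsub>G\<^esub> h \<otimes>\<^bsub>G\<^esub> inv\<^bsub>G\<^esub> g | h g. h \<in> lower_central G (Suc k) \<and> g \<in> carrier G}
        \<subseteq> unipotent_level (Suc (Suc k))"
      using commutator_unipotent_level[OF split] Suc.IH by blast
    then show ?case
      using generate_subgroup_incl[OF _ subgroup_unipotent_level] by (simp only: lower_central.simps)
  qed
  have central: "x \<otimes>\<^bsub>G\<^esub> g = g \<otimes>\<^bsub>G\<^esub> x" "x \<in> carrier G"
    if "x \<in> lower_central G (Suc n)" "g \<in> carrier G" for x g
  proof -
    have x: "x \<in> unipotent_level (Suc n)" using step that by blast
    then show "x \<in> carrier G" by (simp add: unipotent_level_def)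
    moreover have "\<forall>a<n. \<forall>b<n. T x a b = (if a = b then 1 else 0)"
    proof (intro allI impI)
      fix a b assume ab: "a < n" "b < n"
      then show "T x a b = (if a = b then 1 else 0)"
        using x T_upper[of x b a] by (cases a b rule: linorder_cases) (auto simp: unipotent_level_def)
    qed
    ultimately show "x \<otimes>\<^bsub>G\<^esub> g = g \<otimes>\<^bsub>G\<^esub> x"
      using ker that by blast
  qed
  have "h \<otimes>\<^bsub>G\<^esub> g \<otimes>\<^bsub>G\<^esub> inv\<^bsub>G\<^esub> h \<otimes>\<^bsub>G\<^esub> inv\<^bsub>G\<^esub> g = \<one>\<^bsub>G\<^esub>"
    if "h \<in> lower_central G (Suc n)" "g \<in> carrier G" for h g
    using central[OF that] that(2) by (simp add: m_assoc)
  then have "{h \<otimes>\<^bsub>G\<^esub> g \<otimes>\<^bsub>G\<^esub> inv\<^bsub>G\<^esub> h \<otimes>\<^bsub>G\<^esub> inv\<^bsub>G\<^esub> g | h g. h \<in> lower_central G (Suc n) \<and> g \<in> carrier G} \<subseteq> {\<one>\<^bsub>G\<^esub>}"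
    by blast
  then have "lower_central G (Suc (Suc n)) \<subseteq> {\<one>\<^bsub>G\<^esub>}"
    using generate_subgroup_incl[OF _ triv_subgroup] by (simp only: lower_central.simps)
  moreover have "\<one>\<^bsub>G\<^esub> \<in> lower_central G (Suc (Suc n))"
    by (simp only: lower_central.simps) (rule generate.one)
  ultimately show ?thesis
    unfolding nilpotent_group_def by blast
qed

section \<open>Triangularisation of connected solvable groups\<close>

definition poly_apply :: "complex^'n^'n \<Rightarrow> complex poly \<Rightarrow> complex^'n \<Rightarrow> complex^'n" where
  "poly_apply A p v = fold_coeffs (\<lambda>a w. a *s v + A *v w) p 0"

lemma poly_apply_0 [simp]: "poly_apply A 0 v = 0"
  by (simp add: poly_apply_def)

lemma poly_apply_pCons [simp]: "poly_apply A (pCons a p) v = a *s v + A *v poly_apply A p v"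
  by (cases "p = 0 \<and> a = 0") (auto simp: poly_apply_def)

lemma poly_apply_add: "poly_apply A (p + q) v = poly_apply A p v + poly_apply A q v"
  by (induction p q rule: poly_induct2)
    (simp_all add: vec.add vector_sadd_rdistrib)

lemma poly_apply_smult: "poly_apply A (smult c p) v = c *s poly_apply A p v"
  by (induction p) (simp_all add: vec.scale vector_add_ldistrib)

lemma poly_apply_monom: "poly_apply A (monom c i) v = c *s ((*v) A ^^ i) v"
  by (induction i) (simp_all add: monom_0 monom_Suc vec.scale)

lemma poly_apply_sum: "poly_apply A (\<Sum>i\<in>I. p i) v = (\<Sum>i\<in>I. poly_apply A (p i) v)"
  by (induction I rule: infinite_finite_induct) (simp_all add: poly_apply_add)

lemma poly_apply_linear_factor:
  "poly_apply A ([:-\<mu>, 1:] * q) v = A *v poly_apply A q v - \<mu> *s poly_apply A q v"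
proof -
  have "[:-\<mu>, 1:] * q = pCons 0 q + smult (- \<mu>) q" by simp
  then show ?thesis
    by (simp only: poly_apply_add poly_apply_smult) simp
qed

lemma poly_apply_mem:
  assumes "vec.subspace V" "\<And>v. v \<in> V \<Longrightarrow> A *v v \<in> V" "v \<in> V"
  shows "poly_apply A p v \<in> V"
  using assms by (induction p) (auto simp: vec.subspace_0 vec.subspace_add vec.subspace_scale)

lemma poly_apply_eigenvector_mod:
  assumes W: "vec.subspace W" "\<And>w. w \<in> W \<Longrightarrow> A *v w \<in> W" and v: "A *v v - \<mu> *s v \<in> W"
  shows "poly_apply A p v - poly p \<mu> *s v \<in> W"
proof (induction p)
  case 0
  then show ?case using W(1) by (simp add: vec.subspace_0)
next
  case (pCons a p)
  have "poly_apply A (pCons a p) v - poly (pCons a p) \<mu> *s v =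
      A *v (poly_apply A p v - poly p \<mu> *s v) + poly p \<mu> *s (A *v v - \<mu> *s v)"
    by (simp add: vec.diff vec.scale vector_sadd_rdistrib vector_ssub_ldistrib vec.scale_right_diff_distrib mult.commute)
  also have "\<dots> \<in> W"
    using pCons W v by (intro vec.subspace_add vec.subspace_scale) auto
  finally show ?case .
qed

text \<open>The powers of A up to the real dimension of the matrix space are one too many to be
  independent. A coincidence between two powers is treated apart, because dependence is a property
  of the set of powers.\<close>

lemma annihilating_poly: "\<exists>p\<noteq>0. \<forall>v. poly_apply (A::complex^'n^'n) p v = 0"
proof -
  define f where "f i = ((**) A ^^ i) (mat 1)" for i
  have f: "f i *v v = ((*v) A ^^ i) v" for i v
    by (induction i) (simp_all add: f_def matrix_vector_mul_assoc[symmetric])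
  define d where "d = DIM(complex^'n^'n)"
  show ?thesis
  proof (cases "inj_on f {..d}")
    case False
    then obtain i j where ij: "i \<noteq> j" "f i = f j" by (auto simp: inj_on_def)
    let ?p = "monom 1 i + monom (-1) j :: complex poly"
    have "coeff ?p i \<noteq> 0" using ij by simp
    then have "?p \<noteq> 0" by (metis coeff_0)
    moreover have "poly_apply A ?p v = 0" for v
      using arg_cong[OF ij(2), of "\<lambda>M. M *v v"] by (simp add: poly_apply_add poly_apply_monom f)
    ultimately show ?thesis by blast
  next
    case True
    then have "card (f ` {..d}) = Suc d" by (simp add: card_image)
    then have "dependent (f ` {..d})"
      by (intro dependent_biggerset) (auto simp: d_def)
    then obtain u where u: "\<exists>M\<in>f ` {..d}. u M \<noteq> 0" "(\<Sum>M\<in>f ` {..d}. u M *\<^sub>R M) = 0"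
      using dependent_finite[of "f ` {..d}"] by auto
    define p where "p = (\<Sum>i\<le>d. monom (complex_of_real (u (f i))) i)"
    have coeff: "coeff p i = u (f i)" if "i \<le> d" for i
      using that by (simp add: p_def coeff_sum if_distrib[of "\<lambda>x. x = _"])
    then have "p \<noteq> 0" using u(1) by force
    moreover have "poly_apply A p v = 0" for v
    proof -
      have "poly_apply A p v = (\<Sum>i\<le>d. complex_of_real (u (f i)) *s (f i *v v))"
        by (simp add: p_def poly_apply_sum poly_apply_monom f)
      also have "\<dots> = (\<Sum>i\<le>d. (u (f i) *\<^sub>R f i) *v v)"
        by (intro sum.cong refl)
          (simp add: vec_eq_iff matrix_vector_mult_def sum_distrib_left scaleR_conv_of_real[of _ "_ :: complex"] mult.assoc)
      also have "\<dots> = (\<Sum>i\<le>d. u (f i) *\<^sub>R f i) *v v"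
        by (induction d) (simp_all add: matrix_vector_mult_add_rdistrib)
      also have "(\<Sum>i\<le>d. u (f i) *\<^sub>R f i) = 0"
        using u(2) True by (simp add: sum.reindex)
      finally show ?thesis by simp
    qed
    ultimately show ?thesis by blast
  qed
qed

text \<open>The eigenvalues of A on quotients by invariant subspaces. All W enter, so the set
  depends on A alone, and a family of eigenvalues that arise modulo a fixed W takes its values in
  this one set.\<close>

definition quotient_eigenvalues :: "complex^'n^'n \<Rightarrow> complex set" where
  "quotient_eigenvalues A = {\<mu>. \<exists>W v. vec.subspace W \<and> (\<forall>w\<in>W. A *v w \<in> W) \<and> v \<notin> W \<and> A *v v - \<mu> *s v \<in> W}"

lemma quotient_eigenvaluesI:
  "\<lbrakk>vec.subspace W; \<And>w. w \<in> W \<Longrightarrow> A *v w \<in> W; v \<notin> W; A *v v - \<mu> *s v \<in> W\<rbrakk> \<Longrightarrow> \<mu> \<in> quotient_eigenvalues A"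
  unfolding quotient_eigenvalues_def by blast

text \<open>Modulo W a polynomial in A acts on the eigenvector through its value at \<mu>, so \<mu>
  is a root of any annihilating polynomial.\<close>

lemma finite_quotient_eigenvalues: "finite (quotient_eigenvalues (A :: complex^'n^'n))"
proof -
  obtain p where p: "p \<noteq> 0" "\<And>v. poly_apply A p v = 0"
    using annihilating_poly by blast
  have "poly p \<mu> = 0" if \<mu>: "\<mu> \<in> quotient_eigenvalues A" for \<mu>
  proof (rule ccontr)
    assume ne: "poly p \<mu> \<noteq> 0"
    obtain W v where W: "vec.subspace W" "\<forall>w\<in>W. A *v w \<in> W" and v: "v \<notin> W" "A *v v - \<mu> *s v \<in> W"
      using \<mu> unfolding quotient_eigenvalues_def by blast
    have "0 - poly p \<mu> *s v \<in> W"
      using poly_apply_eigenvector_mod[OF W(1) _ v(2), of p] W(2) p(2) by simp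
    from vec.subspace_scale[OF W(1) this, of "- (1 / poly p \<mu>)"] show False
      using v(1) ne by simp
  qed
  then have "quotient_eigenvalues A \<subseteq> {\<mu>. poly p \<mu> = 0}" by blast
  then show ?thesis
    using poly_roots_finite[OF p(1)] finite_subset by blast
qed

text \<open>Linear factors are stripped off a polynomial that takes x into W. The first vector found
  outside W is sent into W by the factor A - \<mu> just removed, and it stays in V as a polynomial
  in A applied to x.\<close>

lemma eigenvector_mod_exists:
  fixes A :: "complex^'n^'n"
  assumes W: "vec.subspace W" "\<And>w. w \<in> W \<Longrightarrow> A *v w \<in> W"
    and V: "vec.subspace V" "\<And>v. v \<in> V \<Longrightarrow> A *v v \<in> V" and x: "x \<in> V" "x \<notin> W"
  shows "\<exists>v\<in>V - W. \<exists>\<mu>. A *v v - \<mu> *s v \<in> W"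
proof -
  have "\<exists>v\<in>V - W. \<exists>\<mu>. A *v v - \<mu> *s v \<in> W" if "p \<noteq> 0" "poly_apply A p x \<in> W" for p
    using that
  proof (induction "degree p" arbitrary: p)
    case 0
    then obtain c where c: "p = [:c:]" "c \<noteq> 0" by (metis degree_eq_zeroE pCons_0_0)
    then have "c *s x \<in> W" using 0 by (simp add: W)
    from vec.subspace_scale[OF W(1) this, of "1 / c"] show ?case
      using c x by simp
  next
    case (Suc d)
    then have "\<not> constant (poly p)"
      by (metis constant_degree nat.distinct(1))
    then obtain \<mu> where "poly p \<mu> = 0"
      using fundamental_theorem_of_algebra by blast
    then obtain q where q: "p = [:-\<mu>, 1:] * q"
      by (metis dvdE poly_eq_0_iff_dvd)
    have q0: "q \<noteq> 0" using q Suc.prems by auto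
    have deg: "d = degree q"
      using Suc.hyps(2) q0 by (simp add: q degree_mult_eq del: mult_pCons_left)
    show ?case
    proof (cases "poly_apply A q x \<in> W")
      case True
      then show ?thesis using Suc.hyps(1)[OF deg q0] by blast
    next
      case False
      then show ?thesis
        using Suc.prems(2) poly_apply_mem[OF V x(1)]
        unfolding q poly_apply_linear_factor by blast
    qed
  qed
  moreover obtain p where "p \<noteq> 0" "poly_apply A p x = 0"
    using annihilating_poly by blast
  ultimately show ?thesis
    using vec.subspace_0[OF W(1)] by metis
qed

text \<open>Stated with closed level sets instead of continuity, because the eigenvalue functions it
  serves are given implicitly, by membership of vectors in a closed subspace.\<close>

lemma connected_finite_range_constant:
  assumes H: "connected H" and Z: "finite Z" "\<And>h. h \<in> H \<Longrightarrow> f h \<in> Z"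
    and closed: "\<And>z. z \<in> Z \<Longrightarrow> closedin (top_of_set H) {h \<in> H. f h = z}" and ab: "a \<in> H" "b \<in> H"
  shows "f a = f b"
proof (rule ccontr)
  assume ne: "f a \<noteq> f b"
  define B where "B = (\<Union>z\<in>Z - {f a}. {h \<in> H. f h = z})"
  have "closedin (top_of_set H) {h \<in> H. f h = f a}" "closedin (top_of_set H) B"
    unfolding B_def using Z ab closed by (auto intro!: closedin_Union)
  moreover have "H \<subseteq> {h \<in> H. f h = f a} \<union> B" "{h \<in> H. f h = f a} \<inter> B = {}"
    using Z by (auto simp: B_def)
  moreover have "{h \<in> H. f h = f a} \<noteq> {}" "B \<noteq> {}"
    using ab ne Z by (auto simp: B_def)
  ultimately show False
    using H unfolding connected_closedin by blast
qed

section \<open>Connectedness of derived groups\<close>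

locale top_group = group G for G :: "'s::topological_space monoid" (structure) +
  assumes carrier_UNIV [simp]: "carrier G = UNIV"
    and continuous_mult: "continuous_on UNIV (\<lambda>(x, y). x \<otimes> y)"
    and continuous_inv: "continuous_on UNIV (\<lambda>x. inv x)"
begin

lemma continuous_on_mult [continuous_intros]:
  "continuous_on X f \<Longrightarrow> continuous_on X g \<Longrightarrow> continuous_on X (\<lambda>x. f x \<otimes> g x)"
  using continuous_on_compose2[OF continuous_mult, of X "\<lambda>x. (f x, g x)"]
  by (auto intro: continuous_on_Pair)

lemma continuous_on_inv [continuous_intros]:
  "continuous_on X f \<Longrightarrow> continuous_on X (\<lambda>x. inv (f x))"
  using continuous_on_compose2[OF continuous_inv] by auto

text \<open>Every generated element lies together with \<one> in a connected subset of the generated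
  group; for a product, the product of the two subsets serves.\<close>

lemma connected_generate:
  assumes K: "connected K" "\<one> \<in> K" "\<And>k. k \<in> K \<Longrightarrow> inv k \<in> K"
  shows "connected (generate G K)"
proof -
  have "\<exists>C. connected C \<and> \<one> \<in> C \<and> x \<in> C \<and> C \<subseteq> generate G K" if "x \<in> generate G K" for x
    using that
  proof (induction rule: generate.induct)
    case one
    then show ?case by (intro exI[of _ "{\<one>}"]) (auto intro: generate.one)
  next
    case (incl h)
    then show ?case using K by (intro exI[of _ K]) (auto intro: generate.incl)
  next
    case (inv h)
    then show ?case using K by (intro exI[of _ K]) (auto intro: generate.incl)
  next
    case (eng h1 h2)
    then obtain A B where A: "connected A" "\<one> \<in> A" "h1 \<in> A" "A \<subseteq> generate G K"
      and B: "connected B" "\<one> \<in> B" "h2 \<in> B" "B \<subseteq> generate G K" by blast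
    let ?C = "(\<lambda>(x, y). x \<otimes> y) ` (A \<times> B)"
    have "connected ?C"
      by (intro connected_continuous_image connected_Times A B continuous_on_subset[OF continuous_mult]) auto
    moreover have "\<one> \<in> ?C"
      using A B by (intro image_eqI[of _ _ "(\<one>, \<one>)"]) auto
    moreover have "h1 \<otimes> h2 \<in> ?C"
      using A B by (intro image_eqI[of _ _ "(h1, h2)"]) auto
    moreover have "?C \<subseteq> generate G K"
      using A B by (auto intro: generate.eng)
    ultimately show ?case by blast
  qed
  then have "\<forall>x\<in>generate G K. \<forall>y\<in>generate G K. \<exists>C. connected C \<and> C \<subseteq> generate G K \<and> x \<in> C \<and> y \<in> C"
    by (metis (no_types, lifting) connected_Un disjoint_iff le_sup_iff UnCI)
  then show ?thesis
    by (metis connected_iff_connected_component connected_component_def)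
qed

text \<open>The commutators are a continuous image of H \<times> H, and the inverse of the
  commutator of x and y is that of y and x, so \<open>connected_generate\<close> applies.\<close>

lemma connected_derived:
  assumes H: "connected H" "subgroup H G"
  shows "connected (derived G H)"
proof -
  let ?c = "\<lambda>(x, y). x \<otimes> y \<otimes> inv x \<otimes> inv y"
  have eq: "derived_set G H = ?c ` (H \<times> H)"
    by auto
  show ?thesis
    unfolding derived_def
  proof (rule connected_generate)
    show "connected (derived_set G H)"
      unfolding eq case_prod_unfold
      by (intro connected_continuous_image connected_Times H continuous_intros)
    show "\<one> \<in> derived_set G H"
      unfolding eq using subgroup.one_closed[OF H(2)] by (intro image_eqI[of _ _ "(\<one>, \<one>)"]) auto
    fix k assume "k \<in> derived_set G H"
    then obtain x y where "x \<in> H" "y \<in> H" "k = x \<otimes> y \<otimes> inv x \<otimes> inv y" by blast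
    then show "inv k \<in> derived_set G H"
      unfolding eq by (intro image_eqI[of _ _ "(y, x)"]) (auto simp: inv_mult_group m_assoc)
  qed
qed

end

section \<open>Lie's theorem for connected solvable groups\<close>

locale top_group_rep = top_group G for G :: "'s::topological_space monoid" (structure) +
  fixes \<rho> :: "'s \<Rightarrow> complex^'n^'n"
  assumes rep_mult: "\<rho> (s \<otimes> t) = \<rho> s ** \<rho> t"
    and rep_one: "\<rho> \<one> = mat 1"
    and rep_cont: "continuous_on UNIV \<rho>"
begin

definition invariant :: "'s set \<Rightarrow> (complex^'n) set \<Rightarrow> bool" where
  "invariant H V \<longleftrightarrow> vec.subspace V \<and> (\<forall>h\<in>H. \<forall>v\<in>V. \<rho> h *v v \<in> V)"

lemma rep_mult_vec: "\<rho> (s \<otimes> t) *v v = \<rho> s *v (\<rho> t *v v)"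
  by (simp add: rep_mult matrix_vector_mul_assoc)

lemma rep_inv_vec: "\<rho> (inv s) *v (\<rho> s *v v) = v" "\<rho> s *v (\<rho> (inv s) *v v) = v"
  by (simp_all add: rep_mult_vec[symmetric] rep_one)

lemma closed_invariant: "invariant H V \<Longrightarrow> closed V"
proof -
  assume "invariant H V"
  then have V: "vec.subspace V" by (simp add: invariant_def)
  have "subspace V"
    unfolding subspace_def
  proof (intro conjI allI ballI)
    fix c :: real and x assume "x \<in> V"
    then have "complex_of_real c *s x \<in> V" using V vec.subspace_scale by blast
    moreover have "complex_of_real c *s x = c *\<^sub>R x"
      by (simp add: vec_eq_iff scaleR_conv_of_real[of _ "_ :: complex"])
    ultimately show "c *\<^sub>R x \<in> V" by simp
  qed (use V in \<open>auto simp: vec.subspace_0 vec.subspace_add\<close>)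
  then show "closed V" by (rule closed_subspace)
qed

lemma closedin_eigen:
  fixes f :: "'s \<Rightarrow> 's" and v :: "'s \<Rightarrow> complex^'n"
  assumes W: "invariant K W" and f: "continuous_on H f" and v: "continuous_on H v"
  shows "closedin (top_of_set H) {h \<in> H. \<rho> (f h) *v v h - z *s v h \<in> W}"
proof -
  have vs: "z *s x = (\<chi> i. z * x $ i)" for x :: "complex^'n"
    by (simp add: vector_scalar_mult_def)
  have "continuous_on H (\<lambda>h. \<rho> (f h) *v v h - z *s v h)"
    unfolding matrix_vector_mult_def vs
    by (intro continuous_intros v continuous_on_compose2[OF rep_cont f]) auto
  from continuous_closedin_preimage[OF this closed_invariant[OF W]] show ?thesis
    by (simp add: vimage_def Collect_conj_eq[symmetric] Int_def)
qed

lemma invariant_mono: "invariant H V \<Longrightarrow> K \<subseteq> H \<Longrightarrow> invariant K V"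
  by (auto simp: invariant_def)

text \<open>The conclusion of Lie's theorem for all subquotients V / W at once. The induction over
  the derived series applies it to subspaces that are chosen only on the way.\<close>

definition triangular_property :: "'s set \<Rightarrow> bool" where
  "triangular_property H \<longleftrightarrow> (\<forall>W V. invariant H W \<longrightarrow> invariant H V \<longrightarrow> W \<subset> V \<longrightarrow>
     (\<exists>v\<in>V - W. \<exists>\<xi>. \<forall>h\<in>H. \<rho> h *v v - \<xi> h *s v \<in> W))"

text \<open>All eigenvalues are taken modulo \<open>W\<close>, which avoids quotient representations. On a minimal
  invariant \<open>V\<close> above \<open>W\<close> first the derived group and then \<open>H\<close> act by scalars: the relevant
  eigenvalues depend continuously on a group element and are confined to a finite set.\<close>

lemma triangular_step:
  assumes H: "subgroup H G" "connected H" and D: "triangular_property (derived G H)"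
  shows "triangular_property H"
  unfolding triangular_property_def
proof (intro allI impI)
  fix W V0 assume W: "invariant H W" and V0: "invariant H V0" "W \<subset> V0"
  have DH: "derived G H \<subseteq> H" by (rule derived_incl[OF order_refl H(1)])
  have Ws: "vec.subspace W" and Wi: "\<And>h w. h \<in> H \<Longrightarrow> w \<in> W \<Longrightarrow> \<rho> h *v w \<in> W"
    using W by (auto simp: invariant_def)
  have Hi: "\<And>h. h \<in> H \<Longrightarrow> inv h \<in> H" "\<And>h k. h \<in> H \<Longrightarrow> k \<in> H \<Longrightarrow> h \<otimes> k \<in> H" "\<one> \<in> H"
    using H(1) by (auto simp: subgroup.m_inv_closed subgroup.m_closed subgroup.one_closed)
  define good where "good V \<longleftrightarrow> invariant H V \<and> W \<subset> V \<and> V \<subseteq> V0" for V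
  have "good V0" using V0 by (simp add: good_def)
  then obtain V where V: "good V" "\<And>V'. good V' \<Longrightarrow> vec.dim V \<le> vec.dim V'"
    using ex_has_least_nat[of good V0 vec.dim] by blast
  have Vs: "vec.subspace V" and Vi: "\<And>h w. h \<in> H \<Longrightarrow> w \<in> V \<Longrightarrow> \<rho> h *v w \<in> V" and WV: "W \<subset> V"
    using V(1) by (auto simp: invariant_def good_def)
  have minimal: "V' = V" if "invariant H V'" "W \<subset> V'" "V' \<subseteq> V" for V'
  proof -
    have "good V'" using that V(1) by (auto simp: good_def)
    then show ?thesis
      using V(2) that vec.subspace_dim_equal[of V' V] Vs by (auto simp: invariant_def)
  qed
  have nW: "\<rho> h *v x \<notin> W" if "h \<in> H" "x \<notin> W" for h x
    using Wi[OF Hi(1)[OF that(1)], of "\<rho> h *v x"] that(2) by (auto simp: rep_inv_vec)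
  have unique: "z = z'" if "x \<notin> W" "y - z *s x \<in> W" "y - z' *s x \<in> W" for x y and z z' :: complex
  proof (rule ccontr)
    assume "z \<noteq> z'"
    have "(z' - z) *s x \<in> W"
      using vec.subspace_diff[OF Ws that(2,3)] by (simp add: vector_ssub_ldistrib vec.scale_left_diff_distrib)
    then have "(1 / (z' - z)) *s ((z' - z) *s x) \<in> W"
      by (rule vec.subspace_scale[OF Ws])
    moreover have "(1 / (z' - z)) * (z' - z) = 1"
      using \<open>z \<noteq> z'\<close> by simp
    ultimately show False
      using that(1) by (simp only: vector_smult_assoc vec.scale_one)
  qed
  obtain v0 \<xi> where v0: "v0 \<in> V - W" "\<And>d. d \<in> derived G H \<Longrightarrow> \<rho> d *v v0 - \<xi> d *s v0 \<in> W"
    using D WV invariant_mono[OF W DH] V(1) invariant_mono[OF _ DH, of V]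
    unfolding triangular_property_def good_def by meson
  have conjD: "inv g \<otimes> d \<otimes> g \<in> derived G H" if "g \<in> H" "d \<in> derived G H" for g d
  proof -
    have "derived G H \<lhd> G \<lparr> carrier := H \<rparr>"
      by (rule derived_subgroup_is_normal[OF H(1)])
    then have "inv\<^bsub>G \<lparr> carrier := H \<rparr>\<^esub> g \<otimes> d \<otimes> g \<in> derived G H"
      using normal.inv_op_closed1[of "derived G H" "G \<lparr> carrier := H \<rparr>" g d] that by simp
    then show ?thesis
      using m_inv_consistent[OF H(1) that(1)] by simp
  qed
  have \<xi>conj: "\<xi> (inv g \<otimes> d \<otimes> g) = \<xi> d" if g: "g \<in> H" and d: "d \<in> derived G H" for g d
  proof -
    note Z = finite_quotient_eigenvalues[of "\<rho> d"] quotient_eigenvaluesI[OF Ws Wi[OF subsetD[OF DH d]]]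
    \<comment> \<open>The matrix of g carries v0, an eigenvector modulo W for the conjugated
      element, to an eigenvector for d; so all these eigenvalues lie in the finite set attached to
      \<rho> d.\<close>
    have eig: "\<rho> d *v (\<rho> g *v v0) - \<xi> (inv g \<otimes> d \<otimes> g) *s (\<rho> g *v v0) \<in> W" if "g \<in> H" for g
    proof -
      have "\<rho> g *v (\<rho> (inv g \<otimes> d \<otimes> g) *v v0 - \<xi> (inv g \<otimes> d \<otimes> g) *s v0) \<in> W"
        using that v0(2) conjD d by (intro Wi) auto
      then show ?thesis
        by (simp add: vec.diff vec.scale rep_mult_vec rep_inv_vec)
    qed
    have "\<xi> (inv g \<otimes> d \<otimes> g) = \<xi> (inv \<one> \<otimes> d \<otimes> \<one>)"
    proof (rule connected_finite_range_constant[OF H(2) Z(1), where f = "\<lambda>g. \<xi> (inv g \<otimes> d \<otimes> g)"])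
      fix g assume "g \<in> H"
      then show "\<xi> (inv g \<otimes> d \<otimes> g) \<in> quotient_eigenvalues (\<rho> d)"
        using Z(2) eig nW v0 by blast
    next
      fix z
      have "{h \<in> H. \<xi> (inv h \<otimes> d \<otimes> h) = z} = {h \<in> H. \<rho> (inv h \<otimes> d \<otimes> h) *v v0 - z *s v0 \<in> W}"
        using v0 conjD[OF _ d] unique by blast
      moreover have "closedin (top_of_set H) \<dots>"
        by (intro closedin_eigen[OF W] continuous_intros)
      ultimately show "closedin (top_of_set H) {h \<in> H. \<xi> (inv h \<otimes> d \<otimes> h) = z}" by simp
    qed (use g Hi in auto)
    then show ?thesis by simp
  qed
  have D_scalar: "\<rho> d *v v - \<xi> d *s v \<in> W" if "v \<in> V" "d \<in> derived G H" for v d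
  proof -
    \<comment> \<open>The part of V on which the derived group acts through \<xi>. As \<xi> is
      invariant under conjugation, this part is stable under H, and minimality makes it all of
      V.\<close>
    define V' where "V' = {v \<in> V. \<forall>d\<in>derived G H. \<rho> d *v v - \<xi> d *s v \<in> W}"
    have "V' = V"
    proof (rule minimal)
      have "vec.subspace V'"
      proof (rule vec.subspaceI)
        show "0 \<in> V'" using Ws Vs by (simp add: V'_def vec.subspace_0)
      next
        fix x y assume "x \<in> V'" "y \<in> V'"
        then show "x + y \<in> V'"
          using vec.subspace_add[OF Ws] vec.subspace_add[OF Vs]
          by (auto simp: V'_def vec.add vec.scale_right_distrib add_diff_add)
      next
        fix c x assume "x \<in> V'"
        then have "\<forall>d\<in>derived G H. c *s (\<rho> d *v x - \<xi> d *s x) \<in> W" "c *s x \<in> V"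
          using vec.subspace_scale[OF Ws] vec.subspace_scale[OF Vs] unfolding V'_def by blast+
        then show "c *s x \<in> V'"
          by (simp add: V'_def vec.scale vec.scale_right_diff_distrib mult.commute)
      qed
      moreover have "\<rho> g *v v \<in> V'" if g: "g \<in> H" and v: "v \<in> V'" for g v
      proof -
        have "\<rho> d *v (\<rho> g *v v) - \<xi> d *s (\<rho> g *v v) \<in> W" if d: "d \<in> derived G H" for d
        proof -
          have "\<rho> g *v (\<rho> (inv g \<otimes> d \<otimes> g) *v v - \<xi> (inv g \<otimes> d \<otimes> g) *s v) \<in> W"
            using v conjD[OF g d] g by (intro Wi) (auto simp: V'_def)
          then show ?thesis
            using \<xi>conj[OF g d] by (simp add: vec.diff vec.scale rep_mult_vec rep_inv_vec)
        qed
        then show ?thesis using v Vi g by (auto simp: V'_def)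
      qed
      ultimately show "invariant H V'" by (simp add: invariant_def)
      have "W \<subseteq> V'"
      proof
        fix w assume w: "w \<in> W"
        then have "\<rho> d *v w - \<xi> d *s w \<in> W" if "d \<in> derived G H" for d
          using that DH Wi vec.subspace_scale[OF Ws] vec.subspace_diff[OF Ws] by blast
        then show "w \<in> V'" using w WV by (auto simp: V'_def)
      qed
      then show "W \<subset> V'" using v0 by (auto simp: V'_def)
    qed (auto simp: V'_def)
    then show ?thesis using that by (auto simp: V'_def)
  qed
  have scalar: "\<exists>\<mu>. \<forall>u\<in>V. \<rho> g *v u - \<mu> *s u \<in> W" if g: "g \<in> H" for g
  proof -
    obtain v \<mu> where v: "v \<in> V" "v \<notin> W" "\<rho> g *v v - \<mu> *s v \<in> W"
      using eigenvector_mod_exists[OF Ws Wi[OF g] Vs Vi[OF g], of v0] v0 by auto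
    note Z = finite_quotient_eigenvalues[of "\<rho> g"] quotient_eigenvaluesI[OF Ws Wi[OF g]]
    \<comment> \<open>Writing g h as the commutator of g and h times h g shows that \<rho> h takes a
      \<mu>-eigenvector of \<rho> g modulo W to one with this eigenvalue.\<close>
    define \<zeta> where "\<zeta> h = \<xi> (g \<otimes> h \<otimes> inv g \<otimes> inv h) * \<mu>" for h
    have comm: "g \<otimes> h \<otimes> inv g \<otimes> inv h \<in> derived G H" if "h \<in> H" for h
      unfolding derived_def by (rule generate.incl) (use g that in blast)
    have eig: "\<rho> g *v (\<rho> h *v u) - \<zeta> h *s (\<rho> h *v u) \<in> W"
      if h: "h \<in> H" and u: "u \<in> V" "\<rho> g *v u - \<mu> *s u \<in> W" for h u
    proof -
      let ?c = "g \<otimes> h \<otimes> inv g \<otimes> inv h"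
      have "?c \<otimes> (h \<otimes> g) = g \<otimes> h"
        by (simp add: m_assoc) (simp add: m_assoc[symmetric])
      then have "\<rho> g *v (\<rho> h *v u) = \<rho> ?c *v (\<rho> h *v (\<rho> g *v u))"
        by (metis rep_mult_vec)
      moreover have "\<rho> ?c *v (\<rho> h *v (\<rho> g *v u)) - \<xi> ?c *s (\<rho> h *v (\<rho> g *v u)) \<in> W"
        using h g u comm Vi by (intro D_scalar) auto
      moreover have "\<xi> ?c *s (\<rho> h *v (\<rho> g *v u - \<mu> *s u)) \<in> W"
        using h u Wi vec.subspace_scale[OF Ws] by blast
      ultimately have "(\<rho> g *v (\<rho> h *v u) - \<xi> ?c *s (\<rho> h *v (\<rho> g *v u)))
          + \<xi> ?c *s (\<rho> h *v (\<rho> g *v u - \<mu> *s u)) \<in> W"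
        using vec.subspace_add[OF Ws] by metis
      then show ?thesis
        by (simp add: \<zeta>_def vec.diff vec.scale vec.scale_right_diff_distrib mult.commute)
    qed
    have \<zeta>1: "\<zeta> \<one> = \<mu>"
      using eig[OF Hi(3) v(1,3)] unique[OF v(2) _ v(3)] by (simp add: rep_one)
    have \<zeta>: "\<zeta> h = \<mu>" if h: "h \<in> H" for h
    proof -
      have "\<zeta> h = \<zeta> \<one>"
      proof (rule connected_finite_range_constant[OF H(2) Z(1), where f = \<zeta>])
        fix h assume "h \<in> H"
        then show "\<zeta> h \<in> quotient_eigenvalues (\<rho> g)"
          using Z(2) eig v nW by blast
      next
        fix z
        have "{h \<in> H. \<zeta> h = z} = {h \<in> H. \<rho> g *v (\<rho> h *v v) - z *s (\<rho> h *v v) \<in> W}"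
          using eig[OF _ v(1,3)] unique nW[OF _ v(2)] by blast
        moreover have "closedin (top_of_set H) \<dots>"
        proof (intro closedin_eigen[OF W] continuous_intros)
          show "continuous_on H (\<lambda>h. \<rho> h *v v)"
            unfolding matrix_vector_mult_def
            by (intro continuous_intros continuous_on_subset[OF rep_cont]) auto
        qed
        ultimately show "closedin (top_of_set H) {h \<in> H. \<zeta> h = z}" by simp
      qed (use h Hi in auto)
      then show ?thesis using \<zeta>1 by simp
    qed
    define V' where "V' = {u \<in> V. \<rho> g *v u - \<mu> *s u \<in> W}"
    have "V' = V"
    proof (rule minimal)
      have "vec.subspace V'"
      proof (rule vec.subspaceI)
        show "0 \<in> V'" using Ws Vs by (simp add: V'_def vec.subspace_0)
      next
        fix x y assume "x \<in> V'" "y \<in> V'"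
        then show "x + y \<in> V'"
          using vec.subspace_add[OF Ws] vec.subspace_add[OF Vs]
          by (auto simp: V'_def vec.add vec.scale_right_distrib add_diff_add)
      next
        fix c x assume "x \<in> V'"
        then have "c *s (\<rho> g *v x - \<mu> *s x) \<in> W" "c *s x \<in> V"
          using vec.subspace_scale[OF Ws] vec.subspace_scale[OF Vs] unfolding V'_def by blast+
        then show "c *s x \<in> V'"
          by (simp add: V'_def vec.scale vec.scale_right_diff_distrib mult.commute)
      qed
      moreover have "\<rho> h *v u \<in> V'" if "h \<in> H" "u \<in> V'" for h u
        using eig[OF that(1)] \<zeta>[OF that(1)] that Vi by (auto simp: V'_def)
      ultimately show "invariant H V'" by (simp add: invariant_def)
      have "W \<subseteq> V'"
      proof
        fix w assume w: "w \<in> W"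
        then have "\<rho> g *v w - \<mu> *s w \<in> W"
          using g Wi vec.subspace_scale[OF Ws] vec.subspace_diff[OF Ws] by blast
        then show "w \<in> V'" using w WV by (auto simp: V'_def)
      qed
      then show "W \<subset> V'" using v by (auto simp: V'_def)
    qed (auto simp: V'_def)
    then show ?thesis by (auto simp: V'_def)
  qed
  then have "\<forall>g\<in>H. \<exists>\<mu>. \<forall>u\<in>V. \<rho> g *v u - \<mu> *s u \<in> W" by blast
  then obtain \<mu> where "\<forall>g\<in>H. \<forall>u\<in>V. \<rho> g *v u - \<mu> g *s u \<in> W"
    by metis
  moreover have "v0 \<in> V0 - W" using v0 V(1) by (auto simp: good_def)
  ultimately show "\<exists>v\<in>V0 - W. \<exists>\<xi>. \<forall>h\<in>H. \<rho> h *v v - \<xi> h *s v \<in> W"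
    using v0 by blast
qed

text \<open>Ascent along the derived series, whose members are connected; for the trivial group
  every vector outside W will do.\<close>

lemma triangular_property_solvable:
  assumes solvable: "solvable G" and conn: "connected (UNIV :: 's set)"
  shows "triangular_property UNIV"
proof -
  obtain k where k: "(derived G ^^ k) UNIV = {\<one>}"
    using solvable solvable_iff_trivial_derived_seq by auto
  have sub: "subgroup ((derived G ^^ i) UNIV) G" for i
    using exp_of_derived_is_subgroup[OF subgroup_self] by simp
  have con: "connected ((derived G ^^ i) UNIV)" for i
    by (induction i) (use conn connected_derived sub in auto)
  have "triangular_property ((derived G ^^ (k - i)) UNIV)" if "i \<le> k" for i
    using that
  proof (induction i)
    case 0
    have "triangular_property {\<one>}"
      unfolding triangular_property_def
    proof (intro allI impI)
      fix W V assume "invariant {\<one>} W" "W \<subset> V"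
      then obtain v where "v \<in> V - W" "vec.subspace W" by (auto simp: invariant_def)
      then show "\<exists>v\<in>V - W. \<exists>\<xi>. \<forall>h\<in>{\<one>}. \<rho> h *v v - \<xi> h *s v \<in> W"
        by (intro bexI[of _ v] exI[of _ "\<lambda>_. 1"]) (auto simp: rep_one vec.subspace_0)
    qed
    then show ?case using k by simp
  next
    case (Suc i)
    have "(derived G ^^ (k - i)) UNIV = derived G ((derived G ^^ (k - Suc i)) UNIV)"
      using Suc.prems by (metis Suc_diff_Suc Suc_le_lessD comp_apply funpow.simps(2))
    then show ?case
      using triangular_step[OF sub con] Suc by auto
  qed
  from this[of k] show ?thesis by simp
qed

end

text \<open>If A - \<mu> were injective, it would map the invariant subspace W onto itself for
  reasons of dimension, and a vector sent into W would already lie in W.\<close>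

lemma quotient_eigenvalue_eigenvector:
  fixes A :: "complex^'n^'n"
  assumes "\<mu> \<in> quotient_eigenvalues A"
  shows "\<exists>x. x \<noteq> 0 \<and> A *v x = \<mu> *s x"
proof (rule ccontr)
  assume neg: "\<not> ?thesis"
  obtain W v where W: "vec.subspace W" "\<forall>w\<in>W. A *v w \<in> W" and v: "v \<notin> W" "A *v v - \<mu> *s v \<in> W"
    using assms unfolding quotient_eigenvalues_def by blast
  define f where "f x = A *v x - \<mu> *s x" for x
  have lin: "Vector_Spaces.linear (*s) (*s) f"
    by unfold_locales (simp_all add: f_def vec.add vec.scale vec.scale_right_distrib vec.scale_right_diff_distrib mult.commute)
  have diff: "f (x - y) = f x - f y" for x y
    by (simp add: f_def vec.diff vec.scale_right_diff_distrib)
  have inj: "inj f"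
  proof (rule injI)
    fix x y assume "f x = f y"
    then have "f (x - y) = 0" by (simp add: diff)
    then have "A *v (x - y) = \<mu> *s (x - y)" by (simp only: f_def right_minus_eq)
    then have "x - y = 0" using neg by blast
    then show "x = y" by simp
  qed
  have fW: "f ` W \<subseteq> W"
    using W vec.subspace_scale[OF W(1)] vec.subspace_diff[OF W(1)] by (auto simp: f_def)
  have "vec.subspace (f ` W)"
    by (rule vec.linear_subspace_image[OF lin W(1)])
  moreover have "vec.dim (f ` W) = vec.dim W"
    by (rule vec.dim_image_eq[OF lin]) (use inj in \<open>auto intro: inj_on_subset\<close>)
  ultimately have "f ` W = W"
    using fW W(1) vec.subspace_dim_equal[of "f ` W" W] by simp
  then obtain w where w: "w \<in> W" "f w = f v"
    using v(2) by (metis f_def imageE)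
  then show False
    using v(1) inj by (metis injD)
qed

text \<open>A basis v and its dual basis w, paired bilinearly, without complex conjugation. Indexing
  by naturals gives matrix entries the form that \<open>tri_rep\<close> expects.\<close>

locale dual_bases =
  fixes v w :: "nat \<Rightarrow> complex^'n"
  assumes dual: "i < CARD('n) \<Longrightarrow> j < CARD('n) \<Longrightarrow> (\<Sum>k\<in>UNIV. w i $ k * v j $ k) = (if i = j then 1 else 0)"
    and expand: "x = (\<Sum>i<CARD('n). (\<Sum>k\<in>UNIV. w i $ k * x $ k) *s v i)"
begin

definition coord :: "nat \<Rightarrow> complex^'n \<Rightarrow> complex" where
  "coord i x = (\<Sum>k\<in>UNIV. w i $ k * x $ k)"

definition entry :: "complex^'n^'n \<Rightarrow> nat \<Rightarrow> nat \<Rightarrow> complex" where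
  "entry M i j = coord i (M *v v j)"

lemma expand_coord: "x = (\<Sum>i<CARD('n). coord i x *s v i)"
  unfolding coord_def by (rule expand)

lemma coord_v: "i < CARD('n) \<Longrightarrow> j < CARD('n) \<Longrightarrow> coord i (v j) = (if i = j then 1 else 0)"
  unfolding coord_def by (rule dual)

lemma coord_add: "coord i (x + y) = coord i x + coord i y"
  by (simp add: coord_def algebra_simps sum.distrib)

lemma coord_scale: "coord i (c *s x) = c * coord i x"
  by (simp add: coord_def sum_distrib_left algebra_simps)

lemma coord_sum: "coord i (sum f I) = (\<Sum>k\<in>I. coord i (f k))"
proof (induction I rule: infinite_finite_induct)
  case (insert x F)
  then show ?case by (simp add: coord_add)
qed (simp_all add: coord_def)

lemma entry_mult:
  "entry (A ** B) i j = (\<Sum>l<CARD('n). entry A i l * entry B l j)"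
proof -
  have "entry (A ** B) i j = coord i (A *v (B *v v j))"
    by (simp add: entry_def matrix_vector_mul_assoc)
  also have "B *v v j = (\<Sum>l<CARD('n). entry B l j *s v l)"
    unfolding entry_def by (rule expand_coord)
  also have "A *v \<dots> = (\<Sum>l<CARD('n). entry B l j *s (A *v v l))"
    by (simp add: vec.sum vec.scale)
  also have "coord i \<dots> = (\<Sum>l<CARD('n). entry A i l * entry B l j)"
    by (simp add: coord_sum coord_scale mult.commute entry_def)
  finally show ?thesis .
qed

lemma entry_one: "i < CARD('n) \<Longrightarrow> j < CARD('n) \<Longrightarrow> entry (mat 1) i j = (if i = j then 1 else 0)"
  by (simp add: entry_def coord_v)

text \<open>The j-th basis vector is an eigenvector modulo the span of the earlier ones, and
  eigenvalues on quotients are eigenvalues.\<close>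

lemma entry_diag_eigenvalue:
  assumes upper: "\<And>i j. i < CARD('n) \<Longrightarrow> j < i \<Longrightarrow> entry M i j = 0" and j: "j < CARD('n)"
  shows "\<exists>x. x \<noteq> 0 \<and> M *v x = entry M j j *s x"
proof (rule quotient_eigenvalue_eigenvector, rule quotient_eigenvaluesI)
  define W where "W = vec.span (v ` {..<j})"
  have col: "M *v v l = (\<Sum>i<Suc l. entry M i l *s v i)" if "l < CARD('n)" for l
  proof -
    have "M *v v l = (\<Sum>i<CARD('n). entry M i l *s v i)"
      unfolding entry_def by (rule expand_coord)
    also have "\<dots> = (\<Sum>i<Suc l. entry M i l *s v i)"
      using that upper by (intro sum.mono_neutral_right) auto
    finally show ?thesis .
  qed
  show "vec.subspace W" by (simp add: W_def)
  have mem: "(\<Sum>i<l. c i *s v i) \<in> W" if "l \<le> j" for l c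
    unfolding W_def using that by (intro vec.span_sum vec.span_scale vec.span_base) auto
  show "M *v x \<in> W" if "x \<in> W" for x
    using that unfolding W_def
  proof (induction rule: vec.span_induct_alt)
    case (step c y z)
    then obtain l where "l < j" "y = v l" by auto
    then have "M *v y \<in> W"
      using col[of l] mem[of "Suc l"] j by simp
    then show ?case
      using step by (simp add: vec.add vec.scale W_def vec.span_add vec.span_scale)
  qed (simp add: vec.span_zero)
  show "M *v v j - entry M j j *s v j \<in> W"
    using col[OF j] mem[of j] by simp
  show "v j \<notin> W"
  proof
    have "coord j x = 0" if "x \<in> W" for x
      using that unfolding W_def
    proof (induction rule: vec.span_induct_alt)
      case (step c y z)
      then show ?case using j coord_v[of j] by (auto simp: coord_add coord_scale)
    qed (simp add: coord_def)
    moreover assume "v j \<in> W"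
    ultimately show False using coord_v[OF j j] by simp
  qed
qed

lemma continuous_on_entry [continuous_intros]:
  "continuous_on X f \<Longrightarrow> continuous_on X (\<lambda>s. entry (f s) i j)"
  unfolding entry_def coord_def matrix_vector_mult_def by (auto intro!: continuous_intros)

end

section \<open>Invariant flags and the triangular form\<close>

context top_group_rep
begin

text \<open>The flag is extended by a common eigenvector of the whole space modulo the span reached
  so far.\<close>

lemma exists_flag:
  assumes "triangular_property UNIV" "k \<le> CARD('n)"
  shows "\<exists>v. inj_on v {..<k} \<and> vec.independent (v ` {..<k}) \<and>
    (\<forall>j<k. \<forall>s. \<rho> s *v v j \<in> vec.span (v ` {..j}))"
  using assms(2)
proof (induction k)
  case 0
  then show ?case by (auto simp: vec.independent_empty)
next
  case (Suc k)
  then obtain v where v: "inj_on v {..<k}" "vec.independent (v ` {..<k})"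
    "\<And>j s. j < k \<Longrightarrow> \<rho> s *v v j \<in> vec.span (v ` {..j})" by auto
  define W where "W = vec.span (v ` {..<k})"
  have inW: "\<rho> s *v x \<in> W" if "x \<in> W" for s x
    using that unfolding W_def
  proof (induction rule: vec.span_induct_alt)
    case (step c y z)
    then obtain l where l: "l < k" "y = v l" by auto
    then have "v ` {..l} \<subseteq> v ` {..<k}" by auto
    then have "\<rho> s *v y \<in> vec.span (v ` {..<k})"
      using v(3)[OF l(1), of s] l(2) vec.span_mono by blast
    then show ?case
      using step by (simp add: vec.add vec.scale vec.span_add vec.span_scale)
  qed (simp add: vec.span_zero)
  then have W: "invariant UNIV W"
    by (simp add: invariant_def W_def)
  have "vec.dim W = k"
    using v(1,2) by (simp add: W_def vec.dim_eq_card_independent card_image)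
  then have "W \<noteq> UNIV"
    using Suc.prems vec_dim_card[where 'a = complex and 'n = 'n] by auto
  then have "W \<subset> UNIV" by auto
  moreover have "invariant UNIV (UNIV :: (complex^'n) set)"
    by (simp add: invariant_def)
  ultimately obtain x \<xi> where x: "x \<notin> W" "\<And>s. \<rho> s *v x - \<xi> s *s x \<in> W"
    using assms(1) W unfolding triangular_property_def by (metis DiffE UNIV_I)
  define v' where "v' = v(k := x)"
  have eq: "v' ` {..<k} = v ` {..<k}" "\<And>j. j < k \<Longrightarrow> v' ` {..j} = v ` {..j}" "v' k = x"
    by (auto simp: v'_def)
  have xv: "x \<notin> v ` {..<k}"
    using x(1) vec.span_base[of x "v ` {..<k}"] by (metis W_def)
  have "inj_on v' {..<Suc k}"
    using v(1) xv by (auto simp: v'_def inj_on_def less_Suc_eq)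
  moreover have "vec.independent (v' ` {..<Suc k})"
    using v(2) x(1) by (simp add: lessThan_Suc eq vec.independent_insert W_def)
  moreover have "\<rho> s *v v' j \<in> vec.span (v' ` {..j})" if "j < Suc k" for j s
  proof (cases "j < k")
    case True
    then show ?thesis using v(3)[OF True, of s] eq by (simp add: v'_def)
  next
    case False
    then have j: "j = k" using that by simp
    have "\<rho> s *v x - \<xi> s *s x \<in> vec.span (v' ` {..k})"
    proof -
      have "v' ` {..<k} \<subseteq> v' ` {..k}" by (rule image_mono) auto
      then show ?thesis
        using x(2)[of s] vec.span_mono[of "v ` {..<k}" "v' ` {..k}"] eq(1) by (auto simp: W_def)
    qed
    moreover have "\<xi> s *s x \<in> vec.span (v' ` {..k})"
      using eq by (intro vec.span_scale vec.span_base) auto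
    ultimately have "(\<rho> s *v x - \<xi> s *s x) + \<xi> s *s x \<in> vec.span (v' ` {..k})"
      by (rule vec.span_add)
    then show ?thesis by (simp add: j eq)
  qed
  ultimately show ?case by blast
qed

lemma exists_tri_rep:
  assumes "solvable G" "connected (UNIV :: 's set)"
  shows "\<exists>v w. dual_bases v w \<and> tri_rep G CARD('n) (\<lambda>s. dual_bases.entry v w (\<rho> s))"
proof -
  obtain v where v: "inj_on v {..<CARD('n)}" "vec.independent (v ` {..<CARD('n)})"
    "\<And>j s. j < CARD('n) \<Longrightarrow> \<rho> s *v v j \<in> vec.span (v ` {..j})"
    using exists_flag[OF triangular_property_solvable[OF assms] order_refl] by blast
  define B where "B = v ` {..<CARD('n)}"
  have span: "vec.span B = UNIV"
    using v(1,2) by (metis B_def card_image card_lessThan vec.dim_eq_card_independent vec.dim_eq_full vec_dim_card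
        vec.dim_UNIV vec.dimension_def)
  have ind: "vec.independent B" using v(2) by (simp add: B_def)
  define c where "c i x = vec.representation B x (v i)" for i x
  \<comment> \<open>The coordinate functionals of the basis, recorded by their values on the
    standard basis.\<close>
  define w where "w i = (\<chi> k. c i (axis k 1))" for i
  have c_add: "c i (x + y) = c i x + c i y" for i x y
    using vec.representation_add[OF ind] span by (simp add: c_def)
  have c_scale: "c i (a *s x) = a * c i x" for i a x
    using vec.representation_scale[OF ind] span by (simp add: c_def)
  have c_sum: "c i (sum f I) = (\<Sum>k\<in>I. c i (f k))" for i I and f :: "'n \<Rightarrow> complex^'n"
    using c_scale[of i 0 0] by (induction I rule: infinite_finite_induct) (simp_all add: c_add)
  have cw: "c i x = (\<Sum>k\<in>UNIV. w i $ k * x $ k)" for i x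
  proof -
    have "c i x = c i (\<Sum>k\<in>UNIV. x $ k *s axis k 1)"
      by (simp add: basis_expansion)
    then show ?thesis
      by (simp add: c_sum c_scale w_def mult.commute)
  qed
  have c_v: "c i (v j) = (if i = j then 1 else 0)" if "i < CARD('n)" "j < CARD('n)" for i j
    using vec.representation_basis[OF ind, of "v j"] v(1) that
    by (auto simp: c_def B_def inj_on_eq_iff)
  have fin: "finite B" by (simp add: B_def)
  interpret dual_bases v w
  proof
    fix i j assume "i < CARD('n)" "j < CARD('n)"
    then show "(\<Sum>k\<in>UNIV. w i $ k * v j $ k) = (if i = j then 1 else 0)"
      using c_v by (simp flip: cw)
  next
    fix x
    have "x = (\<Sum>b\<in>B. vec.representation B x b *s b)"
      using vec.sum_representation_eq[OF ind _ fin, of x] span by simp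
    also have "\<dots> = (\<Sum>i<CARD('n). c i x *s v i)"
      unfolding B_def c_def using v(1) by (simp add: sum.reindex)
    finally show "x = (\<Sum>i<CARD('n). (\<Sum>k\<in>UNIV. w i $ k * x $ k) *s v i)"
      by (simp flip: cw)
  qed
  have "tri_rep G CARD('n) (\<lambda>s. entry (\<rho> s))"
  proof unfold_locales
    fix s i j assume ij: "j < i" "i < CARD('n)"
    have "coord i x = 0" if "x \<in> vec.span (v ` {..j})" for x
      using that
    proof (induction rule: vec.span_induct_alt)
      case (step a y z)
      then obtain l where "l \<le> j" "y = v l" by auto
      then show ?case using step coord_v[of i l] ij by (simp add: coord_add coord_scale)
    qed (simp add: coord_def)
    then show "entry (\<rho> s) i j = 0"
      using v(3)[of j s] ij by (simp add: entry_def)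
  qed (simp_all add: rep_mult rep_one entry_mult entry_one)
  then show ?thesis
    using dual_bases_axioms by blast
qed

end

section \<open>The adjoint representation\<close>

lemma Ck_on_cong:
  assumes "open U" "\<And>x. x \<in> U \<Longrightarrow> f x = g x" "Ck_on k U f"
  shows "Ck_on k U g"
  using assms(2,3)
proof (induction k arbitrary: f g)
  case 0
  then show ?case by (simp cong: continuous_on_cong)
next
  case (Suc k)
  have d: "(g has_derivative frechet_derivative f (at x)) (at x)" if "x \<in> U" for x
    using Suc.prems that assms(1)
    by (intro has_derivative_transform_within_open[of f _ x UNIV U g]) (auto simp: frechet_derivative_works[symmetric])
  then have eq: "frechet_derivative g (at x) = frechet_derivative f (at x)" if "x \<in> U" for x
    using that frechet_derivative_at by metis
  have "Ck_on k U (\<lambda>x. frechet_derivative g (at x) v)" for v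
  proof (rule Suc.IH)
    show "Ck_on k U (\<lambda>x. frechet_derivative f (at x) v)"
      using Suc.prems by simp
  qed (simp add: eq)
  moreover have "g differentiable at x" if "x \<in> U" for x
    using d[OF that] by (auto simp: differentiable_def)
  ultimately show ?case by simp
qed

text \<open>Schwarz's theorem by the second difference over a parallelogram. The mean value theorem,
  applied twice in either order of the directions, expresses it by each mixed derivative at some
  point of the parallelogram; continuity compares these values with those at p.\<close>

lemma second_derivative_symmetric_real:
  fixes f :: "'a::euclidean_space \<Rightarrow> real"
  assumes D: "open D" "p \<in> D"
    and f: "\<And>x. x \<in> D \<Longrightarrow> (f has_derivative f' x) (at x)"
    and fu: "\<And>x. x \<in> D \<Longrightarrow> ((\<lambda>x. f' x u) has_derivative fu x) (at x)"
    and fv: "\<And>x. x \<in> D \<Longrightarrow> ((\<lambda>x. f' x v) has_derivative fv x) (at x)"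
    and cu: "continuous_on D (\<lambda>x. fu x v)" and cv: "continuous_on D (\<lambda>x. fv x u)"
  shows "fu p v = fv p u"
proof (rule ccontr)
  assume ne: "fu p v \<noteq> fv p u"
  define \<epsilon> where "\<epsilon> = \<bar>fu p v - fv p u\<bar> / 2"
  have \<epsilon>: "\<epsilon> > 0" using ne by (simp add: \<epsilon>_def)
  obtain d1 where d1: "d1 > 0" "\<And>x. dist x p < d1 \<Longrightarrow> x \<in> D"
    using D unfolding open_dist by blast
  obtain d2 where d2: "d2 > 0" "\<And>x. x \<in> D \<Longrightarrow> dist x p < d2 \<Longrightarrow> dist (fu x v) (fu p v) < \<epsilon>"
    using cu D(2) \<epsilon> unfolding continuous_on_iff by blast
  obtain d3 where d3: "d3 > 0" "\<And>x. x \<in> D \<Longrightarrow> dist x p < d3 \<Longrightarrow> dist (fv x u) (fv p u) < \<epsilon>"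
    using cv D(2) \<epsilon> unfolding continuous_on_iff by blast
  define d where "d = min d1 (min d2 d3)"
  \<comment> \<open>Small enough to keep the parallelogram with sides t u and t v within distance d
    of p; the summand 1 avoids division by 0.\<close>
  define t where "t = d / (2 * (norm u + norm v + 1))"
  have d0: "d > 0" using d1 d2 d3 by (simp add: d_def)
  have t: "t > 0" "t * (norm u + norm v) < d"
  proof -
    have pos: "norm u + norm v + 1 > 0" by (simp add: add_nonneg_pos)
    then show "t > 0" using d0 by (simp add: t_def)
    have "t * (norm u + norm v) \<le> t * (norm u + norm v + 1)"
      using \<open>t > 0\<close> by (intro mult_left_mono) auto
    also have "\<dots> = d / 2"
    proof -
      have "d / (2 * N) * N = d / 2" if "N > 0" for N :: real
        using that by simp
      then show ?thesis unfolding t_def using pos by blast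
    qed
    finally show "t * (norm u + norm v) < d" using d0 by simp
  qed
  have near: "dist (p + a *\<^sub>R u + b *\<^sub>R v) p < d" if "0 \<le> a" "a \<le> t" "0 \<le> b" "b \<le> t" for a b
  proof -
    have "norm (a *\<^sub>R u + b *\<^sub>R v) \<le> a * norm u + b * norm v"
      using that norm_triangle_ineq[of "a *\<^sub>R u" "b *\<^sub>R v"] by simp
    also have "\<dots> \<le> t * norm u + t * norm v"
      using that by (intro add_mono mult_right_mono) auto
    also have "\<dots> < d" using t(2) by (simp add: algebra_simps)
    finally show ?thesis by (simp add: dist_norm add.assoc)
  qed
  have inD: "p + a *\<^sub>R u + b *\<^sub>R v \<in> D" if "0 \<le> a" "a \<le> t" "0 \<le> b" "b \<le> t" for a b
    using near[OF that] d1 by (simp add: d_def)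
  define \<Delta> where "\<Delta> = f (p + t *\<^sub>R u + t *\<^sub>R v) - f (p + t *\<^sub>R u) - f (p + t *\<^sub>R v) + f p"
  have line: "((\<lambda>a. h (q + a *\<^sub>R w)) has_real_derivative h' w) (at s)"
    if "(h has_derivative h') (at (q + s *\<^sub>R w))" for h :: "'a \<Rightarrow> real" and h' q w s
  proof -
    have "((\<lambda>a. h (q + a *\<^sub>R w)) has_derivative (\<lambda>a. h' (a *\<^sub>R w))) (at s)"
      by (rule has_derivative_compose[where f = "\<lambda>a. q + a *\<^sub>R w" and g = h])
        (use that in \<open>auto intro!: derivative_eq_intros\<close>)
    moreover have "h' (a *\<^sub>R w) = a * h' w" for a
      using linear_scale[OF has_derivative_linear[OF that]] by simp
    ultimately show ?thesis by (simp add: has_field_derivative_def mult_commute_abs)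
  qed
  have "\<exists>a\<in>{0..t}. \<exists>b\<in>{0..t}. \<Delta> = t * t * fu (p + a *\<^sub>R u + b *\<^sub>R v) v"
  proof -
    have "((\<lambda>a. f (p + t *\<^sub>R v + a *\<^sub>R u) - f (p + a *\<^sub>R u)) has_real_derivative
        f' (p + t *\<^sub>R v + a *\<^sub>R u) u - f' (p + a *\<^sub>R u) u) (at a)" if "0 \<le> a" "a \<le> t" for a
      using inD[of a t] inD[of a 0] that t
      by (intro DERIV_diff line f) (simp_all add: ac_simps)
    from MVT2[OF t(1) this] obtain a where a: "0 < a" "a < t"
      "f (p + t *\<^sub>R v + t *\<^sub>R u) - f (p + t *\<^sub>R u) - (f (p + t *\<^sub>R v + 0 *\<^sub>R u) - f (p + 0 *\<^sub>R u)) =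
       (t - 0) * (f' (p + t *\<^sub>R v + a *\<^sub>R u) u - f' (p + a *\<^sub>R u) u)" by blast
    have "((\<lambda>b. f' (p + a *\<^sub>R u + b *\<^sub>R v) u) has_real_derivative fu (p + a *\<^sub>R u + b *\<^sub>R v) v) (at b)"
      if "0 \<le> b" "b \<le> t" for b
      using inD[of a b] a that by (intro line fu) simp_all
    from MVT2[OF t(1) this] obtain b where b: "0 < b" "b < t"
      "f' (p + a *\<^sub>R u + t *\<^sub>R v) u - f' (p + a *\<^sub>R u + 0 *\<^sub>R v) u = (t - 0) * fu (p + a *\<^sub>R u + b *\<^sub>R v) v" by blast
    have "\<Delta> = t * (t * fu (p + a *\<^sub>R u + b *\<^sub>R v) v)"
      using a(3) b(3) by (simp add: \<Delta>_def ac_simps)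
    then show ?thesis using a b by (intro bexI[of _ a] bexI[of _ b]) auto
  qed
  then obtain a b where ab: "a \<in> {0..t}" "b \<in> {0..t}" "\<Delta> = t * t * fu (p + a *\<^sub>R u + b *\<^sub>R v) v" by blast
  have "\<exists>a\<in>{0..t}. \<exists>b\<in>{0..t}. \<Delta> = t * t * fv (p + a *\<^sub>R u + b *\<^sub>R v) u"
  proof -
    have "((\<lambda>b. f (p + t *\<^sub>R u + b *\<^sub>R v) - f (p + b *\<^sub>R v)) has_real_derivative
        f' (p + t *\<^sub>R u + b *\<^sub>R v) v - f' (p + b *\<^sub>R v) v) (at b)" if "0 \<le> b" "b \<le> t" for b
      using inD[of t b] inD[of 0 b] that t
      by (intro DERIV_diff line f) (simp_all add: ac_simps)
    from MVT2[OF t(1) this] obtain b where b: "0 < b" "b < t"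
      "f (p + t *\<^sub>R u + t *\<^sub>R v) - f (p + t *\<^sub>R v) - (f (p + t *\<^sub>R u + 0 *\<^sub>R v) - f (p + 0 *\<^sub>R v)) =
       (t - 0) * (f' (p + t *\<^sub>R u + b *\<^sub>R v) v - f' (p + b *\<^sub>R v) v)" by blast
    have "((\<lambda>a. f' (p + b *\<^sub>R v + a *\<^sub>R u) v) has_real_derivative fv (p + b *\<^sub>R v + a *\<^sub>R u) u) (at a)"
      if "0 \<le> a" "a \<le> t" for a
      using inD[of a b] b that by (intro line fv) (simp_all add: ac_simps)
    from MVT2[OF t(1) this] obtain a where a: "0 < a" "a < t"
      "f' (p + b *\<^sub>R v + t *\<^sub>R u) v - f' (p + b *\<^sub>R v + 0 *\<^sub>R u) v = (t - 0) * fv (p + b *\<^sub>R v + a *\<^sub>R u) u" by blast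
    have "\<Delta> = t * (t * fv (p + a *\<^sub>R u + b *\<^sub>R v) u)"
      using a(3) b(3) by (simp add: \<Delta>_def ac_simps)
    then show ?thesis using a b by (intro bexI[of _ a] bexI[of _ b]) auto
  qed
  then obtain a' b' where ab': "a' \<in> {0..t}" "b' \<in> {0..t}" "\<Delta> = t * t * fv (p + a' *\<^sub>R u + b' *\<^sub>R v) u" by blast
  have "fu (p + a *\<^sub>R u + b *\<^sub>R v) v = fv (p + a' *\<^sub>R u + b' *\<^sub>R v) u"
    using ab(3) ab'(3) t(1) by simp
  moreover have "\<bar>fu (p + a *\<^sub>R u + b *\<^sub>R v) v - fu p v\<bar> < \<epsilon>"
    using d2(2)[OF inD] near[of a b] ab by (simp add: d_def dist_real_def)
  moreover have "\<bar>fv (p + a' *\<^sub>R u + b' *\<^sub>R v) u - fv p u\<bar> < \<epsilon>"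
    using d3(2)[OF inD] near[of a' b'] ab' by (simp add: d_def dist_real_def)
  moreover have "\<bar>fu p v - fv p u\<bar> \<le> \<bar>z - fu p v\<bar> + \<bar>z - fv p u\<bar>" for z
    by linarith
  ultimately have "\<bar>fu p v - fv p u\<bar> < \<epsilon> + \<epsilon>"
    by (smt (verit))
  then show False by (simp add: \<epsilon>_def)
qed

lemma Ck_on_Suc_differentiable: "Ck_on (Suc k) U f \<Longrightarrow> x \<in> U \<Longrightarrow> (f has_derivative frechet_derivative f (at x)) (at x)"
  by (simp add: frechet_derivative_works)

lemma second_derivative_symmetric:
  fixes f :: "'a::euclidean_space \<Rightarrow> 'b::euclidean_space"
  assumes D: "open D" "p \<in> D" and f: "Ck_on 2 D f"
  shows "frechet_derivative (\<lambda>x. frechet_derivative f (at x) u) (at p) v =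
    frechet_derivative (\<lambda>x. frechet_derivative f (at x) v) (at p) u"
proof (rule euclidean_eqI)
  fix b :: 'b
  let ?f' = "\<lambda>x. frechet_derivative f (at x)"
  let ?H = "\<lambda>w x. frechet_derivative (\<lambda>x. ?f' x w) (at x)"
  have 1: "(f has_derivative ?f' x) (at x)" if "x \<in> D" for x
    using Ck_on_Suc_differentiable[of 1 D f x] f that by (simp add: numeral_2_eq_2)
  have 2: "((\<lambda>x. ?f' x w) has_derivative ?H w x) (at x)" if "x \<in> D" for x w
    using Ck_on_Suc_differentiable[of 0 D "\<lambda>x. ?f' x w" x] f that by (simp add: numeral_2_eq_2)
  have 3: "continuous_on D (\<lambda>x. ?H w x z)" for w z
    using f by (simp add: numeral_2_eq_2)
  show "?H u p v \<bullet> b = ?H v p u \<bullet> b"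
    by (rule second_derivative_symmetric_real[OF D, where f = "\<lambda>x. f x \<bullet> b" and f' = "\<lambda>x w. ?f' x w \<bullet> b"
        and fu = "\<lambda>x z. ?H u x z \<bullet> b" and fv = "\<lambda>x z. ?H v x z \<bullet> b"])
      (auto intro!: has_derivative_inner_left 1 2 continuous_intros 3)
qed

text \<open>The sum bounds the operator norm of T - id and is a finite expression in the vectors T
  b, so continuity of these is enough to control it.\<close>

lemma linear_near_identity:
  fixes T :: "'a::euclidean_space \<Rightarrow> 'a"
  assumes "linear T"
  shows "norm (T v - v) \<le> (\<Sum>b\<in>Basis. norm (T b - b)) * norm v"
proof -
  have "T v - v = T (\<Sum>b\<in>Basis. (v \<bullet> b) *\<^sub>R b) - (\<Sum>b\<in>Basis. (v \<bullet> b) *\<^sub>R b)"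
    by (simp add: euclidean_representation)
  also have "\<dots> = (\<Sum>b\<in>Basis. (v \<bullet> b) *\<^sub>R (T b - b))"
    using assms by (simp add: linear_sum linear_scale sum_subtractf scaleR_diff_right)
  also have "norm \<dots> \<le> (\<Sum>b\<in>Basis. norm v * norm (T b - b))"
    by (rule sum_norm_le) (auto intro!: mult_right_mono Basis_le_norm)
  finally show ?thesis by (simp add: sum_distrib_left mult.commute)
qed

text \<open>The error is measured against a, the function whose derivative is sought. Where \<kappa>
  < 1/2 this gives norm (a x) \<le> 2 norm (d x), and d x is of the order of x - e; as \<kappa>
  tends to 0, the error is of smaller order.\<close>

lemma has_derivative_relative_error:
  fixes a d :: "'a::real_normed_vector \<Rightarrow> 'b::real_normed_vector"
  assumes d: "(d has_derivative d') (at e)" "d e = 0" and a: "a e = 0"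
    and \<kappa>: "(\<kappa> \<longlongrightarrow> 0) (at e)" and nonneg: "\<And>x. \<kappa> x \<ge> (0::real)"
    and near: "eventually (\<lambda>x. norm (a x - d x) \<le> \<kappa> x * norm (a x)) (at e)"
  shows "(a has_derivative d') (at e)"
proof -
  obtain B where B: "\<And>x. norm (d' x) \<le> norm x * B" "B > 0"
    using bounded_linear.pos_bounded[OF has_derivative_bounded_linear[OF d(1)]] by blast
  have lim: "((\<lambda>x. norm (d x - d e - d' (x - e)) / norm (x - e)) \<longlongrightarrow> 0) (at e)"
    using d(1) by (simp add: has_derivative_iff_norm)
  have bound: "eventually (\<lambda>x. norm (a x - a e - d' (x - e)) / norm (x - e) \<le>
      norm (d x - d e - d' (x - e)) / norm (x - e) + 2 * \<kappa> x * (B + 1)) (at e)"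
  proof -
    have "eventually (\<lambda>x. \<kappa> x < 1/2) (at e)"
      using order_tendstoD(2)[OF \<kappa>, of "1/2"] by simp
    moreover have "eventually (\<lambda>x. norm (d x - d e - d' (x - e)) / norm (x - e) < 1) (at e)"
      using order_tendstoD(2)[OF lim, of 1] by simp
    moreover have "eventually (\<lambda>x. x \<noteq> e) (at e)"
      by (simp add: eventually_at_filter)
    ultimately show ?thesis using near
    proof eventually_elim
      case (elim x)
      have pos: "norm (x - e) > 0" using elim by simp
      have "norm (a x) \<le> norm (d x) + norm (a x - d x)"
        using norm_triangle_ineq[of "d x" "a x - d x"] by simp
      also have "\<dots> \<le> norm (d x) + 1/2 * norm (a x)"
        using elim mult_right_mono[of "\<kappa> x" "1/2" "norm (a x)"] by simp
      finally have ad: "norm (a x) \<le> 2 * norm (d x)" by simp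
      have "norm (d x) \<le> norm (d x - d e - d' (x - e)) + norm (d' (x - e))"
        using norm_triangle_ineq[of "d x - d e - d' (x - e)" "d' (x - e)"] d(2) by simp
      also have "\<dots> \<le> norm (x - e) + norm (x - e) * B"
        using elim pos B(1)[of "x - e"] by (intro add_mono) (auto simp: divide_less_eq)
      finally have dx: "norm (d x) \<le> norm (x - e) * (B + 1)" by (simp add: algebra_simps)
      have "norm (a x - d x) \<le> \<kappa> x * (2 * (norm (x - e) * (B + 1)))"
        using elim(4) mult_left_mono[of "norm (a x)" "2 * (norm (x - e) * (B + 1))" "\<kappa> x"] ad dx nonneg[of x]
        by linarith
      then have "norm (a x - a e - d' (x - e)) \<le> norm (d x - d e - d' (x - e)) + 2 * \<kappa> x * (B + 1) * norm (x - e)"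
        using norm_triangle_ineq[of "a x - d x" "d x - d e - d' (x - e)"] a d(2) by (simp add: algebra_simps)
      then have "norm (a x - a e - d' (x - e)) / norm (x - e) \<le>
          (norm (d x - d e - d' (x - e)) + 2 * \<kappa> x * (B + 1) * norm (x - e)) / norm (x - e)"
        by (intro divide_right_mono) auto
      then show ?case using pos by (simp add: add_divide_distrib)
    qed
  qed
  have "((\<lambda>x. norm (d x - d e - d' (x - e)) / norm (x - e) + 2 * \<kappa> x * (B + 1)) \<longlongrightarrow> 0) (at e)"
    by (rule tendsto_eq_intros lim \<kappa> refl | simp)+
  then have "((\<lambda>x. norm (a x - a e - d' (x - e)) / norm (x - e)) \<longlongrightarrow> 0) (at e)"
    by (intro tendsto_sandwich[OF _ bound tendsto_const]) auto
  then show ?thesis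
    using d(1) by (simp add: has_derivative_iff_norm)
qed

section \<open>Lie groups in charts\<close>

locale lie = 
  fixes G :: "'s::{t2_space, second_countable_topology} monoid" (structure)
    and A :: "('s, real^'n) atlas"
  assumes lie: "lie_group G A"
begin

sublocale top_group G
proof -
  interpret group G using lie by (simp add: lie_group_def)
  show "top_group G"
    by unfold_locales (use lie in \<open>simp_all add: lie_group_def smooth_map_def\<close>)
qed

lemma chart:
  assumes "(V, f) \<in> A"
  shows "open V" "open (f ` V)" "continuous_on V f" "continuous_on (f ` V) (inv_into V f)" "inj_on f V"
proof -
  have "open V \<and> open (f ` V) \<and> (\<exists>f'. homeomorphism V (f ` V) f f')"
    using lie assms by (auto simp: lie_group_def smooth_manifold_def)
  then obtain f' where f': "open V" "open (f ` V)" "homeomorphism V (f ` V) f f'" by blast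
  show "open V" "open (f ` V)" "continuous_on V f"
    using f' by (auto simp: homeomorphism_def)
  show inj: "inj_on f V"
    using f'(3) by (metis homeomorphism_apply1 inj_on_def)
  have "inv_into V f x = f' x" if "x \<in> f ` V" for x
    using f'(3) inj that by (metis homeomorphism_apply2 homeomorphism_image2 imageI inv_into_f_eq)
  then show "continuous_on (f ` V) (inv_into V f)"
    using f'(3) by (simp add: homeomorphism_def cong: continuous_on_cong)
qed

lemma chart_inv: "(V, f) \<in> A \<Longrightarrow> s \<in> V \<Longrightarrow> inv_into V f (f s) = s"
  using chart(5) by (simp add: inv_into_f_f)

lemma exists_chart: "\<exists>V f. (V, f) \<in> A \<and> s \<in> V"
proof -
  have "s \<in> (\<Union>(V, f)\<in>A. V)"
    using lie by (simp add: lie_group_def smooth_manifold_def)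
  then show ?thesis by blast
qed

lemma open_chart_preimage:
  assumes V: "(V, f) \<in> A" and W: "open W"
  shows "open {x \<in> f ` V. inv_into V f x \<in> W}"
  using continuous_open_preimage[OF chart(4)[OF V] chart(2)[OF V] W]
  by (simp add: vimage_def Int_def)

definition chart_mult where
  "chart_mult U f U' f' h = (\<lambda>(x, y). h (inv_into U f x \<otimes> inv_into U' f' y))"

definition chart_mult_dom where
  "chart_mult_dom U f U' f' V =
     {(x, y). x \<in> f ` U \<and> y \<in> f' ` U' \<and> inv_into U f x \<otimes> inv_into U' f' y \<in> V}"

text \<open>The definition speaks of the inverse of a product chart. It is the pair of inverses on
  the product of the images, so both expressions agree on an open domain and smoothness
  transfers.\<close>

lemma chart_mult_smooth:
  assumes U: "(U, f) \<in> A" and U': "(U', f') \<in> A" and V: "(V, h) \<in> A"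
  shows "open (chart_mult_dom U f U' f' V)"
    "smooth_on (chart_mult_dom U f U' f' V) (chart_mult U f U' f' h)"
proof -
  let ?m = "\<lambda>(x, y). x \<otimes> y"
  have "open ((f ` U \<times> f' ` U') \<inter> (\<lambda>p. inv_into U f (fst p) \<otimes> inv_into U' f' (snd p)) -` V)"
    by (intro continuous_open_preimage continuous_on_mult open_Times chart(1)[OF V] chart(2)[OF U] chart(2)[OF U']
        continuous_on_compose2[OF chart(4)[OF U]] continuous_on_compose2[OF chart(4)[OF U']] continuous_intros)
      auto
  also have "(f ` U \<times> f' ` U') \<inter> (\<lambda>p. inv_into U f (fst p) \<otimes> inv_into U' f' (snd p)) -` V = chart_mult_dom U f U' f' V"
    by (auto simp: chart_mult_dom_def)
  finally show dom: "open (chart_mult_dom U f U' f' V)" .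
  have img: "map_prod f f' ` ((U \<times> U') \<inter> ?m -` V) = chart_mult_dom U f U' f' V"
    using chart_inv[OF U] chart_inv[OF U'] by (force simp: chart_mult_dom_def)
  have "(U \<times> U', map_prod f f') \<in> prod_atlas A A"
    using U U' by (auto simp: prod_atlas_def)
  moreover have "smooth_map (prod_atlas A A) A ?m"
    using lie by (simp add: lie_group_def)
  ultimately have sm: "smooth_on (chart_mult_dom U f U' f' V) (h \<circ> ?m \<circ> inv_into (U \<times> U') (map_prod f f'))"
    using V unfolding smooth_map_def img[symmetric] by blast
  have inv: "inv_into (U \<times> U') (map_prod f f') (x, y) = (inv_into U f x, inv_into U' f' y)"
    if "x \<in> f ` U" "y \<in> f' ` U'" for x y
    using that chart(5)[OF U] chart(5)[OF U']
    by (intro inv_into_f_eq map_prod_inj_on) (auto simp: f_inv_into_f inv_into_into)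
  have "(h \<circ> ?m \<circ> inv_into (U \<times> U') (map_prod f f')) p = chart_mult U f U' f' h p"
    if "p \<in> chart_mult_dom U f U' f' V" for p
    using that inv by (auto simp: chart_mult_dom_def chart_mult_def)
  then show "smooth_on (chart_mult_dom U f U' f' V) (chart_mult U f U' f' h)"
    using sm Ck_on_cong[OF dom] unfolding smooth_on_def by blast
qed

lemma chart_mult_differentiable:
  assumes U: "(U, f) \<in> A" and U': "(U', f') \<in> A" and V: "(V, h) \<in> A"
    and a: "a \<in> U" "b \<in> U'" "a \<otimes> b \<in> V"
  shows "chart_mult U f U' f' h differentiable (at (f a, f' b))"
proof -
  have "Ck_on (Suc 0) (chart_mult_dom U f U' f' V) (chart_mult U f U' f' h)"
    using chart_mult_smooth(2)[OF U U' V] unfolding smooth_on_def by blast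
  moreover have "(f a, f' b) \<in> chart_mult_dom U f U' f' V"
    using a chart_inv[OF U] chart_inv[OF U'] by (simp add: chart_mult_dom_def)
  ultimately show ?thesis by simp
qed

text \<open>Only first-order differentiability is recorded. It composes by the chain rule and covers
  translations and conjugations; second derivatives are taken only of the multiplication in a chart
  at the identity.\<close>

definition dmap :: "('s \<Rightarrow> 's) \<Rightarrow> bool" where
  "dmap h \<longleftrightarrow> continuous_on UNIV h \<and> (\<forall>V f W g s. (V, f) \<in> A \<longrightarrow> (W, g) \<in> A \<longrightarrow> s \<in> V \<longrightarrow> h s \<in> W \<longrightarrow>
     (\<lambda>x. g (h (inv_into V f x))) differentiable (at (f s)))"

lemma open_chart_vimage:
  assumes "(V, f) \<in> A" "continuous_on UNIV h" "open W"
  shows "open {x \<in> f ` V. h (inv_into V f x) \<in> W}"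
proof -
  have "continuous_on (f ` V) (\<lambda>x. h (inv_into V f x))"
    by (rule continuous_on_compose2[OF assms(2) chart(4)[OF assms(1)]]) simp
  from continuous_open_preimage[OF this chart(2)[OF assms(1)] assms(3)] show ?thesis
    by (simp add: vimage_def Int_def)
qed

lemma dmap_comp:
  assumes h1: "dmap h1" and h2: "dmap h2"
  shows "dmap (\<lambda>x. h2 (h1 x))"
  unfolding dmap_def
proof (intro conjI allI impI)
  have c: "continuous_on UNIV h1" "continuous_on UNIV h2" using h1 h2 by (auto simp: dmap_def)
  show "continuous_on UNIV (\<lambda>x. h2 (h1 x))"
    by (rule continuous_on_compose2[OF c(2,1)]) simp
  fix V f W g s assume V: "(V, f) \<in> A" "(W, g) \<in> A" "s \<in> V" "h2 (h1 s) \<in> W"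
  obtain K k where K: "(K, k) \<in> A" "h1 s \<in> K" using exists_chart by blast
  have 1: "(\<lambda>x. k (h1 (inv_into V f x))) differentiable (at (f s))"
    using h1 V K by (auto simp: dmap_def)
  have 2: "(\<lambda>x. g (h2 (inv_into K k x))) differentiable (at (k (h1 s)))"
    using h2 V K by (auto simp: dmap_def)
  have "((\<lambda>x. g (h2 (inv_into K k x))) \<circ> (\<lambda>x. k (h1 (inv_into V f x)))) differentiable (at (f s))"
    by (rule differentiable_chain_at[OF 1]) (use 2 V in \<open>simp add: chart_inv\<close>)
  then obtain d where d: "(((\<lambda>x. g (h2 (inv_into K k x))) \<circ> (\<lambda>x. k (h1 (inv_into V f x)))) has_derivative d) (at (f s))"
    by (auto simp: differentiable_def)
  have "((\<lambda>x. g (h2 (h1 (inv_into V f x)))) has_derivative d) (at (f s))"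
    by (rule has_derivative_transform_within_open[OF d open_chart_vimage[OF V(1) c(1) chart(1)[OF K(1)]]])
      (use V K in \<open>auto simp: chart_inv\<close>)
  then show "(\<lambda>x. g (h2 (h1 (inv_into V f x)))) differentiable (at (f s))"
    by (auto simp: differentiable_def)
qed

lemma dmap_left: "dmap (\<lambda>x. g \<otimes> x)"
  unfolding dmap_def
proof (intro conjI allI impI)
  show "continuous_on UNIV (\<lambda>x. g \<otimes> x)" by (intro continuous_intros)
  fix V f W h s assume V: "(V, f) \<in> A" "(W, h) \<in> A" "s \<in> V" "g \<otimes> s \<in> W"
  obtain K k where K: "(K, k) \<in> A" "g \<in> K" using exists_chart by blast
  have 1: "chart_mult K k V f h differentiable (at ((\<lambda>x. (k g, x)) (f s)))"
    by (rule chart_mult_differentiable[OF K(1) V(1,2) K(2) V(3,4)])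
  have "(chart_mult K k V f h \<circ> (\<lambda>x. (k g, x))) differentiable (at (f s))"
    by (rule differentiable_chain_at[where g = "chart_mult K k V f h"])
      (use 1 in \<open>auto intro!: differentiable_Pair\<close>)
  then show "(\<lambda>x. h (g \<otimes> inv_into V f x)) differentiable (at (f s))"
    using K by (simp add: chart_mult_def o_def chart_inv)
qed

lemma dmap_right: "dmap (\<lambda>x. x \<otimes> g)"
  unfolding dmap_def
proof (intro conjI allI impI)
  show "continuous_on UNIV (\<lambda>x. x \<otimes> g)" by (intro continuous_intros)
  fix V f W h s assume V: "(V, f) \<in> A" "(W, h) \<in> A" "s \<in> V" "s \<otimes> g \<in> W"
  obtain K k where K: "(K, k) \<in> A" "g \<in> K" using exists_chart by blast
  have 1: "chart_mult V f K k h differentiable (at ((\<lambda>x. (x, k g)) (f s)))"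
    by (rule chart_mult_differentiable[OF V(1) K(1) V(2,3) K(2) V(4)])
  have "(chart_mult V f K k h \<circ> (\<lambda>x. (x, k g))) differentiable (at (f s))"
    by (rule differentiable_chain_at[where g = "chart_mult V f K k h"])
      (use 1 in \<open>auto intro!: differentiable_Pair\<close>)
  then show "(\<lambda>x. h (inv_into V f x \<otimes> g)) differentiable (at (f s))"
    using K by (simp add: chart_mult_def o_def chart_inv)
qed

lemma dmap_conj: "dmap (\<lambda>x. g \<otimes> x \<otimes> inv g)"
  using dmap_comp[OF dmap_left dmap_right] .

end

section \<open>The differential of the adjoint representation\<close>

locale lie_chart = lie G A for G :: "'s::{t2_space, second_countable_topology} monoid" (structure)
    and A :: "('s, real^'n) atlas" +
  fixes U :: "'s set" and \<phi> :: "'s \<Rightarrow> real^'n"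
  assumes UA: "(U, \<phi>) \<in> A" and one_U: "\<one> \<in> U"
begin

abbreviation "\<psi> \<equiv> inv_into U \<phi>"
abbreviation "e \<equiv> \<phi> \<one>"

definition "m = chart_mult U \<phi> U \<phi> \<phi>"
definition "D = chart_mult_dom U \<phi> U \<phi> U"
definition "Dm p = frechet_derivative m (at p)"
text \<open>The second derivative of \<open>m\<close> at p, read as a form in w and the remaining
  argument.\<close>

definition "H w p = frechet_derivative (\<lambda>p. Dm p w) (at p)"

definition conj :: "'s \<Rightarrow> 's \<Rightarrow> 's" where
  "conj g x = g \<otimes> x \<otimes> inv g"

definition cj :: "'s \<Rightarrow> real^'n \<Rightarrow> real^'n" where
  "cj g x = \<phi> (conj g (\<psi> x))"

definition Ad :: "'s \<Rightarrow> real^'n \<Rightarrow> real^'n" where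
  "Ad g = frechet_derivative (cj g) (at e)"

text \<open>The differential at e of left translation by the point with coordinates x, so that x
  \<mapsto> L x v is the left-invariant field with value v at e. \<open>R\<close> does the same for
  right translations.\<close>

definition L :: "real^'n \<Rightarrow> real^'n \<Rightarrow> real^'n" where
  "L x = frechet_derivative (\<lambda>y. \<phi> (\<psi> x \<otimes> \<psi> y)) (at e)"

definition R :: "real^'n \<Rightarrow> real^'n \<Rightarrow> real^'n" where
  "R x = frechet_derivative (\<lambda>y. \<phi> (\<psi> y \<otimes> \<psi> x)) (at e)"

lemmas chart_U = chart[OF UA] and inv_U [simp] = chart_inv[OF UA]

lemma \<phi>_inv [simp]: "x \<in> \<phi> ` U \<Longrightarrow> \<phi> (\<psi> x) = x"
  by (rule f_inv_into_f)

lemma inv_mem [simp]: "x \<in> \<phi> ` U \<Longrightarrow> \<psi> x \<in> U"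
  by (rule inv_into_into)

lemma e_mem [simp]: "e \<in> \<phi> ` U" using one_U by simp

lemma inv_e [simp]: "\<psi> e = \<one>" using one_U by simp

lemma conj_mult: "conj g (x \<otimes> y) = conj g x \<otimes> conj g y" and conj_conj: "conj (g \<otimes> h) x = conj g (conj h x)"
  and conj_one [simp]: "conj g \<one> = \<one>" "conj \<one> x = x"
  by (simp_all add: conj_def m_assoc inv_mult_group) (simp_all add: m_assoc[symmetric])

lemma continuous_conj: "continuous_on UNIV (conj g)"
  unfolding conj_def by (intro continuous_intros)

lemma cj_e [simp]: "cj g e = e"
  by (simp add: cj_def)

lemma open_D: "open D" and smooth_m: "smooth_on D m"
  using chart_mult_smooth[OF UA UA UA] by (simp_all add: D_def m_def)

lemma mem_D: "x \<in> \<phi> ` U \<Longrightarrow> y \<in> \<phi> ` U \<Longrightarrow> \<psi> x \<otimes> \<psi> y \<in> U \<Longrightarrow> (x, y) \<in> D"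
  by (simp add: D_def chart_mult_dom_def)

lemma mem_D_e [simp]: "x \<in> \<phi> ` U \<Longrightarrow> (x, e) \<in> D" "x \<in> \<phi> ` U \<Longrightarrow> (e, x) \<in> D"
  by (auto intro!: mem_D simp: one_U)

lemma m_eq: "m (x, y) = \<phi> (\<psi> x \<otimes> \<psi> y)"
  by (simp add: m_def chart_mult_def)

lemma m_deriv: "p \<in> D \<Longrightarrow> (m has_derivative Dm p) (at p)"
  using Ck_on_Suc_differentiable[of 0 D m p] smooth_m unfolding smooth_on_def Dm_def by blast

lemma m_C2: "Ck_on 2 D m"
  using smooth_m unfolding smooth_on_def by blast

lemma Dm_deriv: "p \<in> D \<Longrightarrow> ((\<lambda>p. Dm p w) has_derivative H w p) (at p)"
  unfolding H_def by (rule Ck_on_Suc_differentiable[of 0 D]) (use m_C2 in \<open>simp_all add: numeral_2_eq_2 Dm_def del: split_paired_All\<close>)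

lemma H_cont: "continuous_on D (\<lambda>p. H w p u)"
  using m_C2 by (simp add: numeral_2_eq_2 Dm_def H_def del: split_paired_All)

lemma H_symmetric: "p \<in> D \<Longrightarrow> H w p u = H u p w"
  unfolding H_def Dm_def by (rule second_derivative_symmetric[OF open_D _ m_C2])

lemma m_deriv_left:
  assumes "x \<in> \<phi> ` U"
  shows "((\<lambda>y. m (x, y)) has_derivative (\<lambda>v. Dm (x, e) (0, v))) (at e)"
  by (rule has_derivative_compose[where f = "\<lambda>y. (x, y)" and g = m])
    (auto intro!: derivative_eq_intros m_deriv mem_D_e assms)

lemma m_deriv_right:
  assumes "x \<in> \<phi> ` U"
  shows "((\<lambda>y. m (y, x)) has_derivative (\<lambda>v. Dm (e, x) (v, 0))) (at e)"
  by (rule has_derivative_compose[where f = "\<lambda>y. (y, x)" and g = m])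
    (auto intro!: derivative_eq_intros m_deriv mem_D_e assms)

lemma L_eq: "x \<in> \<phi> ` U \<Longrightarrow> L x v = Dm (x, e) (0, v)"
  using frechet_derivative_at[OF m_deriv_left] by (simp add: L_def m_eq) metis

lemma R_eq: "x \<in> \<phi> ` U \<Longrightarrow> R x v = Dm (e, x) (v, 0)"
  using frechet_derivative_at[OF m_deriv_right] by (simp add: R_def m_eq) metis

lemma L_deriv: "x \<in> \<phi> ` U \<Longrightarrow> ((\<lambda>y. m (x, y)) has_derivative L x) (at e)"
  using m_deriv_left L_eq by presburger

lemma R_deriv: "x \<in> \<phi> ` U \<Longrightarrow> ((\<lambda>y. m (y, x)) has_derivative R x) (at e)"
  using m_deriv_right R_eq by presburger

lemma linear_L: "x \<in> \<phi> ` U \<Longrightarrow> linear (L x)" and linear_R: "x \<in> \<phi> ` U \<Longrightarrow> linear (R x)"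
  using L_deriv R_deriv has_derivative_linear by blast+

lemma L_e: "L e v = v" and R_e: "R e v = v"
proof -
  have "((\<lambda>y. m (e, y)) has_derivative (\<lambda>v. v)) (at e)" "((\<lambda>y. m (y, e)) has_derivative (\<lambda>v. v)) (at e)"
    by (rule has_derivative_transform_within_open[OF has_derivative_ident chart_U(2)]; simp add: m_eq)+
  then show "L e v = v" "R e v = v"
    using has_derivative_unique[OF L_deriv[OF e_mem]] has_derivative_unique[OF R_deriv[OF e_mem]] by metis+
qed

lemma L_field_deriv:
  assumes x: "x \<in> \<phi> ` U"
  shows "((\<lambda>x. L x v) has_derivative (\<lambda>X. H (0, v) (x, e) (X, 0))) (at x)"
proof -
  have "((\<lambda>x. Dm (x, e) (0, v)) has_derivative (\<lambda>X. H (0, v) (x, e) (X, 0))) (at x)"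
    by (rule has_derivative_compose[where f = "\<lambda>x. (x, e)" and g = "\<lambda>p. Dm p (0, v)"])
      (auto intro!: derivative_eq_intros Dm_deriv mem_D_e x)
  then show ?thesis
    by (rule has_derivative_transform_within_open[OF _ chart_U(2) x]) (simp add: L_eq)
qed

lemma R_field_deriv:
  assumes x: "x \<in> \<phi> ` U"
  shows "((\<lambda>x. R x v) has_derivative (\<lambda>X. H (v, 0) (e, x) (0, X))) (at x)"
proof -
  have "((\<lambda>x. Dm (e, x) (v, 0)) has_derivative (\<lambda>X. H (v, 0) (e, x) (0, X))) (at x)"
    by (rule has_derivative_compose[where f = "\<lambda>x. (e, x)" and g = "\<lambda>p. Dm p (v, 0)"])
      (auto intro!: derivative_eq_intros Dm_deriv mem_D_e x)
  then show ?thesis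
    by (rule has_derivative_transform_within_open[OF _ chart_U(2) x]) (simp add: R_eq)
qed

lemma lie_bracket_eq: "lie_bracket G (U, \<phi>) X Y = H (0, Y) (e, e) (X, 0) - H (0, X) (e, e) (Y, 0)"
proof -
  have "left_inv_field G (U, \<phi>) X = (\<lambda>x. L x X)" for X
    by (simp add: left_inv_field_def L_def)
  moreover have "frechet_derivative (\<lambda>x. L x v) (at e) = (\<lambda>X. H (0, v) (e, e) (X, 0))" for v
    using frechet_derivative_at[OF L_field_deriv[OF e_mem]] by simp
  ultimately show ?thesis
    by (simp add: lie_bracket_def vector_field_bracket_def L_e)
qed

lemma cj_deriv:
  assumes "x \<in> \<phi> ` U" "conj g (\<psi> x) \<in> U"
  shows "(cj g has_derivative frechet_derivative (cj g) (at x)) (at x)"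
proof -
  have "(\<lambda>x. \<phi> (conj g (\<psi> x))) differentiable (at (\<phi> (\<psi> x)))"
    using dmap_conj[of g] UA assms(2) inv_mem[OF assms(1)] unfolding dmap_def conj_def by blast
  then show ?thesis
    using assms(1) by (simp add: cj_def[abs_def] frechet_derivative_works)
qed

lemma Ad_deriv: "(cj g has_derivative Ad g) (at e)"
  unfolding Ad_def by (rule cj_deriv) (simp_all add: one_U)

lemma linear_Ad: "linear (Ad g)"
  using Ad_deriv has_derivative_linear by blast

lemma open_conj_dom: "open {x \<in> \<phi> ` U. conj g (\<psi> x) \<in> U}"
  by (rule open_chart_vimage[OF UA continuous_conj chart_U(1)])

lemma Ad_mult: "Ad (g \<otimes> h) v = Ad g (Ad h v)"
proof -
  have "((\<lambda>x. cj g (cj h x)) has_derivative (\<lambda>v. Ad g (Ad h v))) (at e)"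
    by (rule has_derivative_compose[OF Ad_deriv]) (simp add: Ad_deriv)
  then have "(cj (g \<otimes> h) has_derivative (\<lambda>v. Ad g (Ad h v))) (at e)"
    by (rule has_derivative_transform_within_open[OF _ open_conj_dom[of h]])
      (simp_all add: one_U cj_def conj_conj)
  from has_derivative_unique[OF Ad_deriv this] show ?thesis by metis
qed

lemma Ad_one: "Ad \<one> v = v"
proof -
  have "(cj \<one> has_derivative (\<lambda>v. v)) (at e)"
    by (rule has_derivative_transform_within_open[OF has_derivative_ident chart_U(2)]) (simp_all add: cj_def)
  from has_derivative_unique[OF Ad_deriv this] show ?thesis by metis
qed

text \<open>Differentiate x y = (x y inv x) x in y at the identity.\<close>

lemma R_Ad:
  assumes x: "x \<in> \<phi> ` U"
  shows "R x (Ad (\<psi> x) v) = L x v"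
proof -
  have "((\<lambda>y. m (cj (\<psi> x) y, x)) has_derivative (\<lambda>v. R x (Ad (\<psi> x) v))) (at e)"
    by (rule has_derivative_compose[OF Ad_deriv, where g = "\<lambda>y. m (y, x)"]) (simp add: R_deriv x)
  then have "((\<lambda>y. m (x, y)) has_derivative (\<lambda>v. R x (Ad (\<psi> x) v))) (at e)"
    by (rule has_derivative_transform_within_open[OF _ open_conj_dom[of "\<psi> x"]])
      (auto simp: one_U m_eq cj_def conj_def m_assoc)
  from has_derivative_unique[OF L_deriv[OF x] this] show ?thesis by metis
qed

text \<open>The differential of Ad is ad, obtained without differentiating conjugation twice. As L x
  v - R x v = R x (Ad v - v) and R x tends to the identity, Ad v - v has the derivative of the
  difference of the two fields; symmetry of the second derivative of \<open>m\<close> turns that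
  into the bracket.\<close>

lemma Ad_field_deriv: "((\<lambda>x. Ad (\<psi> x) v) has_derivative (\<lambda>X. lie_bracket G (U, \<phi>) X v)) (at e)"
proof -
  define \<kappa> where "\<kappa> x = (\<Sum>b\<in>Basis. norm (R x b - b))" for x
  have "((\<lambda>x. Ad (\<psi> x) v - v) has_derivative (\<lambda>X. lie_bracket G (U, \<phi>) X v)) (at e)"
  proof (rule has_derivative_relative_error[where d = "\<lambda>x. L x v - R x v" and \<kappa> = \<kappa>])
    show "((\<lambda>x. L x v - R x v) has_derivative (\<lambda>X. lie_bracket G (U, \<phi>) X v)) (at e)"
      using has_derivative_diff[OF L_field_deriv[OF e_mem] R_field_deriv[OF e_mem], of v v]
        H_symmetric[of "(e, e)" "(v, 0)"] by (simp add: lie_bracket_eq)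
    show "(\<kappa> \<longlongrightarrow> 0) (at e)"
    proof -
      have "((\<lambda>x. norm (R x b - b)) \<longlongrightarrow> norm (R e b - b)) (at e)" for b
        using has_derivative_continuous[OF R_field_deriv[OF e_mem], of b]
        by (intro tendsto_intros) (simp add: continuous_within)
      then have "((\<lambda>x. norm (R x b - b)) \<longlongrightarrow> 0) (at e)" for b
        by (simp add: R_e)
      then show ?thesis unfolding \<kappa>_def by (intro tendsto_null_sum) blast
    qed
    have "eventually (\<lambda>x. x \<in> \<phi> ` U) (at e)"
      using chart_U(2) by (auto simp: eventually_at_topological)
    then show "eventually (\<lambda>x. norm (Ad (\<psi> x) v - v - (L x v - R x v)) \<le> \<kappa> x * norm (Ad (\<psi> x) v - v)) (at e)"
    proof eventually_elim
      case (elim x)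
      have "L x v - R x v = R x (Ad (\<psi> x) v - v)"
        using R_Ad[OF elim] linear_diff[OF linear_R[OF elim]] by simp
      then show ?case
        using linear_near_identity[OF linear_R[OF elim], of "Ad (\<psi> x) v - v"]
        by (simp add: \<kappa>_def norm_minus_commute)
    qed
  qed (auto simp: L_e R_e Ad_one \<kappa>_def sum_nonneg)
  from has_derivative_add[OF this has_derivative_const[of v]] show ?thesis by simp
qed

text \<open>The homomorphism rule for conjugation, differentiated in the second factor: conjugation
  maps left-invariant fields to left-invariant fields. Along a curve this is the differential
  equation behind \<open>conj_close_estimate\<close>.\<close>

lemma cj_deriv_L:
  assumes x: "x \<in> \<phi> ` U" "conj g (\<psi> x) \<in> U"
  shows "frechet_derivative (cj g) (at x) (L x v) = L (cj g x) (Ad g v)"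
proof -
  have cx: "cj g x \<in> \<phi> ` U" using x by (simp add: cj_def)
  have "((\<lambda>y. cj g (m (x, y))) has_derivative (\<lambda>v. frechet_derivative (cj g) (at x) (L x v))) (at e)"
    by (rule has_derivative_compose[OF L_deriv[OF x(1)]]) (use cj_deriv[OF x] x in \<open>simp add: m_eq\<close>)
  moreover have "((\<lambda>y. cj g (m (x, y))) has_derivative (\<lambda>v. L (cj g x) (Ad g v))) (at e)"
  proof (rule has_derivative_transform_within_open)
    show "((\<lambda>y. m (cj g x, cj g y)) has_derivative (\<lambda>v. L (cj g x) (Ad g v))) (at e)"
      by (rule has_derivative_compose[OF Ad_deriv, where g = "\<lambda>y. m (cj g x, y)"]) (simp add: L_deriv cx)
    let ?W = "{y \<in> \<phi> ` U. conj g (\<psi> y) \<in> U} \<inter> {y \<in> \<phi> ` U. \<psi> x \<otimes> \<psi> y \<in> U}"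
    show "open ?W"
      by (intro open_Int open_conj_dom open_chart_vimage[OF UA _ chart_U(1)] continuous_intros)
    show "e \<in> ?W" using x by (simp add: one_U)
    show "m (cj g x, cj g y) = cj g (m (x, y))" if "y \<in> ?W" for y
      using that x by (simp add: m_eq cj_def conj_mult)
  qed
  ultimately show ?thesis
    using has_derivative_unique by metis
qed

text \<open>The constants of the differential inequality for conjugation. Distance 1/2 from the
  identity keeps L x invertible, and the Lipschitz bound comes from the continuous second
  derivatives of \<open>m\<close> on a compact convex ball.\<close>

lemma L_local:
  obtains r K where "r > 0" "K \<ge> 0" "cball e r \<subseteq> \<phi> ` U"
    "\<And>x v. x \<in> cball e r \<Longrightarrow> norm (L x v - v) \<le> norm v / 2"
    "\<And>x y v. x \<in> cball e r \<Longrightarrow> y \<in> cball e r \<Longrightarrow> norm (L x v - L y v) \<le> K * norm (x - y) * norm v"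
proof -
  obtain r1 where r1: "r1 > 0" "cball e r1 \<subseteq> \<phi> ` U"
    using chart_U(2) open_contains_cball e_mem by meson
  have cont: "continuous_on (\<phi> ` U) (\<lambda>x. L x v)" for v
    using has_derivative_continuous[OF L_field_deriv] continuous_at_imp_continuous_on by blast
  define S where "S x = (\<Sum>b\<in>Basis. norm (L x b - b))" for x
  have "continuous_on (\<phi> ` U) S"
    unfolding S_def by (intro continuous_intros cont)
  then have "\<exists>d>0. \<forall>x\<in>\<phi> ` U. dist x e < d \<longrightarrow> dist (S x) (S e) < 1/2"
    unfolding continuous_on_iff using e_mem half_gt_zero[OF zero_less_one] by blast
  moreover have "S e = 0"
    by (simp add: S_def L_e)
  ultimately obtain r2 where r2: "r2 > 0"
    "\<And>x. x \<in> \<phi> ` U \<Longrightarrow> dist x e < r2 \<Longrightarrow> dist (S x) 0 < 1/2"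
    by auto
  define r where "r = min r1 (r2 / 2)"
  have r: "r > 0" "cball e r \<subseteq> \<phi> ` U" "\<And>x. x \<in> cball e r \<Longrightarrow> dist x e < r2"
    using r1 r2 by (auto simp: r_def dist_commute)
  have near: "norm (L x v - v) \<le> norm v / 2" if x: "x \<in> cball e r" for x v
  proof -
    have "norm (L x v - v) \<le> (\<Sum>b\<in>Basis. norm (L x b - b)) * norm v"
      using x r by (intro linear_near_identity linear_L) auto
    also have "\<dots> \<le> 1/2 * norm v"
      using r2(2)[OF _ r(3)[OF x]] x r by (intro mult_right_mono) (auto simp: dist_real_def S_def)
    finally show ?thesis by simp
  qed
  have "\<exists>B\<ge>0. \<forall>x\<in>cball e r. \<forall>y\<in>cball e r. norm (L x b - L y b) \<le> B * norm (x - y)" for b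
  proof -
    have "continuous_on (cball e r) (\<lambda>x. \<Sum>c\<in>Basis. norm (H (0, b) (x, e) (c, 0)))"
      using r by (intro continuous_intros continuous_on_compose2[OF H_cont]) auto
    then have "bounded ((\<lambda>x. \<Sum>c\<in>Basis. norm (H (0, b) (x, e) (c, 0))) ` cball e r)"
      by (intro compact_imp_bounded compact_continuous_image) auto
    then obtain B where B: "\<And>x. x \<in> cball e r \<Longrightarrow> norm (\<Sum>c\<in>Basis. norm (H (0, b) (x, e) (c, 0))) \<le> B"
      unfolding bounded_iff by blast
    have "norm (L x b - L y b) \<le> B * norm (x - y)" if "x \<in> cball e r" "y \<in> cball e r" for x y
    proof (rule differentiable_bound[OF convex_cball _ _ that])
      fix z assume z: "z \<in> cball e r"
      have d: "((\<lambda>x. L x b) has_derivative (\<lambda>X. H (0, b) (z, e) (X, 0))) (at z)"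
        using L_field_deriv z r by blast
      then show "((\<lambda>x. L x b) has_derivative (\<lambda>X. H (0, b) (z, e) (X, 0))) (at z within cball e r)"
        by (rule has_derivative_at_withinI)
      have lin: "linear (\<lambda>X. H (0, b) (z, e) (X, 0))"
        using d by (rule has_derivative_linear)
      show "onorm (\<lambda>X. H (0, b) (z, e) (X, 0)) \<le> B"
      proof (rule onorm_le)
        fix X :: "real^'n"
        have "H (0, b) (z, e) (X, 0) = (\<Sum>c\<in>Basis. (X \<bullet> c) *\<^sub>R H (0, b) (z, e) (c, 0))"
        proof -
          have "H (0, b) (z, e) ((\<Sum>c\<in>Basis. (X \<bullet> c) *\<^sub>R c), 0) = (\<Sum>c\<in>Basis. (X \<bullet> c) *\<^sub>R H (0, b) (z, e) (c, 0))"
            using linear_sum[OF lin, of "\<lambda>c. (X \<bullet> c) *\<^sub>R c" Basis] linear_scale[OF lin] by simp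
          then show ?thesis by (simp add: euclidean_representation)
        qed
        also have "norm \<dots> \<le> (\<Sum>c\<in>Basis. norm X * norm (H (0, b) (z, e) (c, 0)))"
          by (rule sum_norm_le) (auto intro!: mult_right_mono Basis_le_norm)
        also have "\<dots> = (\<Sum>c\<in>Basis. norm (H (0, b) (z, e) (c, 0))) * norm X"
          by (simp add: sum_distrib_left mult.commute)
        also have "\<dots> \<le> B * norm X"
          using B[OF z] by (intro mult_right_mono) auto
        finally show "norm (H (0, b) (z, e) (X, 0)) \<le> B * norm X" .
      qed
    qed
    moreover have "B \<ge> 0"
      using B[of e] r(1) by (smt (verit) centre_in_cball norm_ge_zero)
    ultimately show ?thesis by blast
  qed
  then obtain B where B: "\<And>b. B b \<ge> 0"
    "\<And>b x y. x \<in> cball e r \<Longrightarrow> y \<in> cball e r \<Longrightarrow> norm (L x b - L y b) \<le> B b * norm (x - y)"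
    by metis
  define K where "K = (\<Sum>b\<in>Basis. B b)"
  have K: "norm (L x v - L y v) \<le> K * norm (x - y) * norm v" if xy: "x \<in> cball e r" "y \<in> cball e r" for x y v
  proof -
    have exp: "L x v = (\<Sum>b\<in>Basis. (v \<bullet> b) *\<^sub>R L x b)" if "x \<in> cball e r" for x
    proof -
      have "linear (L x)" using that r by (intro linear_L) auto
      then have "L x (\<Sum>b\<in>Basis. (v \<bullet> b) *\<^sub>R b) = (\<Sum>b\<in>Basis. (v \<bullet> b) *\<^sub>R L x b)"
        by (simp add: linear_sum linear_scale)
      then show ?thesis by (simp add: euclidean_representation)
    qed
    have "L x v - L y v = (\<Sum>b\<in>Basis. (v \<bullet> b) *\<^sub>R (L x b - L y b))"
      using exp[OF xy(1)] exp[OF xy(2)] by (simp add: sum_subtractf scaleR_diff_right)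
    also have "norm \<dots> \<le> (\<Sum>b\<in>Basis. norm v * (B b * norm (x - y)))"
      using B xy by (intro sum_norm_le) (auto intro!: mult_mono Basis_le_norm)
    also have "\<dots> = K * norm (x - y) * norm v"
      by (simp add: K_def sum_distrib_left sum_distrib_right ac_simps)
    finally show ?thesis .
  qed
  have "K \<ge> 0" unfolding K_def using B by (simp add: sum_nonneg)
  then show thesis using that[of r K] r near K by blast
qed

end

text \<open>A subgroup that contains a neighbourhood of \<one> is a union of translates of it, and
  so is its complement; both are open.\<close>

lemma (in top_group) connected_open_subgroup:
  assumes conn: "connected (UNIV :: 's set)" and H: "subgroup H G" and W: "open W" "\<one> \<in> W" "W \<subseteq> H"
  shows "H = UNIV"
proof -
  have nbhd: "open {y. inv x \<otimes> y \<in> W}" "x \<in> {y. inv x \<otimes> y \<in> W}" for x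
  proof -
    have "continuous_on UNIV (\<lambda>y. inv x \<otimes> y)" by (intro continuous_intros)
    from open_vimage[OF W(1) this] show "open {y. inv x \<otimes> y \<in> W}" by (simp add: vimage_def)
  qed (use W in simp)
  have 1: "y \<in> H \<longleftrightarrow> x \<in> H" if y: "inv x \<otimes> y \<in> W" for x y
  proof -
    have h: "inv x \<otimes> y \<in> H" using W y by blast
    have "y = x \<otimes> (inv x \<otimes> y)" "x = y \<otimes> inv (inv x \<otimes> y)"
      by (simp_all add: inv_mult_group m_assoc[symmetric])
    then show ?thesis
      using h H by (metis subgroup.m_closed subgroup.m_inv_closed)
  qed
  have "open H" "open (- H)"
    using nbhd 1 by (subst open_subopen, blast)+
  then show ?thesis
    using conn H subgroup.one_closed[OF H] unfolding connected_clopen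
    by (metis closed_def closedin_closed_subset empty_iff inf_top_right open_openin openin_open closed_closedin subtopology_UNIV)
qed

section \<open>Conjugation by elements with adjoint close to the identity\<close>

context lie_chart
begin

definition dev :: "'s \<Rightarrow> real" where
  "dev g = (\<Sum>b\<in>Basis. norm (Ad g b - b))"

lemma Ad_close: "norm (Ad g v - v) \<le> dev g * norm v"
  unfolding dev_def by (rule linear_near_identity[OF linear_Ad])

lemma dev_nonneg: "dev g \<ge> 0"
  by (simp add: dev_def sum_nonneg)

text \<open>Conjugation by \<open>g\<close>, read in the chart, solves a differential equation that is a small
  perturbation of the one solved by the identity when \<open>Ad g\<close> is near the identity.\<close>

lemma conj_close_estimate:
  assumes r0: "K \<ge> 0" "cball e r0 \<subseteq> \<phi> ` U"
    "\<And>x v. x \<in> cball e r0 \<Longrightarrow> norm (L x v - v) \<le> norm v / 2"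
    "\<And>x y v. x \<in> cball e r0 \<Longrightarrow> y \<in> cball e r0 \<Longrightarrow> norm (L x v - L y v) \<le> K * norm (x - y) * norm v"
    and v: "norm v \<le> r" "r \<le> r0" "3 * r \<le> 1/2" "2 * K * r \<le> 1/2"
    and \<tau>: "0 \<le> \<tau>" "\<tau> \<le> 1"
    and inside: "\<And>t. 0 \<le> t \<Longrightarrow> t \<le> \<tau> \<Longrightarrow> conj g (\<psi> (e + t *\<^sub>R v)) \<in> U \<and> cj g (e + t *\<^sub>R v) \<in> cball e r0"
    and t: "0 \<le> t" "t \<le> \<tau>"
  shows "norm (cj g (e + t *\<^sub>R v) - (e + t *\<^sub>R v)) \<le> dev g"
proof -
  define x where "x t = e + t *\<^sub>R v" for t
  define w where "w t = cj g (x t) - x t" for t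
  have x: "x t \<in> cball e r0" if "0 \<le> t" "t \<le> \<tau>" for t
  proof -
    have "\<bar>t\<bar> * norm v \<le> 1 * r" using that \<tau> v by (intro mult_mono) auto
    then show ?thesis using v by (simp add: x_def dist_norm)
  qed
  define w' where "w' t = frechet_derivative (cj g) (at (x t)) v - v" for t
  have dw: "(w has_derivative (\<lambda>h. h *\<^sub>R w' t)) (at t)" if t: "0 \<le> t" "t \<le> \<tau>" for t
  proof -
    have c: "(cj g has_derivative frechet_derivative (cj g) (at (x t))) (at (x t))"
      using inside[OF t] x[OF t] r0(2) by (intro cj_deriv) (auto simp: x_def)
    have "((\<lambda>t. cj g (x t)) has_derivative (\<lambda>h. frechet_derivative (cj g) (at (x t)) (h *\<^sub>R v))) (at t)"
      by (rule has_derivative_compose[where f = x, OF _ c]) (auto simp: x_def[abs_def] intro!: derivative_eq_intros)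
    then have "(w has_derivative (\<lambda>h. frechet_derivative (cj g) (at (x t)) (h *\<^sub>R v) - h *\<^sub>R v)) (at t)"
      unfolding w_def[abs_def] by (intro has_derivative_diff) (auto simp: x_def[abs_def] intro!: derivative_eq_intros)
    then show ?thesis
      using linear_scale[OF has_derivative_linear[OF c]] by (simp add: w'_def scaleR_diff_right)
  qed
  have cont: "continuous_on {0..\<tau>} w"
    using has_derivative_continuous[OF dw] by (intro continuous_at_imp_continuous_on) auto
  then obtain s where s: "s \<in> {0..\<tau>}" "\<And>t. t \<in> {0..\<tau>} \<Longrightarrow> norm (w t) \<le> norm (w s)"
    using continuous_attains_sup[of "{0..\<tau>}" "\<lambda>t. norm (w t)"] \<tau> continuous_on_norm[OF cont]
    by (metis atLeastAtMost_iff compact_Icc empty_iff order_refl)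
  \<comment> \<open>The maximal deviation along the curve. Bounding the derivative in terms of M
    itself, over an interval of length at most 1, gives M \<le> dev g / 2 + M / 2, which takes the
    place of Gronwall's inequality.\<close>
  define M where "M = norm (w s)"
  have bound: "norm (w' t) \<le> dev g / 2 + M / 2" if t: "0 \<le> t" "t \<le> \<tau>" for t
  proof -
    have xU: "x t \<in> \<phi> ` U" using x[OF t] r0(2) by auto
    have cx: "conj g (\<psi> (x t)) \<in> U" "cj g (x t) \<in> cball e r0"
      using inside[OF t] by (simp_all add: x_def)
    have lin: "linear (L (x t))" by (rule linear_L[OF xU])
    have "inj (L (x t))"
      unfolding linear_injective_0[OF lin]
    proof (intro allI impI)
      fix u assume "L (x t) u = 0"
      then show "u = 0" using r0(3)[OF x[OF t], of u] by simp
    qed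
    \<comment> \<open>The direction v is written as L (x t) u so that \<open>cj_deriv_L\<close>
      applies; as L (x t) is within 1/2 of the identity, u is at most twice as long as v.\<close>
    then obtain u where u: "L (x t) u = v"
      using linear_injective_imp_surjective[OF lin] by (metis surjD)
    have nu: "norm u \<le> 2 * norm v"
    proof -
      have "norm u \<le> norm (L (x t) u) + norm (L (x t) u - u)"
        by (metis norm_minus_commute norm_triangle_sub)
      then show ?thesis using r0(3)[OF x[OF t], of u] u by simp
    qed
    have "w' t = L (cj g (x t)) (Ad g u) - L (x t) u"
      using cj_deriv_L[OF xU cx(1), of u] u by (simp add: w'_def)
    also have "\<dots> = L (cj g (x t)) (Ad g u - u) + (L (cj g (x t)) u - L (x t) u)"
      using cx(2) r0(2) by (subst linear_diff[OF linear_L]) auto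
    finally have "norm (w' t) \<le> norm (L (cj g (x t)) (Ad g u - u)) + norm (L (cj g (x t)) u - L (x t) u)"
      by (simp add: norm_triangle_ineq)
    also have "norm (L (cj g (x t)) (Ad g u - u)) \<le> 3/2 * (dev g * norm u)"
    proof -
      have "norm (L y z) \<le> 3/2 * norm z" if "y \<in> cball e r0" for y z
        using r0(3)[OF that, of z] norm_triangle_ineq[of "L y z - z" z] by simp
      then show ?thesis
        using Ad_close[of g u] cx(2) by (meson mult_left_mono order_trans zero_le_divide_iff zero_le_numeral)
    qed
    also have "norm (L (cj g (x t)) u - L (x t) u) \<le> K * M * norm u"
    proof -
      have "norm (L (cj g (x t)) u - L (x t) u) \<le> K * norm (w t) * norm u"
        using r0(4)[OF cx(2) x[OF t], of u] by (simp add: w_def)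
      also have "\<dots> \<le> K * M * norm u"
        using s(2)[of t] t r0(1) by (intro mult_right_mono mult_left_mono) (auto simp: M_def)
      finally show ?thesis .
    qed
    also have "3/2 * (dev g * norm u) + K * M * norm u = (3/2 * dev g + K * M) * norm u"
      by (simp add: algebra_simps)
    also have "\<dots> \<le> (3/2 * dev g + K * M) * (2 * r)"
      using nu v(1) dev_nonneg[of g] r0(1) by (intro mult_left_mono) (auto simp: M_def)
    also have "\<dots> = (3 * r) * dev g + (2 * K * r) * M"
      by (simp add: algebra_simps)
    also have "\<dots> \<le> 1/2 * dev g + 1/2 * M"
      using v dev_nonneg[of g] by (intro add_mono mult_right_mono) (auto simp: M_def)
    finally show ?thesis by simp
  qed
  have "norm (w s - w 0) \<le> (dev g / 2 + M / 2) * norm (s - 0)"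
  proof (rule differentiable_bound[where S = "{0..\<tau>}"])
    fix t assume t: "t \<in> {0..\<tau>}"
    show "(w has_derivative (\<lambda>h. h *\<^sub>R w' t)) (at t within {0..\<tau>})"
      using dw t by (auto intro: has_derivative_at_withinI)
    show "onorm (\<lambda>h. h *\<^sub>R w' t) \<le> dev g / 2 + M / 2"
      using bound[of t] t by (intro onorm_le) (auto simp: mult.commute intro!: mult_left_mono)
  qed (use s \<tau> in auto)
  also have "\<dots> \<le> (dev g / 2 + M / 2) * 1"
    using s \<tau> dev_nonneg[of g] by (intro mult_left_mono) (auto simp: M_def)
  finally have "M \<le> dev g"
    by (simp add: M_def w_def x_def)
  then show ?thesis
    using s(2)[of t] t by (simp add: M_def w_def x_def)
qed

text \<open>A continuation argument: the estimate holds as long as the conjugated segment stays in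
  the chart ball, and while it holds the segment stays in a smaller compact set, so there is no
  first exit.\<close>

lemma conj_close_local:
  obtains r where "r > 0" "ball e r \<subseteq> \<phi> ` U"
    "\<And>\<epsilon>. \<epsilon> > 0 \<Longrightarrow> \<exists>\<delta>>0. \<forall>g. dev g < \<delta> \<longrightarrow> (\<forall>x\<in>ball e r. conj g (\<psi> x) \<in> U \<and> norm (cj g x - x) < \<epsilon>)"
proof -
  obtain r0 K where r0: "r0 > 0" "K \<ge> 0" "cball e r0 \<subseteq> \<phi> ` U"
    "\<And>x v. x \<in> cball e r0 \<Longrightarrow> norm (L x v - v) \<le> norm v / 2"
    "\<And>x y v. x \<in> cball e r0 \<Longrightarrow> y \<in> cball e r0 \<Longrightarrow> norm (L x v - L y v) \<le> K * norm (x - y) * norm v"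
    using L_local by metis
  \<comment> \<open>The bound r0 / 4, together with dev g < r0 / 4, keeps the curve within r0 / 2;
    1/6 yields 3 r \<le> 1/2, and the last term yields 2 K r \<le> 1/2, its summand 4 avoiding
    division by 0.\<close>
  define r where "r = min (r0 / 4) (min (1/6) (1 / (4 * K + 4)))"
  have r: "r > 0" "r \<le> r0 / 4" "3 * r \<le> 1/2"
    using r0 by (auto simp: r_def)
  have "2 * K * r \<le> 2 * K * (1 / (4 * K + 4))"
    using r0(2) by (intro mult_left_mono) (auto simp: r_def)
  also have "\<dots> \<le> 1/2" using r0(2) by (simp add: field_simps)
  finally have Kr: "2 * K * r \<le> 1/2" .
  have sub: "ball e r \<subseteq> \<phi> ` U" using r0 r by (auto simp: subset_iff)
  have main: "conj g (\<psi> x) \<in> U \<and> norm (cj g x - x) \<le> dev g" if g: "dev g < r0 / 4" and x: "x \<in> ball e r" for g x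
  proof -
    define v where "v = x - e"
    have v: "norm v \<le> r" using x by (simp add: v_def dist_norm norm_minus_commute)
    define N where "N = {s \<in> U. \<phi> s \<in> ball e r0}"
    have "open N"
      using continuous_open_preimage[OF chart_U(3,1) open_ball] by (simp add: N_def vimage_def Int_def)
    define c where "c t = conj g (\<psi> (e + t *\<^sub>R v))" for t
    have xt: "e + t *\<^sub>R v \<in> \<phi> ` U" "norm (t *\<^sub>R v) \<le> r" if "0 \<le> t" "t \<le> 1" for t
    proof -
      have "\<bar>t\<bar> * norm v \<le> 1 * r" using that v by (intro mult_mono) auto
      then show "norm (t *\<^sub>R v) \<le> r" by simp
      then have "e + t *\<^sub>R v \<in> cball e r0" using r r0 by (simp add: dist_norm)
      then show "e + t *\<^sub>R v \<in> \<phi> ` U" using r0 by blast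
    qed
    have cc: "continuous_on {0..1} c"
      unfolding c_def
      by (intro continuous_on_compose2[OF continuous_conj] continuous_on_compose2[OF chart_U(4)] continuous_intros)
        (use xt in auto)
    have est: "norm (cj g (e + t *\<^sub>R v) - (e + t *\<^sub>R v)) \<le> dev g"
      if "0 \<le> t" "t \<le> \<tau>" "\<tau> \<le> 1" "\<And>t. 0 \<le> t \<Longrightarrow> t \<le> \<tau> \<Longrightarrow> c t \<in> N" for t \<tau>
    proof (rule conj_close_estimate[OF r0(2-5) v _ r(3) Kr _ that(3) _ that(1,2)])
      fix t assume "0 \<le> t" "t \<le> \<tau>"
      then have "c t \<in> N" by (rule that(4))
      then show "conj g (\<psi> (e + t *\<^sub>R v)) \<in> U \<and> cj g (e + t *\<^sub>R v) \<in> cball e r0"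
        by (simp add: N_def c_def cj_def)
    qed (use r that r0 in auto)
    have inN: "c t \<in> N" if t: "0 \<le> t" "t \<le> 1" for t
    proof (rule ccontr)
      assume out: "c t \<notin> N"
      define Z where "Z = {0..1} \<inter> c -` (- N)"
      have "closed Z"
        unfolding Z_def using \<open>open N\<close> by (intro continuous_closed_preimage[OF cc]) auto
      moreover have "bounded Z" by (rule bounded_subset[of "{0..1}"]) (auto simp: Z_def)
      ultimately have "compact Z" by (simp add: compact_eq_bounded_closed)
      moreover have "Z \<noteq> {}" using t out by (auto simp: Z_def)
      ultimately obtain \<tau> where \<tau>: "\<tau> \<in> Z" "\<And>t. t \<in> Z \<Longrightarrow> \<tau> \<le> t"
        using compact_attains_inf[of Z] by metis
      have lt: "c t \<in> N" if "0 \<le> t" "t < \<tau>" for t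
        using \<tau> that by (force simp: Z_def)
      have "c 0 \<in> N" using r0 one_U by (simp add: c_def N_def)
      then have \<tau>0: "0 < \<tau>" "\<tau> \<le> 1" using \<tau>(1) by (cases "\<tau> = 0"; auto simp: Z_def)+
      \<comment> \<open>Being compact, Q is closed in the whole group and not just in the chart
        domain, so it also contains the point at the exit time \<tau>.\<close>
      define Q where "Q = \<psi> ` cball e (r0 / 2)"
      have sub2: "cball e (r0 / 2) \<subseteq> \<phi> ` U" using r0(1,3) by (auto simp: subset_iff)
      have "compact Q"
        unfolding Q_def by (intro compact_continuous_image continuous_on_subset[OF chart_U(4)] sub2) simp
      then have "closed Q" by (rule compact_imp_closed)
      have "c t \<in> Q" if "0 \<le> t" "t < \<tau>" for t
      proof -
        have "norm (cj g (e + t *\<^sub>R v) - (e + t *\<^sub>R v)) \<le> dev g"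
          using that \<tau>0 by (intro est[of t t] lt) auto
        moreover have "norm (t *\<^sub>R v) \<le> r" using xt(2) that \<tau>0 by simp
        ultimately have "norm (cj g (e + t *\<^sub>R v) - e) \<le> dev g + r"
          using norm_triangle_ineq[of "cj g (e + t *\<^sub>R v) - (e + t *\<^sub>R v)" "t *\<^sub>R v"] by (simp add: algebra_simps)
        then have "cj g (e + t *\<^sub>R v) \<in> cball e (r0 / 2)"
          using g r(2) by (simp add: dist_norm norm_minus_commute)
        moreover have "\<psi> (cj g (e + t *\<^sub>R v)) = c t"
          using lt[OF that] by (simp add: c_def cj_def N_def)
        ultimately show ?thesis unfolding Q_def by (metis imageI)
      qed
      then have "c ` {0..<\<tau>} \<subseteq> Q" by auto
      moreover have "closure {0..<\<tau>} = {0..\<tau>}" using \<tau>0 by simp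
      ultimately have "c ` {0..\<tau>} \<subseteq> Q"
        using image_closure_subset[of "{0..<\<tau>}" c Q] \<open>closed Q\<close> continuous_on_subset[OF cc, of "{0..\<tau>}"] \<tau>0 by simp
      then have "c \<tau> \<in> Q" using \<tau>0 by auto
      then obtain y where "y \<in> cball e (r0 / 2)" "c \<tau> = \<psi> y" by (auto simp: Q_def)
      then have "c \<tau> \<in> N"
        using sub2 r0(1) by (auto simp: N_def subset_iff)
      then show False using \<tau>(1) by (simp add: Z_def)
    qed
    have "norm (cj g (e + 1 *\<^sub>R v) - (e + 1 *\<^sub>R v)) \<le> dev g"
      by (rule est[of 1 1]) (use inN in auto)
    moreover have "c 1 \<in> N" by (rule inN) auto
    ultimately show ?thesis by (simp add: v_def c_def N_def)
  qed
  show thesis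
  proof (rule that[OF r(1) sub])
    fix \<epsilon> :: real assume "\<epsilon> > 0"
    then show "\<exists>\<delta>>0. \<forall>g. dev g < \<delta> \<longrightarrow> (\<forall>x\<in>ball e r. conj g (\<psi> x) \<in> U \<and> norm (cj g x - x) < \<epsilon>)"
      using r0(1) by (intro exI[of _ "min (r0 / 4) \<epsilon>"]) (use main in force)
  qed
qed

text \<open>The elements h that are moved little when Ad g is near the identity form a subgroup. It
  contains a neighbourhood of \<one> by the local estimate, so connectedness makes it the whole
  group. This is the link from closeness of matrices back to the lattice.\<close>

lemma conj_close:
  assumes conn: "connected (UNIV :: 's set)" and W: "open W" "h \<in> W"
  shows "\<exists>\<delta>>0. \<forall>g. dev g < \<delta> \<longrightarrow> conj g h \<in> W"
proof -
  define P where "P h \<longleftrightarrow> (\<forall>W. open W \<longrightarrow> h \<in> W \<longrightarrow> (\<exists>\<delta>>0. \<forall>g. dev g < \<delta> \<longrightarrow> conj g h \<in> W))" for h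
  obtain r where r: "r > 0" "ball e r \<subseteq> \<phi> ` U"
    "\<And>\<epsilon>. \<epsilon> > 0 \<Longrightarrow> \<exists>\<delta>>0. \<forall>g. dev g < \<delta> \<longrightarrow> (\<forall>x\<in>ball e r. conj g (\<psi> x) \<in> U \<and> norm (cj g x - x) < \<epsilon>)"
    using conj_close_local by metis
  define N where "N = {s \<in> U. \<phi> s \<in> ball e r}"
  have "open N"
    using continuous_open_preimage[OF chart_U(3,1) open_ball] by (simp add: N_def vimage_def Int_def)
  have "Collect P = UNIV"
  proof (rule connected_open_subgroup[OF conn _ \<open>open N\<close>])
    show "\<one> \<in> N" using r one_U by (simp add: N_def)
    show "N \<subseteq> Collect P"
    proof clarify
      fix h assume h: "h \<in> N"
      show "P h"
        unfolding P_def
      proof (intro allI impI)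
        fix W assume W: "open W" "h \<in> W"
        have "open {y \<in> \<phi> ` U. \<psi> y \<in> W}" by (rule open_chart_preimage[OF UA W(1)])
        moreover have "\<phi> h \<in> {y \<in> \<phi> ` U. \<psi> y \<in> W}" using h W by (simp add: N_def)
        ultimately obtain \<epsilon> where \<epsilon>: "\<epsilon> > 0" "ball (\<phi> h) \<epsilon> \<subseteq> {y \<in> \<phi> ` U. \<psi> y \<in> W}"
          unfolding open_contains_ball by blast
        obtain \<delta> where \<delta>: "\<delta> > 0" "\<And>g x. dev g < \<delta> \<Longrightarrow> x \<in> ball e r \<Longrightarrow> conj g (\<psi> x) \<in> U \<and> norm (cj g x - x) < \<epsilon>"
          using r(3)[OF \<epsilon>(1)] by blast
        have "conj g h \<in> W" if "dev g < \<delta>" for g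
        proof -
          have 1: "conj g h \<in> U" "norm (cj g (\<phi> h) - \<phi> h) < \<epsilon>"
            using \<delta>(2)[OF that, of "\<phi> h"] h by (auto simp: N_def)
          then have "cj g (\<phi> h) \<in> ball (\<phi> h) \<epsilon>" by (simp add: dist_norm norm_minus_commute)
          then have "\<psi> (cj g (\<phi> h)) \<in> W" using \<epsilon>(2) by blast
          then show ?thesis using 1 h by (simp add: cj_def N_def)
        qed
        then show "\<exists>\<delta>>0. \<forall>g. dev g < \<delta> \<longrightarrow> conj g h \<in> W" using \<delta>(1) by blast
      qed
    qed
    show "subgroup (Collect P) G"
    proof
      show "\<one> \<in> Collect P" by (auto simp: P_def intro: exI[of _ 1])
    next
      fix x y assume "x \<in> Collect P" "y \<in> Collect P"
      then have xy: "P x" "P y" by auto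
      have "P (x \<otimes> y)"
        unfolding P_def
      proof (intro allI impI)
        fix W assume W: "open W" "x \<otimes> y \<in> W"
        have "open ((\<lambda>(x, y). x \<otimes> y) -` W)" by (rule open_vimage[OF W(1) continuous_mult])
        moreover have "(x, y) \<in> (\<lambda>(x, y). x \<otimes> y) -` W" using W by simp
        ultimately obtain W1 W2 where W12: "open W1" "open W2" "x \<in> W1" "y \<in> W2"
          "W1 \<times> W2 \<subseteq> (\<lambda>(x, y). x \<otimes> y) -` W"
          by (rule open_prod_elim) auto
        obtain \<delta>1 where 1: "\<delta>1 > 0" "\<And>g. dev g < \<delta>1 \<Longrightarrow> conj g x \<in> W1" using xy(1) W12 unfolding P_def by blast
        obtain \<delta>2 where 2: "\<delta>2 > 0" "\<And>g. dev g < \<delta>2 \<Longrightarrow> conj g y \<in> W2" using xy(2) W12 unfolding P_def by blast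
        have "conj g (x \<otimes> y) \<in> W" if "dev g < min \<delta>1 \<delta>2" for g
          using 1(2)[of g] 2(2)[of g] that W12(5) by (auto simp: conj_mult)
        then show "\<exists>\<delta>>0. \<forall>g. dev g < \<delta> \<longrightarrow> conj g (x \<otimes> y) \<in> W"
          using 1 2 by (intro exI[of _ "min \<delta>1 \<delta>2"]) auto
      qed
      then show "x \<otimes> y \<in> Collect P" by simp
    next
      fix x assume "x \<in> Collect P"
      then have x: "P x" by simp
      have "P (inv x)"
        unfolding P_def
      proof (intro allI impI)
        fix W assume W: "open W" "inv x \<in> W"
        have "open ((\<lambda>x. inv x) -` W)" by (rule open_vimage[OF W(1) continuous_inv])
        moreover have "x \<in> (\<lambda>x. inv x) -` W" using W by simp
        ultimately obtain \<delta> where \<delta>: "\<delta> > 0" "\<And>g. dev g < \<delta> \<Longrightarrow> conj g x \<in> (\<lambda>x. inv x) -` W"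
          using x unfolding P_def by blast
        have "conj g (inv x) = inv (conj g x)" for g
          by (simp add: conj_def inv_mult_group m_assoc)
        then show "\<exists>\<delta>>0. \<forall>g. dev g < \<delta> \<longrightarrow> conj g (inv x) \<in> W" using \<delta> by auto
      qed
      then show "inv x \<in> Collect P" by simp
    qed simp
  qed
  then have "P h" by blast
  then show ?thesis using W by (simp add: P_def)
qed

text \<open>Continuity at \<one> follows from differentiability there, and Ad s = Ad g (Ad (inv g
  \<otimes> s)) carries it to any g.\<close>

lemma continuous_Ad: "continuous_on UNIV (\<lambda>g. Ad g v)"
proof (rule continuous_at_imp_continuous_on, rule ballI)
  fix g
  have 1: "isCont (\<lambda>x. Ad (\<psi> x) v) e" for v
    using has_derivative_continuous[OF Ad_field_deriv] by simp
  have "isCont \<phi> \<one>"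
    using chart_U(1,3) one_U by (simp add: continuous_on_eq_continuous_at)
  then have "isCont (\<lambda>s. Ad (\<psi> (\<phi> s)) v) \<one>" for v
    using isCont_o2[where f = \<phi> and g = "\<lambda>x. Ad (\<psi> x) v"] 1 by blast
  moreover have "eventually (\<lambda>s. Ad (\<psi> (\<phi> s)) v = Ad s v) (nhds \<one>)" for v
    using chart_U(1) one_U by (auto simp: eventually_nhds intro!: exI[of _ U])
  ultimately have at1: "isCont (\<lambda>s. Ad s v) \<one>" for v
    using isCont_cong[of "\<lambda>s. Ad (\<psi> (\<phi> s)) v" "\<lambda>s. Ad s v" \<one> for v] by blast
  have "isCont (\<lambda>s. inv g \<otimes> s) g"
    using continuous_on_mult[OF continuous_on_const continuous_on_id, of UNIV "inv g"]
    by (simp add: continuous_on_eq_continuous_at)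
  then have "isCont (\<lambda>s. Ad (inv g \<otimes> s) v) g"
    using isCont_o2[where f = "\<lambda>s. inv g \<otimes> s" and g = "\<lambda>s. Ad s v" and a = g] at1 by simp
  moreover have "isCont (Ad g) x" for x
    using linear_Ad linear_continuous_at linear_conv_bounded_linear by blast
  ultimately have "isCont (\<lambda>s. Ad g (Ad (inv g \<otimes> s) v)) g"
    using isCont_o2[where f = "\<lambda>s. Ad (inv g \<otimes> s) v" and g = "Ad g" and a = g] by blast
  then show "isCont (\<lambda>s. Ad s v) g"
    by (simp flip: Ad_mult add: m_assoc[symmetric])
qed

end

section \<open>The triangularised adjoint representation and its positive weights\<close>

definition complexify :: "real^'n^'m \<Rightarrow> complex^'n^'m" where
  "complexify M = (\<chi> i j. complex_of_real (M $ i $ j))"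

lemma complexify_mult: "complexify (M ** N) = complexify M ** complexify N"
  by (simp add: complexify_def matrix_matrix_mult_def vec_eq_iff)

lemma complexify_one: "complexify (mat 1) = mat 1"
  by (simp add: complexify_def mat_def vec_eq_iff)

lemma matrix_nth: "matrix f $ i $ j = f (axis j 1) $ i"
  by (simp add: matrix_def)

context lie_chart
begin

definition rep :: "'s \<Rightarrow> complex^'n^'n" where
  "rep g = complexify (matrix (Ad g))"

lemma rep_nth: "rep g $ i $ j = complex_of_real (Ad g (axis j 1) $ i)"
  by (simp add: rep_def complexify_def matrix_nth)

sublocale top_group_rep G rep
proof unfold_locales
  fix s t
  have "matrix (Ad (s \<otimes> t)) = matrix (Ad s \<circ> Ad t)"
    using Ad_mult by (metis comp_apply ext)
  then show "rep (s \<otimes> t) = rep s ** rep t"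
    using linear_Ad by (simp add: rep_def matrix_compose complexify_mult)
  have "matrix (Ad \<one>) = mat 1"
    by (simp add: matrix_def mat_def vec_eq_iff Ad_one axis_def)
  then show "rep \<one> = mat 1"
    by (simp add: rep_def complexify_one)
  have "continuous_on UNIV (\<lambda>g. \<chi> i j. complex_of_real (Ad g (axis j 1) $ i))"
    by (intro continuous_intros continuous_Ad)
  then show "continuous_on UNIV rep"
    by (simp add: rep_def[abs_def] complexify_def matrix_nth)
qed

text \<open>Here type (R) enters. The diagonal entries are characters whose derivatives at the
  identity are diagonal entries of the triangular ad, hence eigenvalues, hence real. So the
  characters are real near \<one>, positive there by continuity, and then on the whole connected
  group. The last conclusion carries \<open>conj_close\<close> over to the triangular
  matrices.\<close>

lemma exists_positive_triangular_rep:
  assumes solvable: "solvable G" and conn: "connected (UNIV :: 's set)" and type_R: "type_R G A"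
  obtains T w where "tri_rep G CARD('n) T"
    "\<And>i j. continuous_on UNIV (\<lambda>s. T s i j)"
    "\<And>s i. i < CARD('n) \<Longrightarrow> w i s > (0::real) \<and> T s i i = complex_of_real (w i s)"
    "\<And>h W. open W \<Longrightarrow> h \<in> W \<Longrightarrow> \<exists>\<epsilon>>0. \<forall>g.
       (\<forall>i<CARD('n). \<forall>j<CARD('n). cmod (T g i j - (if i = j then 1 else 0)) < \<epsilon>) \<longrightarrow> g \<otimes> h \<otimes> inv g \<in> W"
proof -
  obtain v w where vw: "dual_bases v w" "tri_rep G CARD('n) (\<lambda>s. dual_bases.entry v w (rep s))"
    using exists_tri_rep[OF solvable conn] by blast
  interpret dual_bases v w by (rule vw)
  define T where "T s = entry (rep s)" for s
  interpret T: tri_rep G "CARD('n)" T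
    using vw(2) by (simp add: T_def[abs_def])
  have contT: "continuous_on UNIV (\<lambda>s. T s i j)" for i j
    unfolding T_def by (intro continuous_on_entry rep_cont)
  define ad where "ad X = complexify (matrix (lie_bracket G (U, \<phi>) X))" for X
  have dT: "((\<lambda>x. T (\<psi> x) i j) has_derivative (\<lambda>X. entry (ad X) i j)) (at e)" for i j
    unfolding T_def entry_def coord_def matrix_vector_mult_def ad_def complexify_def rep_nth matrix_nth
    by (auto intro!: has_derivative_sum has_derivative_mult_right has_derivative_mult_left
        has_derivative_of_real bounded_linear.has_derivative[OF bounded_linear_vec_nth] Ad_field_deriv)
  \<comment> \<open>Entries of T below the diagonal vanish identically, and so do their derivatives;
    thus ad X is triangular in the same basis.\<close>
  have real_deriv: "entry (ad X) i i \<in> \<real>" if i: "i < CARD('n)" for X i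
  proof -
    have "entry (ad X) k l = 0" if "k < CARD('n)" "l < k" for k l
    proof -
      have "((\<lambda>x. T (\<psi> x) k l) has_derivative (\<lambda>X. 0)) (at e)"
        using T.T_upper that by simp
      from has_derivative_unique[OF dT this] show ?thesis by metis
    qed
    from entry_diag_eigenvalue[OF this i] obtain x where "x \<noteq> 0" "ad X *v x = entry (ad X) i i *s x"
      by blast
    then have "complex_eigenvalue (lie_bracket G (U, \<phi>) X) (entry (ad X) i i)"
      unfolding complex_eigenvalue_def ad_def complexify_def by blast
    then show ?thesis
      using type_R UA one_U unfolding type_R_def by fastforce
  qed
  have positive: "T s i i \<in> \<real> \<and> Re (T s i i) > 0" if i: "i < CARD('n)" for s i
  proof -
    define u where "u x = T (\<psi> x) i i" for x
    define P where "P = {s. T s i i \<in> \<real> \<and> Re (T s i i) > 0}"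
    have T1: "T \<one> i i = 1" using T.T_one i by simp
    have Tm: "T (s \<otimes> t) i i = T s i i * T t i i" for s t
      using T.T_diag_mult i by simp
    have Tn: "T s i i \<noteq> 0" for s
      using T.T_diag_nonzero i by simp
    obtain r where r: "r > 0" "ball e r \<subseteq> \<phi> ` U"
      using chart_U(2) open_contains_ball e_mem by meson
    \<comment> \<open>By multiplicativity, the logarithmic derivative of u at any point of the chart
      is computed from its derivative at e, and is therefore real.\<close>
    have du: "\<exists>d. (u has_derivative (\<lambda>X. u x * complex_of_real (d X))) (at x)" if x: "x \<in> \<phi> ` U" for x
    proof -
      define k where "k y = \<phi> (inv (\<psi> x) \<otimes> \<psi> y)" for y
      have "(\<lambda>y. \<phi> (inv (\<psi> x) \<otimes> \<psi> y)) differentiable (at (\<phi> (\<psi> x)))"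
        using dmap_left[of "inv (\<psi> x)"] UA inv_mem[OF x] one_U unfolding dmap_def by simp
      then obtain k' where k': "(k has_derivative k') (at x)"
        using x by (auto simp: differentiable_def k_def[abs_def])
      have "k x = e" by (simp add: k_def)
      have "((\<lambda>y. u (k y)) has_derivative (\<lambda>X. entry (ad (k' X)) i i)) (at x)"
        by (rule has_derivative_compose[OF k']) (use dT \<open>k x = e\<close> in \<open>simp add: u_def\<close>)
      then have "((\<lambda>y. u x * u (k y)) has_derivative (\<lambda>X. u x * entry (ad (k' X)) i i)) (at x)"
        by (rule has_derivative_mult_right)
      then have "(u has_derivative (\<lambda>X. u x * entry (ad (k' X)) i i)) (at x)"
      proof (rule has_derivative_transform_within_open)
        show "open {y \<in> \<phi> ` U. inv (\<psi> x) \<otimes> \<psi> y \<in> U}"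
          by (intro open_chart_vimage[OF UA _ chart_U(1)] continuous_intros)
        show "x \<in> {y \<in> \<phi> ` U. inv (\<psi> x) \<otimes> \<psi> y \<in> U}" using x one_U by simp
        fix y assume "y \<in> {y \<in> \<phi> ` U. inv (\<psi> x) \<otimes> \<psi> y \<in> U}"
        then show "u x * u (k y) = u y"
          by (simp add: u_def k_def Tm[symmetric] m_assoc[symmetric])
      qed
      moreover have "entry (ad X) i i = complex_of_real (Re (entry (ad X) i i))" for X
        using real_deriv[OF i] by simp
      ultimately have "(u has_derivative (\<lambda>X. u x * complex_of_real (Re (entry (ad (k' X)) i i)))) (at x)"
        by simp
      then show ?thesis by (rule exI[of _ "\<lambda>X. Re (entry (ad (k' X)) i i)"])
    qed
    \<comment> \<open>The quotient of u by its conjugate has derivative 0, because the logarithmic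
      derivative of u is real; its value at e is 1, and having value 1 means that u is real.\<close>
    define q where "q x = u x * inverse (cnj (u x))" for x
    have un: "u x \<noteq> 0" for x by (simp add: u_def Tn)
    have "(q has_derivative (\<lambda>X. 0)) (at x within ball e r)" if x: "x \<in> ball e r" for x
    proof -
      obtain d where d: "(u has_derivative (\<lambda>X. u x * complex_of_real (d X))) (at x)"
        using du x r by blast
      have "((\<lambda>x. cnj (u x)) has_derivative (\<lambda>X. cnj (u x * complex_of_real (d X)))) (at x)"
        by (rule bounded_linear.has_derivative[OF bounded_linear_cnj d])
      then have "((\<lambda>x. inverse (cnj (u x))) has_derivative
          (\<lambda>X. - (inverse (cnj (u x)) * cnj (u x * complex_of_real (d X)) * inverse (cnj (u x))))) (at x)"
        using un by (intro Deriv.has_derivative_inverse) auto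
      from has_derivative_mult[OF d this] have "(q has_derivative (\<lambda>X. 0)) (at x)"
        using un by (simp add: q_def[abs_def] field_simps)
      then show ?thesis by (rule has_derivative_at_withinI)
    qed
    from has_derivative_zero_constant[OF convex_ball this] obtain c where c: "\<And>x. x \<in> ball e r \<Longrightarrow> q x = c"
      by blast
    have "q e = 1" by (simp add: q_def u_def T1)
    then have "c = 1" using c[of e] r(1) by simp
    have real: "u x \<in> \<real>" if "x \<in> ball e r" for x
    proof -
      have "u x * inverse (cnj (u x)) = 1" using c[OF that] \<open>c = 1\<close> by (simp add: q_def)
      then have "u x = cnj (u x)" using un by (simp add: field_simps)
      then show ?thesis by (metis complex_cnj_cancel_iff complex_is_Real_iff Reals_cnj_iff)
    qed
    define N where "N = {s \<in> U. \<phi> s \<in> ball e r} \<inter> {s. Re (T s i i) > 0}"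
    have "P = UNIV"
    proof (rule connected_open_subgroup[OF conn])
      have "open {s \<in> U. \<phi> s \<in> ball e r}"
        using continuous_open_preimage[OF chart_U(3,1) open_ball] by (simp add: vimage_def Int_def)
      moreover have "open {s. Re (T s i i) > 0}"
        by (intro open_Collect_less continuous_intros contT)
      ultimately show "open N" unfolding N_def by (rule open_Int)
      show "\<one> \<in> N" using r one_U by (simp add: N_def T1)
      show "N \<subseteq> P"
      proof
        fix s assume s: "s \<in> N"
        then have "u (\<phi> s) \<in> \<real>" by (intro real) (simp add: N_def)
        then show "s \<in> P" using s by (simp add: N_def P_def u_def)
      qed
      show "subgroup P G"
      proof
        show "\<one> \<in> P" by (simp add: P_def T1)
      next
        fix x y assume "x \<in> P" "y \<in> P"
        then show "x \<otimes> y \<in> P"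
          by (auto simp: P_def Tm elim!: Reals_cases)
      next
        fix x assume x: "x \<in> P"
        then obtain a where a: "T x i i = complex_of_real a" "a > 0"
          by (auto simp: P_def elim!: Reals_cases)
        have "T x i i * T (inv x) i i = 1"
          using Tm[of x "inv x"] T1 by simp
        then have "T (inv x) i i = complex_of_real (1 / a)"
          using a by (simp add: field_simps)
        then show "inv x \<in> P" using a by (simp add: P_def)
      qed simp
    qed
    then show ?thesis by (auto simp: P_def)
  qed
  have close: "\<exists>\<epsilon>>0. \<forall>g.
       (\<forall>i<CARD('n). \<forall>j<CARD('n). cmod (T g i j - (if i = j then 1 else 0)) < \<epsilon>) \<longrightarrow> g \<otimes> h \<otimes> inv g \<in> W"
    if W: "open W" "h \<in> W" for h W
  proof -
    obtain \<delta> where \<delta>: "\<delta> > 0" "\<And>g. dev g < \<delta> \<Longrightarrow> conj g h \<in> W"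
      using conj_close[OF conn W] by blast
    \<comment> \<open>The cost of the change of basis: it bounds the deviation of Ad on the standard
      basis in terms of the deviation of the triangular matrix from the identity.\<close>
    define S where "S = (\<Sum>l\<in>(UNIV :: 'n set). \<Sum>k\<in>(UNIV :: 'n set). \<Sum>j<CARD('n). \<Sum>i<CARD('n). cmod (coord j (axis l 1)) * cmod (v i $ k))"
    have S0: "S \<ge> 0" by (auto simp: S_def intro!: sum_nonneg)
    have bound: "dev g \<le> S * \<epsilon>"
      if g: "\<forall>i<CARD('n). \<forall>j<CARD('n). cmod (T g i j - (if i = j then 1 else 0)) < \<epsilon>" for g \<epsilon>
    proof -
      have exp: "rep g *v x - x = (\<Sum>j<CARD('n). coord j x *s (\<Sum>i<CARD('n). (T g i j - (if i = j then 1 else 0)) *s v i))" for x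
      proof -
        have col: "rep g *v v j = (\<Sum>i<CARD('n). T g i j *s v i)" for j
          unfolding T_def entry_def by (rule expand_coord)
        have colv: "v j = (\<Sum>i<CARD('n). (if i = j then 1 else 0) *s v i)" if "j < CARD('n)" for j
        proof -
          have "(\<Sum>i<CARD('n). (if i = j then 1 else 0) *s v i) = (\<Sum>i<CARD('n). if i = j then v i else 0)"
            by (intro sum.cong) auto
          then show ?thesis using that by simp
        qed
        have "rep g *v x - x = rep g *v (\<Sum>j<CARD('n). coord j x *s v j) - (\<Sum>j<CARD('n). coord j x *s v j)"
          by (simp flip: expand_coord)
        also have "\<dots> = (\<Sum>j<CARD('n). coord j x *s (rep g *v v j - v j))"
          by (simp add: vec.sum vec.scale sum_subtractf vec.scale_right_diff_distrib)
        also have "\<dots> = (\<Sum>j<CARD('n). coord j x *s (\<Sum>i<CARD('n). (T g i j - (if i = j then 1 else 0)) *s v i))"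
        proof (rule sum.cong[OF refl])
          fix j assume "j \<in> {..<CARD('n)}"
          then have "rep g *v v j - v j = (\<Sum>i<CARD('n). T g i j *s v i) - (\<Sum>i<CARD('n). (if i = j then 1 else 0) *s v i)"
            by (intro arg_cong2[where f = "(-)"] col colv) simp
          then show "coord j x *s (rep g *v v j - v j) = coord j x *s (\<Sum>i<CARD('n). (T g i j - (if i = j then 1 else 0)) *s v i)"
            by (simp add: sum_subtractf[symmetric] vec.scale_left_diff_distrib)
        qed
        finally show ?thesis .
      qed
      have comp: "\<bar>(Ad g (axis l 1) - axis l 1) $ k\<bar> \<le> (\<Sum>j<CARD('n). \<Sum>i<CARD('n). cmod (coord j (axis l 1)) * cmod (v i $ k)) * \<epsilon>" for l k
      proof -
        have ax: "(rep g *v axis l 1) $ k = rep g $ k $ l"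
          by (simp add: matrix_vector_mult_def axis_def if_distrib cong: if_cong)
        have "complex_of_real ((Ad g (axis l 1) - axis l 1) $ k) = (rep g *v axis l 1 - axis l 1) $ k"
        proof -
          have "axis l (1 :: complex) $ k = complex_of_real (axis l 1 $ k)"
            by (simp add: axis_def)
          then show ?thesis by (simp add: ax rep_nth)
        qed
        also have "\<dots> = (\<Sum>j<CARD('n). \<Sum>i<CARD('n). coord j (axis l 1) * ((T g i j - (if i = j then 1 else 0)) * v i $ k))"
          by (simp add: exp sum_distrib_left left_diff_distrib)
        finally have "\<bar>(Ad g (axis l 1) - axis l 1) $ k\<bar> =
            cmod (\<Sum>j<CARD('n). \<Sum>i<CARD('n). coord j (axis l 1) * ((T g i j - (if i = j then 1 else 0)) * v i $ k))"
          by (metis norm_of_real)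
        also have "\<dots> \<le> (\<Sum>j<CARD('n). \<Sum>i<CARD('n). cmod (coord j (axis l 1)) * cmod (v i $ k) * \<epsilon>)"
        proof (intro sum_norm_le)
          fix j i assume "j \<in> {..<CARD('n)}" "i \<in> {..<CARD('n)}"
          then have "cmod (T g i j - (if i = j then 1 else 0)) \<le> \<epsilon>" using g by (simp add: less_imp_le)
          then have "cmod (coord j (axis l 1)) * cmod (v i $ k) * cmod (T g i j - (if i = j then 1 else 0)) \<le> cmod (coord j (axis l 1)) * cmod (v i $ k) * \<epsilon>"
            by (intro mult_left_mono) auto
          then show "cmod (coord j (axis l 1) * ((T g i j - (if i = j then 1 else 0)) * v i $ k)) \<le> cmod (coord j (axis l 1)) * cmod (v i $ k) * \<epsilon>"
            by (simp add: norm_mult ac_simps)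
        qed
        finally show ?thesis by (simp add: sum_distrib_right)
      qed
      have "dev g = (\<Sum>l\<in>UNIV. norm (Ad g (axis l 1) - axis l 1))"
      proof -
        have B: "Basis = range (\<lambda>l :: 'n. axis l 1 :: real^'n)"
          by (auto simp: Basis_vec_def)
        have "inj (\<lambda>l :: 'n. axis l 1 :: real^'n)"
          by (simp add: inj_on_def axis_eq_axis)
        then show ?thesis
          unfolding dev_def B by (simp add: sum.reindex)
      qed
      also have "\<dots> \<le> (\<Sum>l\<in>UNIV. \<Sum>k\<in>UNIV. \<bar>(Ad g (axis l 1) - axis l 1) $ k\<bar>)"
        by (intro sum_mono norm_le_l1_cart)
      also have "\<dots> \<le> (\<Sum>l\<in>UNIV. \<Sum>k\<in>UNIV. (\<Sum>j<CARD('n). \<Sum>i<CARD('n). cmod (coord j (axis l 1)) * cmod (v i $ k)) * \<epsilon>)"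
        by (intro sum_mono comp)
      also have "\<dots> = S * \<epsilon>" by (simp add: S_def sum_distrib_right)
      finally show ?thesis .
    qed
    show ?thesis
    proof (intro exI[of _ "\<delta> / (S + 1)"] conjI allI impI)
      show "\<delta> / (S + 1) > 0" using \<delta>(1) S0 by simp
      fix g assume "\<forall>i<CARD('n). \<forall>j<CARD('n). cmod (T g i j - (if i = j then 1 else 0)) < \<delta> / (S + 1)"
      from bound[OF this] have "dev g \<le> S * (\<delta> / (S + 1))" .
      also have "\<dots> < \<delta>" using S0 \<delta>(1) by (simp add: field_simps)
      finally show "g \<otimes> h \<otimes> inv g \<in> W" using \<delta>(2) by (simp add: conj_def)
    qed
  qed
  show thesis
  proof (rule that[OF T.tri_rep_axioms contT])
    fix s i assume "i < CARD('n)"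
    from positive[OF this, of s] show "Re (T s i i) > 0 \<and> T s i i = complex_of_real (Re (T s i i))" by simp
  qed (rule close)
qed

end

section \<open>Monodromy\<close>

text \<open>The relation \<open>Rel x y\<close> stands for: \<open>x\<close> and \<open>y\<close> have corresponding images in the base, so that a
  lift of a map \<open>h\<close> is a continuous \<open>a\<close> with \<open>Rel (h t) (a t)\<close>. The base itself, a set of orbits, carries
  no type class topology.\<close>

locale deck_action =
  fixes Q :: "('y::topological_space \<Rightarrow> 'y) set" and Rel :: "'x::topological_space \<Rightarrow> 'y \<Rightarrow> bool"
  assumes Q_cont: "\<gamma> \<in> Q \<Longrightarrow> continuous_on UNIV \<gamma>"
    and Q_comp: "\<gamma> \<in> Q \<Longrightarrow> \<delta> \<in> Q \<Longrightarrow> \<gamma> \<circ> \<delta> \<in> Q"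
    and Q_id: "id \<in> Q"
    and Q_inv: "\<gamma> \<in> Q \<Longrightarrow> \<exists>\<delta>\<in>Q. \<delta> \<circ> \<gamma> = id \<and> \<gamma> \<circ> \<delta> = id"
    and Q_disc: "\<exists>W. open W \<and> y \<in> W \<and> (\<forall>\<gamma>\<in>Q. \<gamma> ` W \<inter> W \<noteq> {} \<longrightarrow> \<gamma> = id)"
    and Rel_orbit: "Rel x y \<Longrightarrow> Rel x y' \<longleftrightarrow> (\<exists>\<gamma>\<in>Q. y' = \<gamma> y)"
    and Rel_local: "\<exists>V s. open V \<and> x \<in> V \<and> continuous_on V s \<and> (\<forall>x'\<in>V. Rel x' (s x'))"
begin

definition evenly_covering :: "'y set \<Rightarrow> bool" where
  "evenly_covering W \<longleftrightarrow> open W \<and> (\<forall>\<gamma>\<in>Q. \<forall>z\<in>W. \<gamma> z \<in> W \<longrightarrow> \<gamma> = id)"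

lemma evenly_covering_nbhd: "\<exists>W. y \<in> W \<and> evenly_covering W"
proof -
  from Q_disc[of y] obtain W where W: "open W \<and> y \<in> W \<and> (\<forall>\<gamma>\<in>Q. \<gamma> ` W \<inter> W \<noteq> {} \<longrightarrow> \<gamma> = id)"
    by (elim exE)
  have "\<gamma> = id" if "\<gamma> \<in> Q" "z \<in> W" "\<gamma> z \<in> W" for \<gamma> z
  proof -
    have "\<gamma> ` W \<inter> W \<noteq> {}" using that by auto
    then show ?thesis using W that(1) by simp
  qed
  then show ?thesis using W unfolding evenly_covering_def by blast
qed

lemma evenly_coveringD: "evenly_covering W \<Longrightarrow> \<gamma> \<in> Q \<Longrightarrow> z \<in> W \<Longrightarrow> \<gamma> z \<in> W \<Longrightarrow> \<gamma> = id"
  unfolding evenly_covering_def by (drule conjunct2) (drule bspec, assumption, drule bspec, assumption, erule mp)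

lemma Q_free:
  assumes "\<gamma> \<in> Q" "\<delta> \<in> Q" "\<gamma> y = \<delta> y"
  shows "\<gamma> = \<delta>"
proof -
  obtain \<delta>' where \<delta>': "\<delta>' \<in> Q" "\<delta>' \<circ> \<delta> = id" "\<delta> \<circ> \<delta>' = id"
    using Q_inv[OF assms(2)] by auto
  obtain W where W: "y \<in> W" "evenly_covering W"
    using evenly_covering_nbhd[of y] by (elim exE conjE)
  have y: "(\<delta>' \<circ> \<gamma>) y = y"
    using \<delta>'(2) assms(3) by (metis comp_apply id_apply)
  have "\<delta>' \<circ> \<gamma> = id"
    by (rule evenly_coveringD[OF W(2) Q_comp[OF \<delta>'(1) assms(1)] W(1)]) (simp only: y W(1))
  then have "\<delta> \<circ> (\<delta>' \<circ> \<gamma>) = \<delta>" by simp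
  then show ?thesis
    using \<delta>'(3) by (simp add: comp_assoc[symmetric])
qed

text \<open>The deck transformation that relates the two maps is locally constant, by evenly
  covering neighbourhoods; so the set where it equals \<gamma> is open and closed in T.\<close>

lemma lift_unique:
  fixes a b :: "'t::topological_space \<Rightarrow> 'y"
  assumes T: "connected T" and a: "continuous_on T a" and b: "continuous_on T b"
    and orbit: "\<And>t. t \<in> T \<Longrightarrow> \<exists>\<gamma>\<in>Q. b t = \<gamma> (a t)"
    and t0: "t0 \<in> T" "\<gamma> \<in> Q" "b t0 = \<gamma> (a t0)" and t: "t \<in> T"
  shows "b t = \<gamma> (a t)"
proof -
  have local: "\<exists>N. openin (top_of_set T) N \<and> s \<in> N \<and> (\<forall>s'\<in>N. b s' = \<delta> (a s'))"
    if s: "s \<in> T" "\<delta> \<in> Q" "b s = \<delta> (a s)" for s \<delta>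
  proof -
    obtain W where W0: "b s \<in> W" "evenly_covering W"
      using evenly_covering_nbhd[of "b s"] by (elim exE conjE)
    then have W: "open W" "b s \<in> W" by (simp_all add: evenly_covering_def)
    obtain \<delta>' where \<delta>': "\<delta>' \<in> Q" "\<delta>' \<circ> \<delta> = id" "\<delta> \<circ> \<delta>' = id"
      using Q_inv[OF s(2)] by auto
    have da: "continuous_on T (\<lambda>t. \<delta> (a t))"
      by (rule continuous_on_compose2[OF Q_cont[OF s(2)] a]) simp
    let ?N = "(T \<inter> b -` W) \<inter> (T \<inter> (\<lambda>t. \<delta> (a t)) -` W)"
    have "openin (top_of_set T) ?N"
      by (intro openin_Int continuous_openin_preimage_gen a b da W)
    moreover have "s \<in> ?N" using s W by simp
    moreover have "b s' = \<delta> (a s')" if s': "s' \<in> ?N" for s'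
    proof -
      obtain \<gamma>' where \<gamma>': "\<gamma>' \<in> Q" "b s' = \<gamma>' (a s')"
        using orbit s' by blast
      have eq: "(\<gamma>' \<circ> \<delta>') (\<delta> (a s')) = b s'"
        using \<gamma>'(2) \<delta>'(2) by (metis comp_apply id_apply)
      have "\<gamma>' \<circ> \<delta>' = id"
        by (rule evenly_coveringD[OF W0(2) Q_comp[OF \<gamma>'(1) \<delta>'(1)], of "\<delta> (a s')"]) (use eq s' in auto)
      then have "\<gamma>' = \<delta>"
        using \<delta>'(2) by (metis comp_assoc comp_id id_comp)
      then show ?thesis using \<gamma>' by simp
    qed
    ultimately show ?thesis by blast
  qed
  let ?S = "{t \<in> T. b t = \<gamma> (a t)}"
  have "openin (top_of_set T) ?S"
  proof (subst openin_subopen, clarify)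
    fix s assume "s \<in> T" "b s = \<gamma> (a s)"
    from local[OF this(1) t0(2) this(2)] obtain N where
      N: "openin (top_of_set T) N" "s \<in> N" "\<forall>s'\<in>N. b s' = \<gamma> (a s')" by metis
    then have "N \<subseteq> ?S"
      using openin_imp_subset[OF N(1)] by auto
    then show "\<exists>N. openin (top_of_set T) N \<and> s \<in> N \<and> N \<subseteq> ?S"
      using N by metis
  qed
  moreover have "openin (top_of_set T) (T - ?S)"
  proof (subst openin_subopen, rule ballI)
    fix s assume "s \<in> T - ?S"
    then have s: "s \<in> T" "s \<notin> ?S" by simp_all
    then obtain \<delta> where \<delta>: "\<delta> \<in> Q" "b s = \<delta> (a s)" using orbit by metis
    from local[OF s(1) this] obtain N where
      N: "openin (top_of_set T) N" "s \<in> N" "\<forall>s'\<in>N. b s' = \<delta> (a s')" by metis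
    have "s' \<notin> ?S" if "s' \<in> N" for s'
    proof
      assume "s' \<in> ?S"
      then have "\<delta> = \<gamma>" using N(3) that Q_free[OF \<delta>(1) t0(2)] by auto
      then show False using s \<delta>(2) by simp
    qed
    then have "N \<subseteq> T - ?S"
      using openin_imp_subset[OF N(1)] by auto
    then show "\<exists>N. openin (top_of_set T) N \<and> s \<in> N \<and> N \<subseteq> T - ?S"
      using N by metis
  qed
  then have "closedin (top_of_set T) ?S"
    by (auto simp: closedin_def)
  ultimately have "?S = {} \<or> ?S = T"
    using T unfolding connected_clopen by blast
  then show ?thesis using t0 t by blast
qed

definition lift_on :: "('t::topological_space) set \<Rightarrow> ('t \<Rightarrow> 'x) \<Rightarrow> ('t \<Rightarrow> 'y) \<Rightarrow> bool" where
  "lift_on T h a \<longleftrightarrow> continuous_on T a \<and> (\<forall>t\<in>T. Rel (h t) (a t))"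

lemma lift_on_subset: "lift_on T h a \<Longrightarrow> T' \<subseteq> T \<Longrightarrow> lift_on T' h a"
  unfolding lift_on_def using continuous_on_subset by blast

lemma lift_on_deck: "lift_on T h a \<Longrightarrow> \<gamma> \<in> Q \<Longrightarrow> lift_on T h (\<lambda>t. \<gamma> (a t))"
  unfolding lift_on_def using Rel_orbit continuous_on_compose2[OF Q_cont] by (metis subset_UNIV)

lemma lift_on_unique:
  assumes "connected T" "lift_on T h a" "lift_on T h b" "t0 \<in> T" "\<gamma> \<in> Q" "b t0 = \<gamma> (a t0)" "t \<in> T"
  shows "b t = \<gamma> (a t)"
proof (rule lift_unique[where a = a and b = b and T = T and ?t0.0 = t0])
  fix t assume "t \<in> T"
  then show "\<exists>\<gamma>\<in>Q. b t = \<gamma> (a t)"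
    using Rel_orbit[of "h t" "a t" "b t"] assms(2,3) by (simp add: lift_on_def)
qed (use assms in \<open>auto simp: lift_on_def\<close>)

lemma lift_on_adjust:
  assumes "lift_on T h a" "t \<in> T" "Rel (h t) y"
  obtains \<gamma> where "\<gamma> \<in> Q" "lift_on T h (\<lambda>t. \<gamma> (a t))" "\<gamma> (a t) = y"
proof -
  have "Rel (h t) (a t)" using assms by (simp add: lift_on_def)
  then obtain \<gamma> where "\<gamma> \<in> Q" "y = \<gamma> (a t)"
    using Rel_orbit assms(3) by blast
  then show thesis using that lift_on_deck[OF assms(1)] by blast
qed

text \<open>A deck transformation moves the second lift so that it agrees with the first at one
  point of the overlap; the overlap being connected, they agree on all of it.\<close>

lemma lift_glue:
  fixes R1 R2 :: "('t::topological_space) set"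
  assumes R: "closed R1" "closed R2" "connected (R1 \<inter> R2)" "R1 \<inter> R2 \<noteq> {}"
    and a1: "lift_on R1 h a1" and a2: "lift_on R2 h a2"
  shows "\<exists>a. lift_on (R1 \<union> R2) h a"
proof -
  obtain t0 where t0: "t0 \<in> R1" "t0 \<in> R2" using R(4) by blast
  have "Rel (h t0) (a1 t0)" using a1 t0 by (simp add: lift_on_def)
  from lift_on_adjust[OF a2 t0(2) this] obtain \<gamma> where \<gamma>: "lift_on R2 h (\<lambda>t. \<gamma> (a2 t))" "\<gamma> (a2 t0) = a1 t0"
    by blast
  have eq: "a1 t = \<gamma> (a2 t)" if "t \<in> R1 \<inter> R2" for t
    using lift_on_unique[OF R(3) lift_on_subset[OF \<gamma>(1)] lift_on_subset[OF a1] _ Q_id _ that, of t0] \<gamma>(2) t0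
    by auto
  have "continuous_on (R1 \<union> R2) (\<lambda>t. if t \<in> R1 then a1 t else \<gamma> (a2 t))"
    by (rule continuous_on_cases[OF R(1,2)]) (use a1 \<gamma> eq in \<open>auto simp: lift_on_def\<close>)
  moreover have "Rel (h t) (if t \<in> R1 then a1 t else \<gamma> (a2 t))" if "t \<in> R1 \<union> R2" for t
    using that a1 \<gamma>(1) by (auto simp: lift_on_def)
  ultimately show ?thesis by (auto simp: lift_on_def)
qed

text \<open>Two nested bisection arguments: rectangles with a common side are glued, and small ones
  are lifted by a local section. The map is given on the whole plane so that rectangles may stick
  out of the square.\<close>

lemma lift_square:
  fixes h :: "real \<times> real \<Rightarrow> 'x"
  assumes h: "continuous_on UNIV h"
  shows "\<exists>a. lift_on ({0..1} \<times> {0..1}) h a"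
proof -
  have "\<exists>a. lift_on ({0..1::real} \<times> {0..1::real}) h a"
  proof (rule Bolzano[of 0 1 "\<lambda>a b. \<exists>l. lift_on ({a..b} \<times> {0..1::real}) h l"])
    show "(0::real) \<le> 1" by simp
  next
    fix a b c :: real
    assume "\<exists>l. lift_on ({a..b} \<times> {0..1}) h l" "\<exists>l. lift_on ({b..c} \<times> {0..1}) h l" and ab: "a \<le> b" "b \<le> c"
    then obtain l1 l2 where l: "lift_on ({a..b} \<times> {0..1}) h l1" "lift_on ({b..c} \<times> {0..1}) h l2" by blast
    have "({a..b} \<times> {0..1}) \<inter> ({b..c} \<times> {0..1}) = {b} \<times> {0..1::real}" using ab by auto
    moreover have "connected ({b} \<times> {0..1::real})" by (intro connected_Times) auto
    ultimately have "\<exists>a'. lift_on (({a..b} \<times> {0..1}) \<union> ({b..c} \<times> {0..1})) h a'"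
      by (intro lift_glue[OF _ _ _ _ l] closed_Times) auto
    moreover have "({a..b} \<times> {0..1}) \<union> ({b..c} \<times> {0..1}) = {a..c} \<times> {0..1::real}" using ab by auto
    ultimately show "\<exists>l. lift_on ({a..c} \<times> {0..1}) h l" by simp
  next
    fix x :: real
    \<comment> \<open>The width of the strip may shrink at each gluing in the second coordinate;
      compactness leaves a positive width for the whole height.\<close>
    have "\<exists>\<delta>>0. \<exists>l. lift_on ({x - \<delta>..x + \<delta>} \<times> {0..1::real}) h l"
    proof (rule Bolzano[of 0 1 "\<lambda>c d. \<exists>\<delta>>0. \<exists>l. lift_on ({x - \<delta>..x + \<delta>} \<times> {c..d}) h l"])
      show "(0::real) \<le> 1" by simp
    next
      fix a b c :: real
      assume "\<exists>\<delta>>0. \<exists>l. lift_on ({x - \<delta>..x + \<delta>} \<times> {a..b}) h l" "\<exists>\<delta>>0. \<exists>l. lift_on ({x - \<delta>..x + \<delta>} \<times> {b..c}) h l"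
        and ab: "a \<le> b" "b \<le> c"
      then obtain \<delta>1 \<delta>2 l1 l2 where l0: "\<delta>1 > 0" "lift_on ({x - \<delta>1..x + \<delta>1} \<times> {a..b}) h l1"
        "\<delta>2 > 0" "lift_on ({x - \<delta>2..x + \<delta>2} \<times> {b..c}) h l2" by blast
      define \<delta> where "\<delta> = min \<delta>1 \<delta>2"
      have l: "lift_on ({x - \<delta>..x + \<delta>} \<times> {a..b}) h l1" "lift_on ({x - \<delta>..x + \<delta>} \<times> {b..c}) h l2" "\<delta> > 0"
        using l0(1,3) by (auto simp: \<delta>_def intro!: lift_on_subset[OF l0(2)] lift_on_subset[OF l0(4)])
      have "({x - \<delta>..x + \<delta>} \<times> {a..b}) \<inter> ({x - \<delta>..x + \<delta>} \<times> {b..c}) = {x - \<delta>..x + \<delta>} \<times> {b}" using ab by auto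
      moreover have "connected ({x - \<delta>..x + \<delta>} \<times> {b})" by (intro connected_Times) auto
      ultimately have "\<exists>a'. lift_on (({x - \<delta>..x + \<delta>} \<times> {a..b}) \<union> ({x - \<delta>..x + \<delta>} \<times> {b..c})) h a'"
        using l(3) by (intro lift_glue[OF _ _ _ _ l(1,2)] closed_Times) auto
      moreover have "({x - \<delta>..x + \<delta>} \<times> {a..b}) \<union> ({x - \<delta>..x + \<delta>} \<times> {b..c}) = {x - \<delta>..x + \<delta>} \<times> {a..c}" using ab by auto
      ultimately show "\<exists>\<delta>>0. \<exists>l. lift_on ({x - \<delta>..x + \<delta>} \<times> {a..c}) h l" using l(3) by auto
    next
      fix y :: real
      obtain V s where V: "open V" "h (x, y) \<in> V" "continuous_on V s" "\<forall>x'\<in>V. Rel x' (s x')"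
        using Rel_local by blast
      have "open (h -` V)" by (rule open_vimage[OF V(1) h])
      moreover have "(x, y) \<in> h -` V" using V(2) by simp
      ultimately obtain A B where AB: "open A" "open B" "x \<in> A" "y \<in> B" "A \<times> B \<subseteq> h -` V"
        by (rule open_prod_elim) (auto elim!: SigmaE2)
      obtain d1 where d1: "d1 > 0" "cball x d1 \<subseteq> A" using AB open_contains_cball by blast
      obtain d2 where d2: "d2 > 0" "ball y d2 \<subseteq> B" using AB open_contains_ball by blast
      have "lift_on (h -` V) h (\<lambda>p. s (h p))"
        using V continuous_on_compose2[OF V(3) continuous_on_subset[OF h]] by (auto simp: lift_on_def)
      then have "lift_on ({x - d1..x + d1} \<times> {c..d}) h (\<lambda>p. s (h p))" if "c \<le> y" "y \<le> d" "d - c < d2" for c d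
      proof (rule lift_on_subset)
        have "{x - d1..x + d1} \<subseteq> A" using d1 by (auto simp: cball_eq_atLeastAtMost[symmetric])
        moreover have "{c..d} \<subseteq> B" using d2 that by (force simp: ball_def dist_real_def)
        ultimately show "{x - d1..x + d1} \<times> {c..d} \<subseteq> h -` V" using AB(5) by blast
      qed
      then show "\<exists>d>0. \<forall>a b. a \<le> y \<and> y \<le> b \<and> b - a < d \<longrightarrow> (\<exists>\<delta>>0. \<exists>l. lift_on ({x - \<delta>..x + \<delta>} \<times> {a..b}) h l)"
        using d1 d2 by blast
    qed
    then obtain \<delta> l where \<delta>: "\<delta> > 0" "lift_on ({x - \<delta>..x + \<delta>} \<times> {0..1::real}) h l" by blast
    have "lift_on ({a..b} \<times> {0..1}) h l" if "a \<le> x" "x \<le> b" "b - a < \<delta>" for a b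
      using \<delta>(2) by (rule lift_on_subset) (use that in auto)
    then show "\<exists>d>0. \<forall>a b. a \<le> x \<and> x \<le> b \<and> b - a < d \<longrightarrow> (\<exists>l. lift_on ({a..b} \<times> {0..1}) h l)"
      using \<delta>(1) by blast
  qed
  then show ?thesis .
qed

text \<open>Clamping both coordinates to the unit interval extends h to the plane.\<close>

lemma lift_homotopy:
  fixes h :: "real \<times> real \<Rightarrow> 'x"
  assumes h: "continuous_on ({0..1} \<times> {0..1}) h"
  shows "\<exists>a. lift_on ({0..1} \<times> {0..1}) h a"
proof -
  define cl :: "real \<Rightarrow> real" where "cl s = max 0 (min 1 s)" for s
  have cl: "cl s \<in> {0..1}" "s \<in> {0..1} \<Longrightarrow> cl s = s" for s by (auto simp: cl_def)
  have "continuous_on UNIV (\<lambda>p. h (cl (fst p), cl (snd p)))"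
    by (intro continuous_on_compose2[OF h] continuous_on_Pair)
      (auto simp: cl_def intro!: continuous_intros)
  from lift_square[OF this] obtain a where "lift_on ({0..1} \<times> {0..1}) (\<lambda>p. h (cl (fst p), cl (snd p))) a" by blast
  then have "lift_on ({0..1} \<times> {0..1}) h a"
    using cl(2) by (auto simp: lift_on_def)
  then show ?thesis by blast
qed

lemma lift_path:
  assumes g: "path g" and y: "Rel (g 0) y"
  shows "\<exists>a. lift_on {0..1} g a \<and> a 0 = y"
proof -
  have "continuous_on ({0..1} \<times> {0..1::real}) (\<lambda>p. g (fst p))"
    using g unfolding path_def by (rule continuous_on_compose2) (auto intro!: continuous_intros)
  from lift_homotopy[OF this] obtain b where b: "lift_on ({0..1} \<times> {0..1}) (\<lambda>p :: real \<times> real. g (fst p)) b" by blast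
  have "continuous_on {0..1} (\<lambda>s. b (s, 0))"
    by (rule continuous_on_compose2[of "{0..1} \<times> {0..1}" b]) (use b in \<open>auto simp: lift_on_def intro!: continuous_intros\<close>)
  then have "lift_on {0..1} g (\<lambda>s. b (s, 0))"
    using b by (auto simp: lift_on_def)
  from lift_on_adjust[OF this _ y] show ?thesis by auto
qed

text \<open>A null homotopy is lifted. Its sides t = 0 and t = 1 lift the same path, hence differ by
  one deck transformation throughout. At s = 1 the loop is constant, so this transformation fixes a
  point and is the identity; therefore the lift closes up at s = 0 as well.\<close>

lemma lift_loop:
  assumes sc: "simply_connected (UNIV :: 'x set)"
    and g: "path g" "g 0 = x" "g 1 = x" and a: "lift_on {0..1} g a"
  shows "a 1 = a 0"
proof -
  have "homotopic_loops UNIV g (\<lambda>t. x)"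
    using sc g unfolding simply_connected_def
    by (auto simp: pathstart_def pathfinish_def path_def intro!: continuous_intros)
  then obtain h where h0: "continuous_on ({0..1::real} \<times> {0..1::real}) h" "\<forall>t\<in>{0..1}. h (0, t) = g t"
    "\<forall>t\<in>{0..1}. h (1, t) = x" "\<forall>s\<in>{0..1}. h (s, 1) = h (s, 0)"
    unfolding homotopic_loops pathstart_def pathfinish_def comp_apply by blast
  note h = h0(1) h0(2-4)[rule_format]
  obtain b where b: "lift_on ({0..1} \<times> {0..1}) h b"
    using lift_homotopy[OF h(1)] by blast
  have bc: "continuous_on ({0..1} \<times> {0..1}) b" and bR: "\<And>s t. s \<in> {0..1} \<Longrightarrow> t \<in> {0..1} \<Longrightarrow> Rel (h (s, t)) (b (s, t))"
    using b by (auto simp: lift_on_def)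
  have row: "continuous_on {0..1} (\<lambda>t. b (s, t))" if "s \<in> {0..1}" for s
    by (rule continuous_on_compose2[OF bc]) (use that in \<open>auto intro!: continuous_intros\<close>)
  have col: "continuous_on {0..1} (\<lambda>s. b (s, t))" if "t \<in> {0..1}" for t
    by (rule continuous_on_compose2[OF bc]) (use that in \<open>auto intro!: continuous_intros\<close>)
  have l0: "lift_on {0..1} (\<lambda>s. h (s, 0)) (\<lambda>s. b (s, 0))"
    using col[of 0] bR by (auto simp: lift_on_def)
  have l1: "lift_on {0..1} (\<lambda>s. h (s, 0)) (\<lambda>s. b (s, 1))"
    using col[of 1] bR[of _ 1] h(4) by (auto simp: lift_on_def)
  have "Rel (h (0, 0)) (b (0, 0))" "Rel (h (0, 0)) (b (0, 1))" using bR[of 0 0] bR[of 0 1] h(4)[of 0] by simp_all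
  then obtain \<gamma> where \<gamma>: "\<gamma> \<in> Q" "b (0, 1) = \<gamma> (b (0, 0))" using Rel_orbit by blast
  have "b (1, 1) = \<gamma> (b (1, 0))"
    using lift_on_unique[OF _ l0 l1 _ \<gamma>(1), of 0 1] \<gamma>(2) by simp
  moreover have "b (1, 1) = id (b (1, 0))"
  proof (rule lift_on_unique[of "{0..1}" "\<lambda>t. h (1, t)" "\<lambda>t. b (1, 0)" "\<lambda>t. b (1, t)" 0 id 1])
    show "lift_on {0..1} (\<lambda>t. h (1, t)) (\<lambda>t. b (1, 0))"
      using bR[of 1 0] h(3) by (simp add: lift_on_def)
    show "lift_on {0..1} (\<lambda>t. h (1, t)) (\<lambda>t. b (1, t))"
      using bR[of 1] row[of 1] by (simp add: lift_on_def)
  qed (use Q_id in auto)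
  ultimately have "\<gamma> (b (1, 0)) = id (b (1, 0))" by simp
  then have "\<gamma> = id" by (rule Q_free[OF \<gamma>(1) Q_id])
  then have b01: "b (0, 1) = b (0, 0)" using \<gamma>(2) by simp
  have lb: "lift_on {0..1} g (\<lambda>t. b (0, t))"
    using bR[of 0] row[of 0] h(2) by (auto simp: lift_on_def)
  have "Rel (g 0) (a 0)" "Rel (g 0) (b (0, 0))" using a lb by (auto simp: lift_on_def)
  then obtain \<delta> where \<delta>: "\<delta> \<in> Q" "a 0 = \<delta> (b (0, 0))" using Rel_orbit by blast
  have "a 1 = \<delta> (b (0, 1))"
    using lift_on_unique[OF _ lb a _ \<delta>(1), of 0 1] \<delta>(2) by simp
  then show ?thesis using \<delta>(2) b01 by simp
qed

lemma lift_join: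
  assumes "lift_on {0..1} g a" "lift_on {0..1} k b" "a 1 = b 0"
  shows "lift_on {0..1} (g +++ k) (a +++ b)"
proof -
  have "path a" "path b" using assms by (auto simp: lift_on_def path_def)
  then have "path (a +++ b)"
    using assms(3) by (simp add: pathstart_def pathfinish_def path_join_imp)
  then show ?thesis
    using assms by (auto simp: lift_on_def path_def joinpaths_def)
qed

lemma lift_reverse: "lift_on {0..1} g a \<Longrightarrow> lift_on {0..1} (reversepath g) (reversepath a)"
  using path_reversepath[of a] by (auto simp: lift_on_def path_def reversepath_def)

text \<open>F x is the end point of the lift of any path from x0 to x. Independence of the path is
  \<open>lift_loop\<close> for the loop formed with a second path; near each point F is a local
  section followed by a deck transformation, which gives continuity.\<close>

theorem monodromy:
  assumes sc: "simply_connected (UNIV :: 'x set)"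
    and lpc: "\<And>V (x :: 'x). open V \<Longrightarrow> x \<in> V \<Longrightarrow> \<exists>W. open W \<and> x \<in> W \<and> W \<subseteq> V \<and> path_connected W"
    and y0: "Rel x0 y0"
  shows "\<exists>F. continuous_on UNIV F \<and> F x0 = y0 \<and> (\<forall>x. Rel x (F x))"
proof -
  define good where "good x y \<longleftrightarrow> (\<exists>g a. path g \<and> g 0 = x0 \<and> g 1 = x \<and> lift_on {0..1} g a \<and> a 0 = y0 \<and> a 1 = y)" for x y
  have unique: "y = y'" if "good x y" "good x y'" for x y y'
  proof -
    obtain g a where g: "path g" "g 0 = x0" "g 1 = x" "lift_on {0..1} g a" "a 0 = y0" "a 1 = y"
      using \<open>good x y\<close> unfolding good_def by blast
    obtain k b where k: "path k" "k 0 = x0" "k 1 = x" "lift_on {0..1} k b" "b 0 = y0" "b 1 = y'"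
      using \<open>good x y'\<close> unfolding good_def by blast
    have "Rel (k 1) y" using g k by (auto simp: lift_on_def)
    from lift_on_adjust[OF k(4) _ this] obtain \<gamma> where \<gamma>: "\<gamma> \<in> Q" "lift_on {0..1} k (\<lambda>t. \<gamma> (b t))" "\<gamma> (b 1) = y"
      by auto
    have "lift_on {0..1} (g +++ reversepath k) (a +++ reversepath (\<lambda>t. \<gamma> (b t)))"
      using g \<gamma> by (intro lift_join lift_reverse) (auto simp: reversepath_def)
    moreover have "path (g +++ reversepath k)"
      using g k by (intro path_join_imp) (simp_all add: pathstart_def pathfinish_def, simp add: reversepath_def)
    moreover have "(g +++ reversepath k) 0 = x0" "(g +++ reversepath k) 1 = x0"
      using g k by (auto simp: joinpaths_def reversepath_def)
    ultimately have "(a +++ reversepath (\<lambda>t. \<gamma> (b t))) 1 = (a +++ reversepath (\<lambda>t. \<gamma> (b t))) 0"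
      using lift_loop[OF sc] by blast
    then have "\<gamma> y0 = id y0" using g k by (simp add: joinpaths_def reversepath_def)
    then have "\<gamma> = id" using Q_free[OF \<gamma>(1) Q_id] by blast
    then show ?thesis using \<gamma>(3) k(6) by simp
  qed
  \<comment> \<open>A path from x0 to x is read off from a free homotopy between the two constant
    loops, as the track of the base point.\<close>
  have exists: "\<exists>y. good x y" for x
  proof -
    have "homotopic_loops UNIV (\<lambda>t::real. x0) (\<lambda>t. x)"
      using sc unfolding simply_connected_def
      by (auto simp: pathstart_def pathfinish_def path_def)
    then obtain h where h: "continuous_on ({0..1::real} \<times> {0..1::real}) h" "\<forall>t\<in>{0..1}. h (0, t) = x0"
      "\<forall>t\<in>{0..1}. h (1, t) = x"
      unfolding homotopic_loops by blast
    have "path (\<lambda>s. h (s, 0))"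
      unfolding path_def by (rule continuous_on_compose2[OF h(1)]) (auto intro!: continuous_intros)
    moreover have "h (0, 0) = x0" "h (1, 0) = x" using h(2,3) by auto
    ultimately show ?thesis
      using lift_path[of "\<lambda>s. h (s, 0)" y0] y0 unfolding good_def by auto
  qed
  define F where "F x = (THE y. good x y)" for x
  have F: "good x (F x)" for x
    unfolding F_def using exists unique by (metis theI)
  have F_eq: "F x = y" if "good x y" for x y
    using F unique that by blast
  have FR: "Rel x (F x)" for x
  proof -
    obtain g a where "g 1 = x" "lift_on {0..1::real} g a" "a 1 = F x"
      using F[of x] unfolding good_def by blast
    then show ?thesis
      unfolding lift_on_def by (metis atLeastAtMost_iff order_refl zero_le_one)
  qed
  have "\<exists>W. open W \<and> x \<in> W \<and> continuous_on W F" for x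
  proof -
    obtain V s where V: "open V" "x \<in> V" "continuous_on V s" "\<forall>x'\<in>V. Rel x' (s x')"
      using Rel_local by blast
    then have "lift_on V id s" by (simp add: lift_on_def)
    from lift_on_adjust[OF this V(2), of "F x"] FR obtain \<gamma> where
      \<gamma>: "lift_on V id (\<lambda>x. \<gamma> (s x))" "\<gamma> (s x) = F x" by auto
    obtain W where W: "open W" "x \<in> W" "W \<subseteq> V" "path_connected W"
      using lpc[OF V(1,2)] by blast
    have "F x' = \<gamma> (s x')" if x': "x' \<in> W" for x'
    proof (rule F_eq)
      obtain g a where g: "path g" "g 0 = x0" "g 1 = x" "lift_on {0..1} g a" "a 0 = y0" "a 1 = F x"
        using F[of x] unfolding good_def by blast
      obtain k where k: "path k" "path_image k \<subseteq> W" "k 0 = x" "k 1 = x'"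
        using W(4) W(2) x' unfolding path_connected_def pathstart_def pathfinish_def by blast
      have kW: "k t \<in> V" if "t \<in> {0..1}" for t
        using k(2) W(3) that by (force simp: path_image_def)
      have "lift_on {0..1} k (\<lambda>t. \<gamma> (s (k t)))"
      proof -
        have "k ` {0..1} \<subseteq> V" using kW by blast
        then have "continuous_on {0..1} (\<lambda>t. \<gamma> (s (k t)))"
          using \<gamma>(1) k(1) continuous_on_compose2[of V "\<lambda>x. \<gamma> (s x)" "{0..1}" k]
          by (simp add: lift_on_def path_def)
        then show ?thesis
          using \<gamma>(1) kW by (auto simp: lift_on_def)
      qed
      then have "lift_on {0..1} (g +++ k) (a +++ (\<lambda>t. \<gamma> (s (k t))))"
        using g k \<gamma>(2) by (intro lift_join) auto
      moreover have "path (g +++ k)"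
        using g k by (intro path_join_imp) (auto simp: pathstart_def pathfinish_def)
      ultimately show "good x' (\<gamma> (s x'))"
        unfolding good_def using g k
        by (intro exI[of _ "g +++ k"] exI[of _ "a +++ (\<lambda>t. \<gamma> (s (k t)))"]) (auto simp: joinpaths_def)
    qed
    moreover have "continuous_on W (\<lambda>x. \<gamma> (s x))"
      using lift_on_subset[OF \<gamma>(1) W(3)] by (simp add: lift_on_def)
    ultimately have "continuous_on W F"
      by (simp cong: continuous_on_cong)
    then show ?thesis
      using W(1,2) by blast
  qed
  then obtain W where W: "\<And>x. open (W x) \<and> x \<in> W x \<and> continuous_on (W x) F"
    by metis
  then have "continuous_on (\<Union>x\<in>UNIV. W x) F"
    by (intro continuous_on_open_UN) auto
  moreover have "(\<Union>x\<in>UNIV. W x) = UNIV" using W by auto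
  ultimately have "continuous_on UNIV F" by simp
  moreover have "good x0 y0"
    unfolding good_def using y0
    by (intro exI[of _ "\<lambda>t. x0"] exI[of _ "\<lambda>t. y0"]) (auto simp: path_def lift_on_def)
  ultimately show ?thesis using F_eq FR by blast
qed

end

section \<open>Deck groups of infra-solvmanifolds\<close>

locale infra =
  fixes S :: "'s::{t2_space, second_countable_topology} monoid" (structure)
    and A :: "('s, real^'n) atlas" and C :: "('s \<Rightarrow> 's) set" and P :: "('s \<times> ('s \<Rightarrow> 's)) set"
  assumes infra: "infra_solvmanifold S A C P"
begin

sublocale lie S A
  using infra by unfold_locales (simp add: infra_solvmanifold_def)

definition "\<Gamma> = {s. (s, id) \<in> P}"
definition "SC = semidirect S C"
definition "PG = SC\<lparr>carrier := P\<rparr>"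
definition "act = affine_action S"
abbreviation "q \<equiv> orbit_map S P"

lemma conn: "connected (UNIV :: 's set)" and simply_conn: "simply_connected (UNIV :: 's set)"
  and solvable_S: "solvable S"
  using infra by (simp_all add: infra_solvmanifold_def)

lemma C_sub: "subgroup C (AutoGroup S)" and C_lie: "C \<subseteq> lie_automorphisms S A"
  and P_sub: "subgroup P SC" and P_tf: "torsion_free PG"
  and \<Gamma>_lattice: "lattice_in \<Gamma> S"
  and P_fin: "finite (rcosets\<^bsub>PG\<^esub> {\<gamma> \<in> P. snd \<gamma> = id})"
  using infra by (simp_all add: infra_solvmanifold_def SC_def PG_def \<Gamma>_def)

lemma C_auto:
  assumes "\<alpha> \<in> C"
  shows "continuous_on UNIV \<alpha>" "bij \<alpha>" "\<alpha> (x \<otimes> y) = \<alpha> x \<otimes> \<alpha> y"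
proof -
  have "\<alpha> \<in> lie_automorphisms S A" using assms C_lie by blast
  then have "\<alpha> \<in> auto S" "smooth_map A A \<alpha>" by (auto simp: lie_automorphisms_def)
  then show "continuous_on UNIV \<alpha>" "bij \<alpha>" "\<alpha> (x \<otimes> y) = \<alpha> x \<otimes> \<alpha> y"
    by (auto simp: smooth_map_def auto_def Bij_def hom_def)
qed

lemma C_group: "id \<in> C" "\<alpha> \<in> C \<Longrightarrow> \<beta> \<in> C \<Longrightarrow> \<alpha> \<circ> \<beta> \<in> C" "\<alpha> \<in> C \<Longrightarrow> inv_into UNIV \<alpha> \<in> C"
proof -
  have Bij: "\<alpha> \<in> Bij UNIV" if "\<alpha> \<in> C" for \<alpha>
    using C_auto(2)[OF that] by (simp add: Bij_def extensional_def)
  have one: "\<one>\<^bsub>AutoGroup S\<^esub> = id"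
    by (simp add: AutoGroup_def BijGroup_def fun_eq_iff)
  have mult: "\<alpha> \<otimes>\<^bsub>AutoGroup S\<^esub> \<beta> = \<alpha> \<circ> \<beta>" if "\<alpha> \<in> C" "\<beta> \<in> C" for \<alpha> \<beta>
    using Bij that by (simp add: AutoGroup_def BijGroup_def compose_def fun_eq_iff)
  interpret Au: group "AutoGroup S" by (rule AutoGroup)
  show "id \<in> C" using subgroup.one_closed[OF C_sub] one by simp
  show "\<alpha> \<circ> \<beta> \<in> C" if "\<alpha> \<in> C" "\<beta> \<in> C" using subgroup.m_closed[OF C_sub that] mult that by simp
  show "inv_into UNIV \<alpha> \<in> C" if a: "\<alpha> \<in> C"
  proof -
    have i: "inv\<^bsub>AutoGroup S\<^esub> \<alpha> \<in> C" using subgroup.m_inv_closed[OF C_sub a] .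
    have "\<alpha> \<in> carrier (AutoGroup S)" using subgroup.subset[OF C_sub] a by blast
    then have "\<alpha> \<circ> inv\<^bsub>AutoGroup S\<^esub> \<alpha> = id"
      using Au.r_inv mult[OF a i] one by simp
    then have "inv_into UNIV \<alpha> = inv\<^bsub>AutoGroup S\<^esub> \<alpha>"
      using C_auto(2)[OF a] by (metis bij_is_inj comp_assoc comp_id id_comp inv_o_cancel)
    then show ?thesis using i by simp
  qed
qed

lemma C_one: "\<alpha> \<in> C \<Longrightarrow> \<alpha> \<one> = \<one>"
  using C_auto(3)[of \<alpha> \<one> \<one>] l_cancel_one[of "\<alpha> \<one>" "\<alpha> \<one>"] by simp

lemma SC_simps [simp]: "carrier SC = UNIV \<times> C" "(s, \<alpha>) \<otimes>\<^bsub>SC\<^esub> (t, \<beta>) = (s \<otimes> \<alpha> t, \<alpha> \<circ> \<beta>)" "\<one>\<^bsub>SC\<^esub> = (\<one>, id)"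
  by (simp_all add: SC_def semidirect_def)

lemma group_SC: "group SC"
proof (rule groupI)
  fix x y z assume "x \<in> carrier SC" "y \<in> carrier SC" "z \<in> carrier SC"
  then show "x \<otimes>\<^bsub>SC\<^esub> y \<in> carrier SC" "x \<otimes>\<^bsub>SC\<^esub> y \<otimes>\<^bsub>SC\<^esub> z = x \<otimes>\<^bsub>SC\<^esub> (y \<otimes>\<^bsub>SC\<^esub> z)"
    using C_group C_auto(3) by (auto simp: m_assoc comp_assoc)
next
  fix x assume "x \<in> carrier SC"
  then obtain s \<alpha> where x: "x = (s, \<alpha>)" "\<alpha> \<in> C" by auto
  show "\<one>\<^bsub>SC\<^esub> \<otimes>\<^bsub>SC\<^esub> x = x" by (simp add: x)
  have i: "inv_into UNIV \<alpha> \<in> C" using C_group x by blast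
  have "inv_into UNIV \<alpha> \<circ> \<alpha> = id"
    using C_auto(2)[OF x(2)] by (simp add: bij_is_inj)
  moreover have "inv_into UNIV \<alpha> (inv s) \<otimes> inv_into UNIV \<alpha> s = \<one>"
    using C_auto(3)[OF i, of "inv s" s] C_one[OF i] by simp
  ultimately show "\<exists>y\<in>carrier SC. y \<otimes>\<^bsub>SC\<^esub> x = \<one>\<^bsub>SC\<^esub>"
    using i by (intro bexI[of _ "(inv_into UNIV \<alpha> (inv s), inv_into UNIV \<alpha>)"]) (simp_all add: x)
qed (simp add: C_group)

sublocale SC: group SC by (rule group_SC)

lemma PG_simps [simp]: "carrier PG = P" "x \<otimes>\<^bsub>PG\<^esub> y = x \<otimes>\<^bsub>SC\<^esub> y" "\<one>\<^bsub>PG\<^esub> = (\<one>, id)"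
  by (simp_all add: PG_def)

sublocale PG: group PG
  unfolding PG_def by (rule SC.subgroup_imp_group[OF P_sub])

lemma P_C: "p \<in> P \<Longrightarrow> snd p \<in> C"
  using subgroup.subset[OF P_sub] by auto

lemma act_mult: "p \<in> P \<Longrightarrow> r \<in> P \<Longrightarrow> act (p \<otimes>\<^bsub>PG\<^esub> r) = act p \<circ> act r"
  using P_C C_auto(3) by (cases p; cases r) (force simp: act_def affine_action_def m_assoc)

lemma act_one: "act (\<one>, id) = id"
  by (auto simp: act_def affine_action_def)

lemma act_cont: "p \<in> P \<Longrightarrow> continuous_on UNIV (act p)"
  using C_auto(1)[OF P_C] by (cases p) (auto simp: act_def affine_action_def intro!: continuous_intros)

lemma PG_inv: "p \<in> P \<Longrightarrow> inv\<^bsub>PG\<^esub> p \<in> P"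
  using PG.inv_closed[of p] by simp

lemma PG_mult: "p \<in> P \<Longrightarrow> r \<in> P \<Longrightarrow> p \<otimes>\<^bsub>PG\<^esub> r \<in> P"
  using PG.m_closed[of p r] by (simp del: PG_simps(2))

lemma act_inv: "p \<in> P \<Longrightarrow> act (inv\<^bsub>PG\<^esub> p) \<circ> act p = id" "p \<in> P \<Longrightarrow> act p \<circ> act (inv\<^bsub>PG\<^esub> p) = id"
proof -
  assume p: "p \<in> P"
  then have "inv\<^bsub>PG\<^esub> p \<in> P" using PG.inv_closed[of p] by simp
  then show "act (inv\<^bsub>PG\<^esub> p) \<circ> act p = id" "act p \<circ> act (inv\<^bsub>PG\<^esub> p) = id"
    using p PG.l_inv[of p] PG.r_inv[of p] by (simp_all flip: act_mult add: act_one)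
qed

lemma act_image:
  assumes "p \<in> P"
  shows "act p ` W = act (inv\<^bsub>PG\<^esub> p) -` W"
proof -
  have 1: "act (inv\<^bsub>PG\<^esub> p) (act p x) = x" "act p (act (inv\<^bsub>PG\<^esub> p) x) = x" for x
    using act_inv[OF assms] by (metis comp_apply id_apply)+
  show ?thesis
  proof (intro equalityI subsetI)
    fix y assume "y \<in> act (inv\<^bsub>PG\<^esub> p) -` W"
    then show "y \<in> act p ` W" by (intro image_eqI[of _ _ "act (inv\<^bsub>PG\<^esub> p) y"]) (simp_all add: 1)
  qed (use 1 in auto)
qed

lemma act_open:
  assumes "p \<in> P" "open W"
  shows "open (act p ` W)"
  unfolding act_image[OF assms(1)] by (rule open_vimage[OF assms(2) act_cont[OF PG_inv[OF assms(1)]]])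

lemma q_subset:
  assumes "p \<in> P"
  shows "q (act p x) \<subseteq> q x"
proof
  fix z assume "z \<in> q (act p x)"
  then obtain r where r: "r \<in> P" "z = act r (act p x)" by (auto simp: orbit_map_def act_def)
  then have "z = act (r \<otimes>\<^bsub>PG\<^esub> p) x" using act_mult[OF r(1) assms] by (simp del: PG_simps)
  then show "z \<in> q x"
    using PG_mult[OF r(1) assms] unfolding orbit_map_def act_def by blast
qed

lemma q_eq: "q x = q y \<longleftrightarrow> (\<exists>p\<in>P. y = act p x)"
proof
  assume "q x = q y"
  moreover have "y \<in> q y"
  proof -
    have "affine_action S (\<one>, id) y = y" using act_one by (simp add: act_def)
    then show ?thesis unfolding orbit_map_def using PG.one_closed by (metis (mono_tags, lifting) PG_simps(1,3) mem_Collect_eq)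
  qed
  ultimately show "\<exists>p\<in>P. y = act p x" by (auto simp: orbit_map_def act_def)
next
  assume "\<exists>p\<in>P. y = act p x"
  then obtain p where p: "p \<in> P" "y = act p x" by blast
  have "x = act (inv\<^bsub>PG\<^esub> p) y"
    using p act_inv(1)[OF p(1)] by (metis comp_apply id_apply)
  then show "q x = q y"
    using q_subset[OF p(1), of x] q_subset[OF PG_inv[OF p(1)], of y] p(2) by auto
qed

lemma \<Gamma>_sub: "subgroup \<Gamma> S"
  using \<Gamma>_lattice by (simp add: lattice_in_def)

lemma \<Gamma>_isolated: "\<gamma> \<in> \<Gamma> \<Longrightarrow> \<exists>W. open W \<and> W \<inter> \<Gamma> = {\<gamma>}"
proof -
  assume g: "\<gamma> \<in> \<Gamma>"
  have "top_of_set \<Gamma> = discrete_topology \<Gamma>"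
    using \<Gamma>_lattice by (simp add: lattice_in_def discrete_in_def)
  then have "openin (top_of_set \<Gamma>) {\<gamma>}" using g by simp
  then show ?thesis by (auto simp: openin_open)
qed

text \<open>Two elements of \<Gamma> near z have a quotient near \<one>, so they are equal; if the
  remaining element is not z, it is removed from the neighbourhood.\<close>

lemma \<Gamma>_separated: "\<exists>W. open W \<and> z \<in> W \<and> W \<inter> \<Gamma> \<subseteq> {z}"
proof -
  obtain W1 where W1: "open W1" "W1 \<inter> \<Gamma> = {\<one>}"
    using \<Gamma>_isolated subgroup.one_closed[OF \<Gamma>_sub] by blast
  have "open ((\<lambda>p. inv (fst p) \<otimes> snd p) -` W1)"
    by (rule open_vimage[OF W1(1)]) (intro continuous_intros)
  moreover have "(z, z) \<in> (\<lambda>p. inv (fst p) \<otimes> snd p) -` W1" using W1 by auto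
  ultimately obtain V1 V2 where V: "open V1" "open V2" "z \<in> V1" "z \<in> V2"
    "V1 \<times> V2 \<subseteq> (\<lambda>p. inv (fst p) \<otimes> snd p) -` W1"
    by (rule open_prod_elim) (auto elim!: SigmaE2)
  define V where "V = V1 \<inter> V2"
  have oV: "open V" "z \<in> V" using V by (auto simp: V_def)
  have one: "g = h" if "g \<in> V \<inter> \<Gamma>" "h \<in> V \<inter> \<Gamma>" for g h
  proof -
    have "inv g \<otimes> h \<in> W1" using V(5) that by (auto simp: V_def)
    moreover have "inv g \<otimes> h \<in> \<Gamma>"
      using that \<Gamma>_sub by (simp add: subgroup.m_closed subgroup.m_inv_closed)
    ultimately have "inv g \<otimes> h = \<one>" using W1 by blast
    then have "g \<otimes> (inv g \<otimes> h) = g" by simp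
    then show ?thesis by (simp add: m_assoc[symmetric])
  qed
  show ?thesis
  proof (cases "V \<inter> \<Gamma> \<subseteq> {z}")
    case True
    then show ?thesis using oV by blast
  next
    case False
    then obtain g where g: "g \<in> V \<inter> \<Gamma>" "g \<noteq> z" by blast
    have "open (V - {g})" using oV(1) by (intro open_Diff) auto
    then show ?thesis using oV g one by (intro exI[of _ "V - {g}"]) auto
  qed
qed

text \<open>If v is near x and g v is near y, then g is near y inv x, where \<Gamma> has at most
  that one element.\<close>

lemma \<Gamma>_proper:
  "\<exists>V W. open V \<and> open W \<and> x \<in> V \<and> y \<in> W \<and> (\<forall>g\<in>\<Gamma>. \<forall>v\<in>V. g \<otimes> v \<in> W \<longrightarrow> g \<otimes> x = y)"
proof -
  obtain O' where O': "open O'" "y \<otimes> inv x \<in> O'" "O' \<inter> \<Gamma> \<subseteq> {y \<otimes> inv x}"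
    using \<Gamma>_separated by blast
  have "open ((\<lambda>p. snd p \<otimes> inv (fst p)) -` O')"
    by (rule open_vimage[OF O'(1)]) (intro continuous_intros)
  moreover have "(x, y) \<in> (\<lambda>p. snd p \<otimes> inv (fst p)) -` O'" using O' by auto
  ultimately obtain V W where V: "open V" "open W" "x \<in> V" "y \<in> W"
    "V \<times> W \<subseteq> (\<lambda>p. snd p \<otimes> inv (fst p)) -` O'"
    by (rule open_prod_elim) (auto elim!: SigmaE2)
  have "g \<otimes> x = y" if "g \<in> \<Gamma>" "v \<in> V" "g \<otimes> v \<in> W" for g v
  proof -
    have "(g \<otimes> v) \<otimes> inv v \<in> O'" using V(5) that by force
    then have "g \<in> O'" by (simp add: m_assoc)
    then have "g = y \<otimes> inv x" using O' that by blast
    then show ?thesis by (simp add: m_assoc)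
  qed
  then show ?thesis using V by blast
qed

section \<open>Finite holonomy, freeness and properness of the deck action\<close>

definition "\<Gamma>P = {\<gamma> \<in> P. snd \<gamma> = id}"

lemma \<Gamma>P_fst: "\<gamma> \<in> \<Gamma>P \<longleftrightarrow> (\<exists>g\<in>\<Gamma>. \<gamma> = (g, id))"
  by (cases \<gamma>) (auto simp: \<Gamma>P_def \<Gamma>_def)

lemma act_\<Gamma>: "act (g, id) x = g \<otimes> x"
  by (simp add: act_def affine_action_def)

lemma snd_mult: "snd (x \<otimes>\<^bsub>PG\<^esub> y) = snd x \<circ> snd y"
  by (cases x; cases y) simp

lemma snd_inv: "p \<in> P \<Longrightarrow> snd (inv\<^bsub>PG\<^esub> p) \<circ> snd p = id"
  using snd_mult[of "inv\<^bsub>PG\<^esub> p" p] PG.l_inv[of p] by simp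

lemma \<Gamma>P_sub: "subgroup \<Gamma>P PG"
proof
  fix x y assume "x \<in> \<Gamma>P" "y \<in> \<Gamma>P"
  then show "x \<otimes>\<^bsub>PG\<^esub> y \<in> \<Gamma>P"
    using PG.m_closed[of x y] snd_mult[of x y] by (simp add: \<Gamma>P_def del: PG_simps(2))
next
  fix x assume "x \<in> \<Gamma>P"
  then show "inv\<^bsub>PG\<^esub> x \<in> \<Gamma>P"
    using PG.inv_closed[of x] snd_inv[of x] by (simp add: \<Gamma>P_def)
qed (use PG.one_closed in \<open>auto simp: \<Gamma>P_def\<close>)

lemma transversal: "\<exists>R. finite R \<and> R \<subseteq> P \<and> (\<forall>\<delta>\<in>P. \<exists>\<epsilon>\<in>\<Gamma>P. \<exists>\<rho>\<in>R. \<delta> = \<epsilon> \<otimes>\<^bsub>PG\<^esub> \<rho>)"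
proof -
  define R where "R = (\<lambda>X. SOME x. x \<in> X) ` (rcosets\<^bsub>PG\<^esub> \<Gamma>P)"
  have fin: "finite R" using P_fin by (simp add: R_def \<Gamma>P_def)
  have 1: "\<exists>\<epsilon>\<in>\<Gamma>P. (SOME x. x \<in> \<Gamma>P #>\<^bsub>PG\<^esub> \<delta>) = \<epsilon> \<otimes>\<^bsub>PG\<^esub> \<delta>" if "\<delta> \<in> P" for \<delta>
  proof -
    have "\<delta> \<in> \<Gamma>P #>\<^bsub>PG\<^esub> \<delta>" using PG.rcos_self[OF _ \<Gamma>P_sub] that by simp
    then have "(SOME x. x \<in> \<Gamma>P #>\<^bsub>PG\<^esub> \<delta>) \<in> \<Gamma>P #>\<^bsub>PG\<^esub> \<delta>" by (rule someI)
    then show ?thesis unfolding r_coset_def by blast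
  qed
  have "R \<subseteq> P"
  proof
    fix r assume "r \<in> R"
    then obtain \<delta> where d: "\<delta> \<in> P" "r = (SOME x. x \<in> \<Gamma>P #>\<^bsub>PG\<^esub> \<delta>)" by (auto simp: R_def RCOSETS_def)
    then obtain \<epsilon> where "\<epsilon> \<in> \<Gamma>P" "r = \<epsilon> \<otimes>\<^bsub>PG\<^esub> \<delta>" using 1 by metis
    then show "r \<in> P" using PG.m_closed[of \<epsilon> \<delta>] d by (simp add: \<Gamma>P_def)
  qed
  moreover have "\<exists>\<epsilon>\<in>\<Gamma>P. \<exists>\<rho>\<in>R. \<delta> = \<epsilon> \<otimes>\<^bsub>PG\<^esub> \<rho>" if d: "\<delta> \<in> P" for \<delta>
  proof -
    obtain \<epsilon> where e: "\<epsilon> \<in> \<Gamma>P" "(SOME x. x \<in> \<Gamma>P #>\<^bsub>PG\<^esub> \<delta>) = \<epsilon> \<otimes>\<^bsub>PG\<^esub> \<delta>" using 1[OF d] by blast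
    have "\<Gamma>P #>\<^bsub>PG\<^esub> \<delta> \<in> rcosets\<^bsub>PG\<^esub> \<Gamma>P" using d by (auto simp: RCOSETS_def)
    then have "\<epsilon> \<otimes>\<^bsub>PG\<^esub> \<delta> \<in> R" unfolding R_def using e(2) by (metis imageI)
    moreover have "\<delta> = inv\<^bsub>PG\<^esub> \<epsilon> \<otimes>\<^bsub>PG\<^esub> (\<epsilon> \<otimes>\<^bsub>PG\<^esub> \<delta>)"
    proof -
      have "\<epsilon> \<in> carrier PG" "\<delta> \<in> carrier PG" using e(1) d by (auto simp: \<Gamma>P_def)
      then show ?thesis
        using PG.m_assoc[of "inv\<^bsub>PG\<^esub> \<epsilon>" \<epsilon> \<delta>] PG.l_inv[of \<epsilon>] PG.l_one[of \<delta>] PG.inv_closed[of \<epsilon>] by (simp del: PG_simps)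
    qed
    ultimately show ?thesis using subgroup.m_inv_closed[OF \<Gamma>P_sub e(1)] by blast
  qed
  ultimately show ?thesis using fin by blast
qed

lemma snd_pow: "snd (p [^]\<^bsub>PG\<^esub> (i::nat)) = snd p ^^ i"
  by (induction i) (simp_all add: nat_pow_def snd_mult funpow_swap1 fun_eq_iff del: PG_simps(2))

text \<open>A finite transversal of the cosets of the lattice realises all automorphism parts, so
  among the first powers of one of them two coincide. Hence a power with exponent at most N is the
  identity, and N! is a multiple of that exponent.\<close>

lemma exponent: "\<exists>m>0. \<forall>p\<in>P. p [^]\<^bsub>PG\<^esub> (m::nat) \<in> \<Gamma>P"
proof -
  obtain R where R: "finite R" "R \<subseteq> P" "\<forall>\<delta>\<in>P. \<exists>\<epsilon>\<in>\<Gamma>P. \<exists>\<rho>\<in>R. \<delta> = \<epsilon> \<otimes>\<^bsub>PG\<^esub> \<rho>"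
    using transversal by blast
  have sndR: "snd p \<in> snd ` R" if p: "p \<in> P" for p
  proof -
    obtain \<epsilon> \<rho> where "\<epsilon> \<in> \<Gamma>P" "\<rho> \<in> R" "p = \<epsilon> \<otimes>\<^bsub>PG\<^esub> \<rho>" using R(3) p by blast
    then have "snd p = snd \<rho>" using snd_mult[of \<epsilon> \<rho>] by (simp add: \<Gamma>P_def del: PG_simps)
    then show ?thesis using \<open>\<rho> \<in> R\<close> by blast
  qed
  define N where "N = card (snd ` R)"
  have "p [^]\<^bsub>PG\<^esub> (fact N :: nat) \<in> \<Gamma>P" if p: "p \<in> P" for p
  proof -
    have pow: "p [^]\<^bsub>PG\<^esub> i \<in> P" for i :: nat using p PG.nat_pow_closed[of p i] by simp
    have "(\<lambda>i. snd p ^^ i) ` {..N} \<subseteq> snd ` R"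
      using sndR[OF pow] snd_pow by fastforce
    then have "card ((\<lambda>i. snd p ^^ i) ` {..N}) \<le> N"
      unfolding N_def using R(1) by (intro card_mono) auto
    then have "\<not> inj_on (\<lambda>i. snd p ^^ i) {..N}"
      by (metis card_atMost card_image not_less_eq_eq order_refl)
    then obtain i j where ij: "i < j" "j \<le> N" "snd p ^^ i = snd p ^^ j"
      unfolding inj_on_def by (metis atMost_iff linorder_neqE_nat)
    have bij: "bij (snd p ^^ i)" using C_auto(2)[OF P_C[OF p]] by (rule bij_fn)
    have "(snd p ^^ i) \<circ> (snd p ^^ (j - i)) = (snd p ^^ i) \<circ> id"
      using ij by (metis add_diff_inverse_nat comp_id funpow_add less_imp_le not_le)
    then have id: "snd p ^^ (j - i) = id"
      using bij by (metis bij_is_inj inj_eq comp_apply ext)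
    have "(j - i) dvd fact N" using ij by (intro dvd_fact) auto
    then obtain k where k: "fact N = (j - i) * k" by auto
    have "snd p ^^ (fact N) = id"
      unfolding k funpow_mult[symmetric] by (simp add: id)
    then show ?thesis using pow snd_pow by (simp add: \<Gamma>P_def)
  qed
  then show ?thesis by (intro exI[of _ "fact N"]) auto
qed

text \<open>A power of p is a left translation by an element of the lattice. As it fixes x it is
  trivial, and P is torsion-free.\<close>

lemma act_fixed:
  assumes p: "p \<in> P" and x: "act p x = x"
  shows "p = (\<one>, id)"
proof -
  obtain m where m: "m > 0" "p [^]\<^bsub>PG\<^esub> (m::nat) \<in> \<Gamma>P" using exponent p by blast
  have "act (p [^]\<^bsub>PG\<^esub> i) x = x" for i :: nat
  proof (induction i)
    case 0
    then show ?case by (simp add: act_one)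
  next
    case (Suc i)
    have "p [^]\<^bsub>PG\<^esub> i \<in> P" using p PG.nat_pow_closed[of p i] by simp
    then show ?case using Suc x p act_mult[of "p [^]\<^bsub>PG\<^esub> i" p] by (simp del: PG_simps)
  qed
  then have "act (p [^]\<^bsub>PG\<^esub> m) x = x" .
  moreover obtain g where g: "p [^]\<^bsub>PG\<^esub> m = (g, id)" using m(2) \<Gamma>P_fst by blast
  ultimately have "g \<otimes> x = x" by (simp add: act_\<Gamma>)
  then have "g = \<one>" by (simp add: r_cancel_one)
  then have "p [^]\<^bsub>PG\<^esub> m = \<one>\<^bsub>PG\<^esub>" using g by simp
  then show ?thesis using P_tf m(1) p unfolding torsion_free_def by auto
qed

lemma act_inj:
  assumes "p \<in> P" "r \<in> P" "act p x = act r x"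
  shows "p = r"
proof -
  have c: "p \<in> carrier PG" "r \<in> carrier PG" using assms by auto
  have i: "inv\<^bsub>PG\<^esub> r \<in> P" "inv\<^bsub>PG\<^esub> r \<otimes>\<^bsub>PG\<^esub> p \<in> P"
    using c PG.inv_closed[of r] PG.m_closed[of "inv\<^bsub>PG\<^esub> r" p] by (simp_all del: PG_simps(2))
  have "act (inv\<^bsub>PG\<^esub> r \<otimes>\<^bsub>PG\<^esub> p) x = x"
    using act_mult[OF i(1) assms(1)] act_inv(1)[OF assms(2)] assms(3) by (metis comp_apply id_apply)
  then have "inv\<^bsub>PG\<^esub> r \<otimes>\<^bsub>PG\<^esub> p = \<one>\<^bsub>PG\<^esub>"
    using act_fixed[OF i(2)] by simp
  then show ?thesis
    using c by (metis PG.inv_closed PG.inv_inv PG.inv_unique' PG.inv_equality)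
qed

text \<open>Each element of P is a lattice translation after one of finitely many transversal
  elements \<rho>; the neighbourhoods that \<open>\<Gamma>_proper\<close> gives at the points
  \<open>act \<rho> x\<close> can be pulled back and intersected.\<close>

lemma act_proper: "\<exists>V W. open V \<and> open W \<and> x \<in> V \<and> y \<in> W \<and> (\<forall>p\<in>P. \<forall>v\<in>V. act p v \<in> W \<longrightarrow> act p x = y)"
proof -
  obtain R where R: "finite R" "R \<subseteq> P" "\<forall>\<delta>\<in>P. \<exists>\<epsilon>\<in>\<Gamma>P. \<exists>\<rho>\<in>R. \<delta> = \<epsilon> \<otimes>\<^bsub>PG\<^esub> \<rho>"
    using transversal by blast
  define nice where "nice \<rho> V W \<longleftrightarrow> open V \<and> open W \<and> act \<rho> x \<in> V \<and> y \<in> W \<and>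
      (\<forall>g\<in>\<Gamma>. \<forall>v\<in>V. g \<otimes> v \<in> W \<longrightarrow> g \<otimes> act \<rho> x = y)" for \<rho> V W
  have "\<forall>\<rho>. \<exists>V W. nice \<rho> V W"
    unfolding nice_def by (intro allI \<Gamma>_proper)
  then obtain V W where nice: "\<forall>\<rho>. nice \<rho> (V \<rho>) (W \<rho>)" by metis
  have VW: "open (V \<rho>) \<and> open (W \<rho>) \<and> act \<rho> x \<in> V \<rho> \<and> y \<in> W \<rho> \<and>
      (\<forall>g\<in>\<Gamma>. \<forall>v\<in>V \<rho>. g \<otimes> v \<in> W \<rho> \<longrightarrow> g \<otimes> act \<rho> x = y)" for \<rho>
    by (rule nice[THEN spec, of \<rho>, unfolded nice_def])
  define V' where "V' = (\<Inter>\<rho>\<in>R. act \<rho> -` V \<rho>)"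
  define W' where "W' = (\<Inter>\<rho>\<in>R. W \<rho>)"
  have "open V'" "open W'"
    unfolding V'_def W'_def using R VW act_cont by (auto intro!: open_INT open_vimage)
  moreover have "x \<in> V'" "y \<in> W'" using VW by (auto simp: V'_def W'_def)
  moreover have "act p x = y" if p: "p \<in> P" "v \<in> V'" "act p v \<in> W'" for p v
  proof -
    obtain \<epsilon> \<rho> where er: "\<epsilon> \<in> \<Gamma>P" "\<rho> \<in> R" "p = \<epsilon> \<otimes>\<^bsub>PG\<^esub> \<rho>" using R(3) p(1) by blast
    obtain g where g: "g \<in> \<Gamma>" "\<epsilon> = (g, id)" using er(1) \<Gamma>P_fst by blast
    have "\<epsilon> \<in> P" "\<rho> \<in> P" using er R by (auto simp: \<Gamma>P_def)
    then have a: "act p z = g \<otimes> act \<rho> z" for z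
      using act_mult[of \<epsilon> \<rho>] er(3) g(2) by (simp add: act_\<Gamma> del: PG_simps)
    have "act \<rho> v \<in> V \<rho>" "g \<otimes> act \<rho> v \<in> W \<rho>"
      using p er a by (auto simp: V'_def W'_def)
    then have "g \<otimes> act \<rho> x = y" using VW[of \<rho>] g(1) by blast
    then show ?thesis using a by simp
  qed
  ultimately show ?thesis by blast
qed

lemma act_disjoint: "\<exists>W. open W \<and> y \<in> W \<and> (\<forall>p\<in>P. \<forall>w\<in>W. act p w \<in> W \<longrightarrow> p = (\<one>, id))"
proof -
  obtain V W where VW: "open V" "open W" "y \<in> V" "y \<in> W" "\<forall>p\<in>P. \<forall>v\<in>V. act p v \<in> W \<longrightarrow> act p y = y"
    using act_proper[of y y] by (elim exE conjE)
  have "p = (\<one>, id)" if "p \<in> P" "w \<in> V \<inter> W" "act p w \<in> V \<inter> W" for p w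
    using act_fixed[OF that(1), of y] VW(5) that by blast
  then show ?thesis
    using VW by (intro exI[of _ "V \<inter> W"]) (simp add: open_Int)
qed

lemma orbit_space: "topspace (orbit_space S P) = range q"
    "openin (orbit_space S P) V \<longleftrightarrow> V \<subseteq> range q \<and> open {x. q x \<in> V}"
  by (simp_all add: orbit_space_def topspace_quotient_topology openin_quotient_topology)

lemma open_q:
  assumes "open W"
  shows "openin (orbit_space S P) (q ` W)"
proof -
  have "{x. q x \<in> q ` W} = (\<Union>p\<in>P. act p ` W)"
  proof
    show "{x. q x \<in> q ` W} \<subseteq> (\<Union>p\<in>P. act p ` W)"
    proof clarify
      fix x w assume w: "w \<in> W" "q x = q w"
      then obtain p where "p \<in> P" "x = act p w" using q_eq[of w x] by auto
      then show "x \<in> (\<Union>p\<in>P. act p ` W)" using w by blast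
    qed
    show "(\<Union>p\<in>P. act p ` W) \<subseteq> {x. q x \<in> q ` W}"
    proof clarify
      fix p w assume pw: "p \<in> P" "w \<in> W"
      then have "q w = q (act p w)" using q_eq by blast
      then show "q (act p w) \<in> q ` W" using pw by (metis imageI)
    qed
  qed
  moreover have "open (\<Union>p\<in>P. act p ` W)" using act_open assms by blast
  ultimately show ?thesis by (auto simp: orbit_space)
qed

text \<open>The relation pairs x with the points over f (q x). On a neighbourhood W disjoint from
  its translates q is injective and open, so its inverse after f and q is a local section.\<close>

lemma deck_action_lift:
  assumes f: "continuous_map (orbit_space S P) (orbit_space S P) f"
  shows "deck_action (act ` P) (\<lambda>x y. f (q x) = q y)"
proof
  fix \<gamma> \<delta> assume "\<gamma> \<in> act ` P" "\<delta> \<in> act ` P"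
  then obtain p r where pr: "p \<in> P" "r \<in> P" "\<gamma> = act p" "\<delta> = act r" by auto
  then have "p \<otimes>\<^bsub>PG\<^esub> r \<in> P" using PG.m_closed[of p r] by (simp del: PG_simps(2))
  then show "\<gamma> \<circ> \<delta> \<in> act ` P"
    unfolding pr(3,4) act_mult[OF pr(1,2), symmetric] by (rule imageI)
next
  have "(\<one>, id) \<in> P" using PG.one_closed by simp
  then show "id \<in> act ` P" by (rule rev_image_eqI) (simp add: act_one)
next
  fix \<gamma> assume "\<gamma> \<in> act ` P"
  then obtain p where p: "p \<in> P" "\<gamma> = act p" by blast
  then have "inv\<^bsub>PG\<^esub> p \<in> P" using PG.inv_closed[of p] by simp
  then show "\<exists>\<delta>\<in>act ` P. \<delta> \<circ> \<gamma> = id \<and> \<gamma> \<circ> \<delta> = id" using act_inv[OF p(1)] p(2) by blast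
next
  fix y
  obtain W where W: "open W" "y \<in> W" "\<forall>p\<in>P. \<forall>w\<in>W. act p w \<in> W \<longrightarrow> p = (\<one>, id)"
    using act_disjoint by blast
  have "\<gamma> = id" if "\<gamma> \<in> act ` P" "\<gamma> ` W \<inter> W \<noteq> {}" for \<gamma>
    using that W(3) act_one by auto
  then show "\<exists>W. open W \<and> y \<in> W \<and> (\<forall>\<gamma>\<in>act ` P. \<gamma> ` W \<inter> W \<noteq> {} \<longrightarrow> \<gamma> = id)"
    using W by blast
next
  fix x y y' assume "f (q x) = q y"
  then show "f (q x) = q y' \<longleftrightarrow> (\<exists>\<gamma>\<in>act ` P. y' = \<gamma> y)" using q_eq by auto
next
  fix x
  have "f (q x) \<in> range q"
    using f by (metis continuous_map_image_subset_topspace image_subset_iff orbit_space(1) rangeI)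
  then obtain y where y: "f (q x) = q y" by blast
  obtain W where W: "open W" "y \<in> W" "\<forall>p\<in>P. \<forall>w\<in>W. act p w \<in> W \<longrightarrow> p = (\<one>, id)"
    using act_disjoint by blast
  have inj: "inj_on q W"
  proof (rule inj_onI)
    fix a b assume ab: "a \<in> W" "b \<in> W" "q a = q b"
    then obtain p where p: "p \<in> P" "b = act p a" using q_eq[of a b] by auto
    then have "p = (\<one>, id)" using W(3) ab(1,2) by blast
    then show "a = b" using p(2) act_one by simp
  qed
  have pre: "open {x'. f (q x') \<in> q ` W'}" if "open W'" for W'
  proof -
    have "openin (orbit_space S P) {p \<in> topspace (orbit_space S P). f p \<in> q ` W'}"
      using f open_q[OF that] by (rule openin_continuous_map_preimage)
    then show ?thesis by (simp add: orbit_space)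
  qed
  define V where "V = {x'. f (q x') \<in> q ` W}"
  define s where "s x' = inv_into W q (f (q x'))" for x'
  have sV: "s x' \<in> W" "q (s x') = f (q x')" if "x' \<in> V" for x'
    using that by (auto simp: V_def s_def inv_into_into f_inv_into_f)
  have "open V" unfolding V_def by (rule pre[OF W(1)])
  moreover have "x \<in> V" using y W(2) by (simp add: V_def)
  moreover have "continuous_on V s"
    unfolding continuous_on_open_vimage[OF \<open>open V\<close>]
  proof (intro allI impI)
    fix B :: "'s set" assume "open B"
    have "s -` B \<inter> V = {x'. f (q x') \<in> q ` (W \<inter> B)}"
    proof (intro equalityI subsetI)
      fix x' assume "x' \<in> s -` B \<inter> V"
      then have "s x' \<in> W \<inter> B" "q (s x') = f (q x')" using sV by auto
      then show "x' \<in> {x'. f (q x') \<in> q ` (W \<inter> B)}" by (metis imageI mem_Collect_eq)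
    next
      fix x' assume "x' \<in> {x'. f (q x') \<in> q ` (W \<inter> B)}"
      then obtain w where w: "w \<in> W" "w \<in> B" "f (q x') = q w" by auto
      then have "s x' = w" using inj by (simp add: s_def)
      then show "x' \<in> s -` B \<inter> V" using w by (simp add: V_def)
    qed
    then show "open (s -` B \<inter> V)" using pre[of "W \<inter> B"] W(1) \<open>open B\<close> by (simp add: open_Int)
  qed
  ultimately show "\<exists>V s. open V \<and> x \<in> V \<and> continuous_on V s \<and> (\<forall>x'\<in>V. f (q x') = q (s x'))"
    using sV(2) by metis
qed (use act_cont in blast)

lemma locally_path_connected_S:
  assumes "open V" "(x :: 's) \<in> V"
  shows "\<exists>W. open W \<and> x \<in> W \<and> W \<subseteq> V \<and> path_connected W"
proof -
  obtain U \<phi> where U: "(U, \<phi>) \<in> A" "x \<in> U" using exists_chart by blast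
  note ch = chart[OF U(1)]
  have "open {y \<in> \<phi> ` U. inv_into U \<phi> y \<in> V}" by (rule open_chart_preimage[OF U(1) assms(1)])
  moreover have "\<phi> x \<in> {y \<in> \<phi> ` U. inv_into U \<phi> y \<in> V}" using U assms by (simp add: chart_inv)
  ultimately obtain r where r: "r > 0" "ball (\<phi> x) r \<subseteq> {y \<in> \<phi> ` U. inv_into U \<phi> y \<in> V}"
    unfolding open_contains_ball by blast
  define W where "W = inv_into U \<phi> ` ball (\<phi> x) r"
  have W_eq: "W = {s \<in> U. \<phi> s \<in> ball (\<phi> x) r}"
    unfolding W_def using r(2) chart_inv[OF U(1)] by (force simp: inv_into_into f_inv_into_f image_iff)
  have "open {s \<in> U. \<phi> s \<in> ball (\<phi> x) r}"
    using continuous_open_preimage[OF ch(3,1) open_ball] by (simp add: vimage_def Int_def)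
  then have "open W" by (simp add: W_eq)
  moreover have "x \<in> W" unfolding W_eq using U r by simp
  moreover have "W \<subseteq> V" using r(2) by (auto simp: W_def)
  moreover have "path_connected W"
    unfolding W_def
    by (intro path_connected_continuous_image continuous_on_subset[OF ch(4)] convex_imp_path_connected convex_ball)
      (use r(2) in auto)
  ultimately show ?thesis by blast
qed

lemma lift_exists:
  assumes f: "continuous_map (orbit_space S P) (orbit_space S P) f"
  shows "\<exists>F. F \<in> lifts q f"
proof -
  interpret deck_action "act ` P" "\<lambda>x y. f (q x) = q y" by (rule deck_action_lift[OF f])
  obtain V s where "\<one> \<in> V" "\<forall>x\<in>V. f (q x) = q (s x)" using Rel_local[of \<one>] by blast
  then have "f (q \<one>) = q (s \<one>)" by blast
  from monodromy[OF simply_conn locally_path_connected_S this] obtain F where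
    "continuous_on UNIV F" "\<forall>x. f (q x) = q (F x)" by blast
  then show ?thesis by (intro exI[of _ F]) (auto simp: lifts_def fun_eq_iff)
qed

text \<open>Uniqueness of lifts, for the relation that belongs to the identity of the orbit space; F
  and F' cover the same map and the group is connected.\<close>

lemma lifts_differ:
  fixes F F' :: "'s \<Rightarrow> 's"
  assumes F: "continuous_on UNIV F" "continuous_on UNIV F'" "\<And>x. q (F x) = q (F' x)"
  shows "\<exists>p\<in>P. F' = act p \<circ> F"
proof -
  interpret deck_action "act ` P" "\<lambda>x y. id (q x) = q y" by (rule deck_action_lift) (rule continuous_map_id)
  obtain p where p: "p \<in> P" "F' \<one> = act p (F \<one>)"
    using F(3)[of \<one>] q_eq[of "F \<one>" "F' \<one>"] by auto
  have "F' x = act p (F x)" for x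
  proof (rule lift_unique[OF conn F(1,2) _ UNIV_I imageI[OF p(1)] p(2) UNIV_I])
    show "\<exists>\<gamma>\<in>act ` P. F' t = \<gamma> (F t)" for t
      using F(3)[of t] q_eq[of "F t" "F' t"] by auto
  qed
  then show ?thesis by (intro bexI[OF _ p(1)] ext) simp
qed

end

section \<open>The automorphism of the deck group induced by a homeomorphism\<close>

locale infra_homeo = infra S A C P
  for S :: "'s::{t2_space, second_countable_topology} monoid" (structure)
    and A :: "('s, real^'n) atlas" and C :: "('s \<Rightarrow> 's) set" and P :: "('s \<times> ('s \<Rightarrow> 's)) set" +
  fixes f f' :: "'s set \<Rightarrow> 's set"
  assumes homeo: "homeomorphic_maps (orbit_space S P) (orbit_space S P) f f'"
begin

definition F where "F = (SOME F. F \<in> lifts q f)"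
definition F' where "F' = (SOME F. F \<in> lifts q f')"

lemma F: "continuous_on UNIV F" "q (F x) = f (q x)" and F': "continuous_on UNIV F'" "q (F' x) = f' (q x)"
proof -
  have "F \<in> lifts q f" "F' \<in> lifts q f'"
    unfolding F_def F'_def using homeo lift_exists
    by (auto simp: homeomorphic_maps_def intro!: someI_ex[of "\<lambda>F. F \<in> _"])
  then show "continuous_on UNIV F" "q (F x) = f (q x)" "continuous_on UNIV F'" "q (F' x) = f' (q x)"
    by (auto simp: lifts_def fun_eq_iff)
qed

lemma f_inverse: "f' (f (q x)) = q x" "f (f' (q x)) = q x"
  using homeo by (auto simp: homeomorphic_maps_def orbit_space(1))

lemma act_bij: "p \<in> P \<Longrightarrow> bij (act p)"
  using act_inv o_bij by blast

lemma q_act: "p \<in> P \<Longrightarrow> q (act p x) = q x"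
  using q_eq by blast

text \<open>F' lifts the inverse of f, but it inverts F only up to deck transformations: both
  composites cover the identity, so they are deck transformations and hence bijective.\<close>

lemma F_bij: "bij F"
proof -
  have "\<exists>p\<in>P. F' \<circ> F = act p \<circ> id"
    by (rule lifts_differ) (use F F' f_inverse continuous_on_compose2[OF F'(1) F(1)] in \<open>auto simp: o_def\<close>)
  then obtain p where p: "p \<in> P" "F' \<circ> F = act p" by auto
  have "\<exists>p\<in>P. F \<circ> F' = act p \<circ> id"
    by (rule lifts_differ) (use F F' f_inverse continuous_on_compose2[OF F(1) F'(1)] in \<open>auto simp: o_def\<close>)
  then obtain r where r: "r \<in> P" "F \<circ> F' = act r" by auto
  have "inj F"
  proof (rule injI)
    fix x y assume "F x = F y"
    then have "act p x = act p y" unfolding p(2)[symmetric] by simp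
    then show "x = y" using act_bij[OF p(1)] by (simp add: bij_is_inj inj_eq)
  qed
  moreover have "\<exists>x. y = F x" for y
  proof -
    obtain z where "y = act r z" using bij_is_surj[OF act_bij[OF r(1)]] by (rule surjE)
    then show ?thesis unfolding r(2)[symmetric] by (intro exI[of _ "F' z"]) simp
  qed
  then have "surj F" unfolding surj_def by blast
  ultimately show ?thesis by (simp add: bij_def)
qed

lemma F_inv_cont: "continuous_on UNIV (inv_into UNIV F)"
proof -
  have "\<exists>p\<in>P. F' \<circ> F = act p \<circ> id"
    by (rule lifts_differ) (use F F' f_inverse continuous_on_compose2[OF F'(1) F(1)] in \<open>auto simp: o_def\<close>)
  then obtain p where p: "p \<in> P" "F' \<circ> F = act p" by auto
  have "inv_into UNIV F x = act (inv\<^bsub>PG\<^esub> p) (F' x)" for x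
  proof -
    have "act (inv\<^bsub>PG\<^esub> p) (F' (F y)) = y" for y
      using p act_inv(1)[OF p(1)] by (metis comp_apply id_apply)
    then show ?thesis
      using F_bij by (metis bij_inv_eq_iff)
  qed
  then have "inv_into UNIV F = (\<lambda>x. act (inv\<^bsub>PG\<^esub> p) (F' x))" by auto
  then show ?thesis
    using continuous_on_compose2[OF act_cont[OF PG_inv[OF p(1)]] F'(1)] by simp
qed

text \<open>The induced map of deck groups, F \<gamma> = \<phi>(\<gamma>) F. A suitable element
  exists because F after \<open>act p\<close> covers the same map as F, and it is unique because P
  acts freely.\<close>

definition \<phi> where "\<phi> p = (THE r. r \<in> P \<and> F \<circ> act p = act r \<circ> F)"

lemma \<phi>:
  assumes "p \<in> P"
  shows "\<phi> p \<in> P" "F (act p x) = act (\<phi> p) (F x)"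
proof -
  have "\<exists>r\<in>P. F \<circ> act p = act r \<circ> F"
    by (rule lifts_differ) (use F q_act[OF assms] continuous_on_compose2[OF F(1) act_cont[OF assms]] in \<open>auto simp: o_def\<close>)
  moreover have "r = r'" if "r \<in> P" "r' \<in> P" "act r \<circ> F = act r' \<circ> F" for r r'
    using act_inj[OF that(1,2), of "F \<one>"] that(3) by (metis comp_apply)
  ultimately have "\<exists>!r. r \<in> P \<and> F \<circ> act p = act r \<circ> F" by metis
  from theI'[OF this] show "\<phi> p \<in> P" "F (act p x) = act (\<phi> p) (F x)"
    unfolding \<phi>_def[symmetric] by (auto simp: fun_eq_iff)
qed

lemma \<phi>_unique: "p \<in> P \<Longrightarrow> r \<in> P \<Longrightarrow> F (act p x) = act r (F x) \<Longrightarrow> \<phi> p = r"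
  using \<phi>(1)[of p] \<phi>(2)[of p x] act_inj[of "\<phi> p" r "F x"] by simp

lemma \<phi>_mult:
  assumes "p \<in> P" "r \<in> P"
  shows "\<phi> (p \<otimes>\<^bsub>PG\<^esub> r) = \<phi> p \<otimes>\<^bsub>PG\<^esub> \<phi> r"
proof (rule \<phi>_unique[OF PG_mult[OF assms] PG_mult[OF \<phi>(1)[OF assms(1)] \<phi>(1)[OF assms(2)]], of \<one>])
  show "F (act (p \<otimes>\<^bsub>PG\<^esub> r) \<one>) = act (\<phi> p \<otimes>\<^bsub>PG\<^esub> \<phi> r) (F \<one>)"
    unfolding act_mult[OF assms] act_mult[OF \<phi>(1)[OF assms(1)] \<phi>(1)[OF assms(2)]]
    using \<phi>(2)[OF assms(1)] \<phi>(2)[OF assms(2)] by simp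
qed

text \<open>Conjugating the action of r by the inverse of the lift F covers the identity again, so
  it is the action of some p.\<close>

lemma \<phi>_surj:
  assumes r: "r \<in> P"
  shows "\<exists>p\<in>P. \<phi> p = r"
proof -
  have FF: "F (inv_into UNIV F x) = x" for x
    using F_bij by (simp add: bij_is_surj surj_f_inv_f)
  have q: "q (inv_into UNIV F (act r (F x))) = q x" for x
  proof -
    have "f (q (inv_into UNIV F (act r (F x)))) = f (q x)"
      using F(2)[of "inv_into UNIV F (act r (F x))"] q_act[OF r] FF F(2) by simp
    then show ?thesis using f_inverse(1) by metis
  qed
  have "continuous_on UNIV (\<lambda>x. inv_into UNIV F (act r (F x)))"
    by (intro continuous_on_compose2[OF F_inv_cont] continuous_on_compose2[OF act_cont[OF r]] F) auto
  then have "\<exists>p\<in>P. (\<lambda>x. inv_into UNIV F (act r (F x))) = act p \<circ> id"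
    by (intro lifts_differ) (simp_all add: q)
  then obtain p where p: "p \<in> P" "\<And>x. inv_into UNIV F (act r (F x)) = act p x" by (auto simp: fun_eq_iff)
  then have "F (act p \<one>) = act r (F \<one>)" using FF by metis
  then show ?thesis using \<phi>_unique[OF p(1) r] p(1) by blast
qed

lemma \<phi>_pow: "p \<in> P \<Longrightarrow> (\<phi> ^^ k) p \<in> P"
  by (induction k) (auto intro: \<phi>(1))

lemma F_pow_act: "p \<in> P \<Longrightarrow> (F ^^ k) (act p x) = act ((\<phi> ^^ k) p) ((F ^^ k) x)"
  by (induction k) (simp_all add: \<phi>(2) \<phi>_pow)

lemma \<phi>_pow_hom: "\<phi> ^^ k \<in> hom PG PG"
proof (rule homI)
  fix x y assume "x \<in> carrier PG" "y \<in> carrier PG"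
  then have xy: "x \<in> P" "y \<in> P" by auto
  then show "(\<phi> ^^ k) (x \<otimes>\<^bsub>PG\<^esub> y) = (\<phi> ^^ k) x \<otimes>\<^bsub>PG\<^esub> (\<phi> ^^ k) y"
    by (induction k) (simp_all add: \<phi>_mult \<phi>_pow del: PG_simps)
qed (use \<phi>_pow in simp)

lemma F_pow: "continuous_on UNIV (F ^^ k)" "q ((F ^^ k) x) = (f ^^ k) (q x)" "bij (F ^^ k)"
proof -
  show "continuous_on UNIV (F ^^ k)"
    by (induction k) (simp_all add: continuous_on_id' F(1) continuous_on_compose2[OF F(1)] o_def id_def)
  show "q ((F ^^ k) x) = (f ^^ k) (q x)"
    by (induction k) (simp_all add: F(2))
  show "bij (F ^^ k)" using F_bij by (rule bij_fn)
qed

lemma deck: "h \<in> deck_transformations q \<longleftrightarrow> (\<exists>p\<in>P. h = act p)"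
proof
  assume "h \<in> deck_transformations q"
  then have "continuous_on UNIV h" "\<And>x. q (h x) = q x"
    by (auto simp: deck_transformations_def homeomorphism_def fun_eq_iff)
  then have "\<exists>p\<in>P. h = act p \<circ> id" by (intro lifts_differ) auto
  then show "\<exists>p\<in>P. h = act p" by simp
next
  assume "\<exists>p\<in>P. h = act p"
  then obtain p where p: "p \<in> P" "h = act p" by blast
  have "homeomorphism UNIV UNIV (act p) (act (inv\<^bsub>PG\<^esub> p))"
    using act_cont[OF p(1)] act_cont[OF PG_inv[OF p(1)]] act_inv[OF p(1)] act_bij[OF p(1)] act_bij[OF PG_inv[OF p(1)]]
    by (auto simp: homeomorphism_def fun_eq_iff bij_is_surj)
  then show "h \<in> deck_transformations q"
    using q_act[OF p(1)] by (auto simp: deck_transformations_def p(2) fun_eq_iff)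
qed

lemma inv_act: "p \<in> P \<Longrightarrow> inv_into UNIV (act p) = act (inv\<^bsub>PG\<^esub> p)"
  using act_inv by (metis inv_unique_comp)

text \<open>Each p gives the lift p F^k, and conjugation of lifts by \<delta> becomes p \<mapsto>
  \<delta> p \<phi>^k(\<delta>)^(-1) on P. One representative is kept from each class that contains
  such a lift.\<close>

lemma twisted_classes_finite:
  assumes fin: "reidemeister_number q (f ^^ k) < \<infinity>"
  shows "\<exists>E. finite E \<and> E \<subseteq> P \<and> (\<forall>\<gamma>\<in>P. \<exists>\<gamma>0\<in>E. \<exists>\<delta>\<in>P. \<gamma> = \<delta> \<otimes>\<^bsub>PG\<^esub> \<gamma>0 \<otimes>\<^bsub>PG\<^esub> inv\<^bsub>PG\<^esub> ((\<phi> ^^ k) \<delta>))"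
proof -
  define r where "r = lift_conjugacy q (f ^^ k)"
  define lf where "lf p = act p \<circ> (F ^^ k)" for p
  have lf: "lf p \<in> lifts q (f ^^ k)" if "p \<in> P" for p
    using continuous_on_compose2[OF act_cont[OF that] F_pow(1)[of k]] F_pow(2)[of k] q_act[OF that]
    by (simp add: lifts_def lf_def fun_eq_iff o_def)
  have finite: "finite (lifts q (f ^^ k) // r)"
    using fin by (auto simp: reidemeister_number_def r_def Let_def split: if_splits)
  define E where "E = (\<lambda>X. SOME p. p \<in> P \<and> lf p \<in> X) ` {X \<in> lifts q (f ^^ k) // r. \<exists>p\<in>P. lf p \<in> X}"
  have E: "finite E" using finite by (simp add: E_def)
  have "E \<subseteq> P"
  proof
    fix p assume "p \<in> E"
    then obtain X p' where "p' \<in> P \<and> lf p' \<in> X" "p = (SOME p. p \<in> P \<and> lf p \<in> X)" by (auto simp: E_def)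
    then show "p \<in> P" using someI[of "\<lambda>p. p \<in> P \<and> lf p \<in> X" p'] by simp
  qed
  have rel: "\<exists>\<delta>\<in>P. p' = \<delta> \<otimes>\<^bsub>PG\<^esub> p \<otimes>\<^bsub>PG\<^esub> inv\<^bsub>PG\<^esub> ((\<phi> ^^ k) \<delta>)"
    if p: "p \<in> P" "p' \<in> P" "(lf p, lf p') \<in> r" for p p'
  proof -
    obtain h where h: "h \<in> deck_transformations q" "lf p' = h \<circ> lf p \<circ> inv_into UNIV h"
      using p(3) by (auto simp: r_def lift_conjugacy_def)
    then obtain \<delta> where \<delta>: "\<delta> \<in> P" "h = act \<delta>" using deck by blast
    have i: "inv\<^bsub>PG\<^esub> \<delta> \<in> P" by (rule PG_inv[OF \<delta>(1)])
    interpret \<psi>: group_hom PG PG "\<phi> ^^ k"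
      by unfold_locales (rule \<phi>_pow_hom)
    have "act p' ((F ^^ k) \<one>) = act \<delta> (act p ((F ^^ k) (act (inv\<^bsub>PG\<^esub> \<delta>) \<one>)))"
      using h(2) by (simp add: lf_def \<delta>(2) inv_act[OF \<delta>(1)] fun_eq_iff)
    also have "\<dots> = act \<delta> (act p (act ((\<phi> ^^ k) (inv\<^bsub>PG\<^esub> \<delta>)) ((F ^^ k) \<one>)))"
      by (simp add: F_pow_act[OF i])
    also have "\<dots> = act (\<delta> \<otimes>\<^bsub>PG\<^esub> p \<otimes>\<^bsub>PG\<^esub> (\<phi> ^^ k) (inv\<^bsub>PG\<^esub> \<delta>)) ((F ^^ k) \<one>)"
      using act_mult[OF PG_mult[OF \<delta>(1) p(1)] \<phi>_pow[OF i]] act_mult[OF \<delta>(1) p(1)] by (simp del: PG_simps)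
    finally have "p' = \<delta> \<otimes>\<^bsub>PG\<^esub> p \<otimes>\<^bsub>PG\<^esub> (\<phi> ^^ k) (inv\<^bsub>PG\<^esub> \<delta>)"
      by (rule act_inj[OF p(2) PG_mult[OF PG_mult[OF \<delta>(1) p(1)] \<phi>_pow[OF i]]])
    then show ?thesis using \<delta>(1) \<psi>.hom_inv[of \<delta>] by auto
  qed
  have "\<exists>\<gamma>0\<in>E. \<exists>\<delta>\<in>P. \<gamma> = \<delta> \<otimes>\<^bsub>PG\<^esub> \<gamma>0 \<otimes>\<^bsub>PG\<^esub> inv\<^bsub>PG\<^esub> ((\<phi> ^^ k) \<delta>)" if \<gamma>: "\<gamma> \<in> P" for \<gamma>
  proof -
    define X where "X = r `` {lf \<gamma>}"
    have X: "X \<in> lifts q (f ^^ k) // r" unfolding X_def by (rule quotientI[OF lf[OF \<gamma>]])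
    have id: "(lf \<gamma>, lf \<gamma>) \<in> r"
    proof -
      have "id \<in> deck_transformations q" using deck PG.one_closed act_one by (metis PG_simps(1,3))
      then show ?thesis
        using lf[OF \<gamma>] unfolding r_def lift_conjugacy_def by (auto intro!: bexI[of _ id])
    qed
    then have mem: "\<gamma> \<in> P \<and> lf \<gamma> \<in> X" using \<gamma> by (simp add: X_def)
    define p where "p = (SOME p. p \<in> P \<and> lf p \<in> X)"
    have p: "p \<in> P" "lf p \<in> X" using someI[of "\<lambda>p. p \<in> P \<and> lf p \<in> X", OF mem] by (simp_all add: p_def)
    have pE: "p \<in> E" unfolding E_def p_def using X mem by blast
    have "(lf \<gamma>, lf p) \<in> r" using p(2) by (simp add: X_def)
    \<comment> \<open>X is the image of \<open>lf \<gamma>\<close> under r, so membership gives the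
      relation in one direction only; conjugating with the inverse deck transformation reverses
      it.\<close>
    then have "(lf p, lf \<gamma>) \<in> r"
    proof -
      obtain h where h: "h \<in> deck_transformations q" "lf p = h \<circ> lf \<gamma> \<circ> inv_into UNIV h"
        using \<open>(lf \<gamma>, lf p) \<in> r\<close> by (auto simp: r_def lift_conjugacy_def)
      then obtain \<delta> where \<delta>: "\<delta> \<in> P" "h = act \<delta>" using deck by blast
      have i: "inv\<^bsub>PG\<^esub> \<delta> \<in> P" by (rule PG_inv[OF \<delta>(1)])
      have "lf \<gamma> = act (inv\<^bsub>PG\<^esub> \<delta>) \<circ> lf p \<circ> act \<delta>"
      proof
        fix x
        show "lf \<gamma> x = (act (inv\<^bsub>PG\<^esub> \<delta>) \<circ> lf p \<circ> act \<delta>) x"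
          using fun_cong[OF act_inv(1)[OF \<delta>(1)]] by (simp add: h(2) \<delta>(2) inv_act[OF \<delta>(1)])
      qed
      then have eq: "lf \<gamma> = act (inv\<^bsub>PG\<^esub> \<delta>) \<circ> lf p \<circ> inv_into UNIV (act (inv\<^bsub>PG\<^esub> \<delta>))"
        using inv_act[OF i] \<delta>(1) by simp
      have "act (inv\<^bsub>PG\<^esub> \<delta>) \<in> deck_transformations q" unfolding deck by (rule bexI[OF refl i])
      from bexI[where P = "\<lambda>h. lf \<gamma> = h \<circ> lf p \<circ> inv_into UNIV h", OF eq this] show ?thesis
        using lf[OF p(1)] lf[OF \<gamma>] by (simp add: r_def lift_conjugacy_def)
    qed
    then show ?thesis using rel[OF p(1) \<gamma>] pE by blast
  qed
  then show ?thesis using E \<open>E \<subseteq> P\<close> by blast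
qed

end

section \<open>Power subgroups and the proof of nilpotency\<close>

context infra
begin

lemma PG_pow_closed: "p \<in> P \<Longrightarrow> p [^]\<^bsub>PG\<^esub> (i::nat) \<in> P"
  using PG.nat_pow_closed[of p i] by simp

lemma fst_mult: "x \<in> \<Gamma>P \<Longrightarrow> fst (x \<otimes>\<^bsub>PG\<^esub> y) = fst x \<otimes> fst y"
  by (cases x; cases y) (auto simp: \<Gamma>P_def)

lemma \<Gamma>_pow: "g \<in> \<Gamma> \<Longrightarrow> (g, id) [^]\<^bsub>PG\<^esub> (i::nat) = (g [^] i, id)"
  by (induction i) (simp_all add: nat_pow_def)

end

context infra_homeo
begin

text \<open>The powers \<open>p\<^sup>m\<close> generate a subgroup of the lattice that every automorphism of \<open>P\<close> preserves; the
  lattice itself need not be preserved.\<close>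

definition power_subgroup :: "nat \<Rightarrow> ('s \<times> ('s \<Rightarrow> 's)) set" where
  "power_subgroup m = generate PG {p [^]\<^bsub>PG\<^esub> m | p. p \<in> P}"

lemma power_subgroup:
  assumes m: "\<forall>p\<in>P. p [^]\<^bsub>PG\<^esub> m \<in> \<Gamma>P"
  shows "subgroup (power_subgroup m) PG" "power_subgroup m \<subseteq> \<Gamma>P" "\<phi> ` power_subgroup m = power_subgroup m"
    "p \<in> P \<Longrightarrow> p [^]\<^bsub>PG\<^esub> m \<in> power_subgroup m"
proof -
  let ?X = "{p [^]\<^bsub>PG\<^esub> m | p. p \<in> P}"
  have X: "?X \<subseteq> carrier PG" using PG_pow_closed by auto
  show "subgroup (power_subgroup m) PG"
    unfolding power_subgroup_def by (rule PG.generate_is_subgroup[OF X])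
  show "power_subgroup m \<subseteq> \<Gamma>P"
    unfolding power_subgroup_def by (rule PG.generate_subgroup_incl[OF _ \<Gamma>P_sub]) (use m in auto)
  show "p \<in> P \<Longrightarrow> p [^]\<^bsub>PG\<^esub> m \<in> power_subgroup m"
    unfolding power_subgroup_def by (rule generate.incl) blast
  have hom: "\<phi> \<in> hom PG PG" using \<phi>_pow_hom[of 1] by simp
  interpret \<phi>: group_hom PG PG \<phi>
    by unfold_locales (rule hom)
  have pow: "\<phi> (p [^]\<^bsub>PG\<^esub> m) = \<phi> p [^]\<^bsub>PG\<^esub> m" if "p \<in> P" for p
    using \<phi>.hom_nat_pow[of p m] that by simp
  have "\<phi> ` ?X = ?X"
  proof (intro equalityI subsetI)
    fix y assume "y \<in> \<phi> ` ?X"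
    then obtain p where "p \<in> P" "y = \<phi> p [^]\<^bsub>PG\<^esub> m" using pow by auto
    then show "y \<in> ?X" using \<phi>(1) by blast
  next
    fix y assume "y \<in> ?X"
    then obtain r where r: "r \<in> P" "y = r [^]\<^bsub>PG\<^esub> m" by blast
    then obtain p where "p \<in> P" "\<phi> p = r" using \<phi>_surj by blast
    then show "y \<in> \<phi> ` ?X" using r pow by (intro image_eqI[of _ _ "p [^]\<^bsub>PG\<^esub> m"]) (simp, blast)
  qed
  then show "\<phi> ` power_subgroup m = power_subgroup m"
    unfolding power_subgroup_def using \<phi>.generate_img[OF X] by simp
qed

text \<open>Verifies the condition \<open>rigid\<close> of \<open>cocycle_coboundary\<close>. If a
  nonzero homomorphism on the derived group of L is scaled by a nontrivial \<xi>, then some \<phi>^k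
  with k > 0 leaves \<xi> invariant on L, and finiteness of the Reidemeister number of f^k makes
  \<xi> trivial there, a contradiction.\<close>

lemma reidemeister_cocycle_coboundary:
  fixes \<xi> :: "'s \<Rightarrow> real" and b :: "'s \<Rightarrow> complex"
  assumes finite: "\<And>k. k > 0 \<Longrightarrow> reidemeister_number q (f ^^ k) < \<infinity>"
    and rep: "tri_rep S n T"
    and near: "\<And>h W. open W \<Longrightarrow> h \<in> W \<Longrightarrow> \<exists>\<epsilon>>0. \<forall>g.
       (\<forall>i<n. \<forall>j<n. cmod (T g i j - (if i = j then 1 else 0)) < \<epsilon>) \<longrightarrow> g \<otimes> h \<otimes> inv g \<in> W"
    and \<xi>: "continuous_on UNIV \<xi>" "\<And>s. \<xi> s > 0" "\<And>s t. \<xi> (s \<otimes> t) = \<xi> s * \<xi> t"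
    and nontrivial: "\<exists>s. \<xi> s \<noteq> 1"
    and b: "continuous_on UNIV b" "\<And>s t. b (s \<otimes> t) = b s + \<xi> s * b t"
  shows "\<exists>\<kappa>::complex. \<forall>s. b s = \<kappa> * (1 - complex_of_real (\<xi> s))"
proof -
  interpret T: tri_rep S n T by (rule rep)
  obtain m where m: "m > 0" "\<forall>p\<in>P. p [^]\<^bsub>PG\<^esub> (m::nat) \<in> \<Gamma>P" using exponent by blast
  define LP where "LP = power_subgroup m"
  note LP = power_subgroup[OF m(2), folded LP_def]
  \<comment> \<open>The same subgroup twice: \<open>LP\<close> in the deck group, where \<phi> and
    twisted conjugacy live, and \<open>L\<close> in S, where T, \<xi> and b live.\<close>
  define L where "L = fst ` LP"
  have LP_L: "(g, id) \<in> LP \<longleftrightarrow> g \<in> L" for g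
    using LP(2) by (force simp: L_def \<Gamma>P_def)
  have L\<Gamma>: "L \<subseteq> \<Gamma>" using LP(2) by (auto simp: L_def \<Gamma>P_fst)
  have L: "subgroup L S"
  proof
    fix x y assume "x \<in> L" "y \<in> L"
    then have "(x, id) \<otimes>\<^bsub>PG\<^esub> (y, id) \<in> LP" using subgroup.m_closed[OF LP(1)] LP_L by blast
    then show "x \<otimes> y \<in> L" using LP_L by simp
  next
    fix x assume x: "x \<in> L"
    have "inv\<^bsub>PG\<^esub> (x, id) = (inv x, id)"
    proof (rule PG.inv_equality)
      have "inv x \<in> \<Gamma>" "x \<in> \<Gamma>" using x L\<Gamma> subgroup.m_inv_closed[OF \<Gamma>_sub] by auto
      then show "(inv x, id) \<in> carrier PG" "(x, id) \<in> carrier PG" by (simp_all add: \<Gamma>_def)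
    qed simp
    then show "inv x \<in> L" using subgroup.m_inv_closed[OF LP(1)] x LP_L by metis
  qed (use subgroup.one_closed[OF LP(1)] LP_L in auto)
  have pow: "x [^] m \<in> L" if "x \<in> \<Gamma>" for x
    using LP(4)[of "(x, id)"] that \<Gamma>_pow[OF that, of m] LP_L by (simp add: \<Gamma>_def)
  define \<phi>S where "\<phi>S g = fst (\<phi> (g, id))" for g
  have \<phi>S: "\<phi> (g, id) = (\<phi>S g, id)" "\<phi>S g \<in> L" if "g \<in> L" for g
  proof -
    have "\<phi> (g, id) \<in> LP" using that LP(3) LP_L by blast
    moreover have "snd (\<phi> (g, id)) = id" using calculation LP(2) by (auto simp: \<Gamma>P_def)
    ultimately show "\<phi> (g, id) = (\<phi>S g, id)" "\<phi>S g \<in> L"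
      unfolding \<phi>S_def L_def by (auto simp: prod_eq_iff)
  qed
  have \<phi>S_img: "\<phi>S ` L = L"
  proof (intro equalityI subsetI)
    fix y assume "y \<in> L"
    then have "(y, id) \<in> \<phi> ` LP" using LP(3) LP_L by blast
    then obtain x where "x \<in> LP" "\<phi> x = (y, id)" by force
    moreover have "x = (fst x, id)" using calculation LP(2) by (auto simp: \<Gamma>P_def prod_eq_iff)
    ultimately have "fst x \<in> L" "\<phi>S (fst x) = y" unfolding L_def \<phi>S_def by (metis imageI fst_conv)+
    then show "y \<in> \<phi>S ` L" by blast
  qed (use \<phi>S in auto)
  have LP_P: "(g, id) \<in> P" if "g \<in> L" for g using that L\<Gamma> by (auto simp: \<Gamma>_def)
  have \<phi>S_mult: "\<phi>S (x \<otimes> y) = \<phi>S x \<otimes> \<phi>S y" if "x \<in> L" "y \<in> L" for x y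
  proof -
    have "\<phi> ((x, id) \<otimes>\<^bsub>PG\<^esub> (y, id)) = \<phi> (x, id) \<otimes>\<^bsub>PG\<^esub> \<phi> (y, id)"
      by (rule \<phi>_mult[OF LP_P[OF that(1)] LP_P[OF that(2)]])
    then show ?thesis using \<phi>S that subgroup.m_closed[OF L that] by simp
  qed
  have \<phi>S_pow: "(\<phi> ^^ k) (g, id) = ((\<phi>S ^^ k) g, id) \<and> (\<phi>S ^^ k) g \<in> L" if "g \<in> L" for g k
    using that by (induction k) (simp_all add: \<phi>S)
  \<comment> \<open>A conjugate of h by an element of L lies in \<Gamma>, where h is isolated; so if
    it is near h, it equals h.\<close>
  have discrete: "\<exists>\<epsilon>>0. \<forall>x\<in>L. (\<forall>i<n. \<forall>j<n. cmod (T x i j - (if i = j then 1 else 0)) < \<epsilon>) \<longrightarrow> x \<otimes> h = h \<otimes> x"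
    if h: "h \<in> L" for h
  proof -
    obtain W where W: "open W" "W \<inter> \<Gamma> = {h}" using \<Gamma>_isolated h L\<Gamma> by blast
    then obtain \<epsilon> where \<epsilon>: "\<epsilon> > 0" "\<forall>g. (\<forall>i<n. \<forall>j<n. cmod (T g i j - (if i = j then 1 else 0)) < \<epsilon>) \<longrightarrow> g \<otimes> h \<otimes> inv g \<in> W"
      using near[of W h] by blast
    have "x \<otimes> h = h \<otimes> x"
      if x: "x \<in> L" "\<forall>i<n. \<forall>j<n. cmod (T x i j - (if i = j then 1 else 0)) < \<epsilon>" for x
    proof -
      have "x \<otimes> h \<otimes> inv x \<in> L"
        using x h L by (simp add: subgroup.m_closed subgroup.m_inv_closed)
      then have "x \<otimes> h \<otimes> inv x = h" using \<epsilon>(2) x(2) W(2) L\<Gamma> by blast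
      then have "(x \<otimes> h \<otimes> inv x) \<otimes> x = h \<otimes> x" by simp
      then show ?thesis by (simp add: m_assoc)
    qed
    then show ?thesis using \<epsilon>(1) by blast
  qed
  have "\<exists>\<kappa>::complex. \<forall>s. b s = \<kappa> * complex_of_real (1 - \<xi> s)"
  proof (rule cocycle_coboundary[OF _ carrier_UNIV \<Gamma>_sub _ L L\<Gamma> m(1) pow _ \<xi> nontrivial b])
    show "group S" by (rule group_axioms)
    show "compact_space (quotient_topology euclidean (\<lambda>x. \<Gamma> #> x))"
      using \<Gamma>_lattice by (simp add: lattice_in_def)
    fix c :: "'s \<Rightarrow> complex"
    assume c: "\<exists>x\<in>derived S L. c x \<noteq> 0"
      "\<And>x y. x \<in> derived S L \<Longrightarrow> y \<in> derived S L \<Longrightarrow> c (x \<otimes> y) = c x + c y"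
      "\<And>g x. g \<in> L \<Longrightarrow> x \<in> derived S L \<Longrightarrow> c (g \<otimes> x \<otimes> inv g) = \<xi> g * c x"
    show "\<forall>g\<in>L. \<xi> g = 1"
    proof (rule ccontr)
      assume nontriv: "\<not> (\<forall>g\<in>L. \<xi> g = 1)"
      have "\<exists>k>0. \<forall>x\<in>L. \<xi> ((\<phi>S ^^ k) x) = \<xi> x"
        by (rule T.character_periodic[OF L \<phi>S_img \<phi>S_mult c _ discrete]) (use nontriv in auto)
      then obtain k where k: "k > 0" "\<And>x. x \<in> L \<Longrightarrow> \<xi> ((\<phi>S ^^ k) x) = \<xi> x" by blast
      obtain R where R: "finite R" "R \<subseteq> P" "\<forall>\<delta>\<in>P. \<exists>\<epsilon>\<in>\<Gamma>P. \<exists>\<rho>\<in>R. \<delta> = \<epsilon> \<otimes>\<^bsub>PG\<^esub> \<rho>"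
        using transversal by blast
      obtain E where E: "finite E" "E \<subseteq> P"
        "\<forall>\<gamma>\<in>P. \<exists>\<gamma>0\<in>E. \<exists>\<delta>\<in>P. \<gamma> = \<delta> \<otimes>\<^bsub>PG\<^esub> \<gamma>0 \<otimes>\<^bsub>PG\<^esub> inv\<^bsub>PG\<^esub> ((\<phi> ^^ k) \<delta>)"
        using twisted_classes_finite[OF finite[OF k(1)]] by blast
      have "\<xi> g = 1" if g: "g \<in> L" for g
      proof -
        have "(\<xi> \<circ> fst) (g, id :: 's \<Rightarrow> 's) = 1"
        proof (rule PG.twisted_conjugacy_finite_trivial_character[OF \<Gamma>P_sub R(1) _ _ \<phi>_pow_hom E(1) _ _ LP(1,2) m(1),
              where \<xi> = "\<xi> \<circ> fst" and x = "(g, id)"])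
          show "R \<subseteq> carrier PG" "E \<subseteq> carrier PG" using R E by auto
          show "\<exists>\<epsilon>\<in>\<Gamma>P. \<exists>\<rho>\<in>R. \<delta> = \<epsilon> \<otimes>\<^bsub>PG\<^esub> \<rho>" if "\<delta> \<in> carrier PG" for \<delta>
            using that R(3) by (simp del: PG_simps(2))
          show "\<exists>\<gamma>0\<in>E. \<exists>\<delta>\<in>carrier PG. \<gamma> = \<delta> \<otimes>\<^bsub>PG\<^esub> \<gamma>0 \<otimes>\<^bsub>PG\<^esub> inv\<^bsub>PG\<^esub> ((\<phi> ^^ k) \<delta>)" if "\<gamma> \<in> carrier PG" for \<gamma>
            using that E(3) by (simp del: PG_simps(2))
          show "x [^]\<^bsub>PG\<^esub> m \<in> LP" if "x \<in> \<Gamma>P" for x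
            using LP(4) that by (simp add: \<Gamma>P_def)
          show "(\<xi> \<circ> fst) (x \<otimes>\<^bsub>PG\<^esub> y) = (\<xi> \<circ> fst) x * (\<xi> \<circ> fst) y" if "x \<in> \<Gamma>P" "y \<in> \<Gamma>P" for x y
            using fst_mult[OF that(1), of y] by (simp add: \<xi>(3) del: PG_simps)
          show "(\<xi> \<circ> fst) ((\<phi> ^^ k) x) = (\<xi> \<circ> fst) x" if "x \<in> LP" for x
          proof -
            have "snd x = id" using that LP(2) by (auto simp: \<Gamma>P_def)
            then have x: "x = (fst x, id)" by (simp add: prod_eq_iff)
            then have "fst x \<in> L" using that LP_L by metis
            then show ?thesis using \<phi>S_pow[of "fst x" k] k(2) x by (metis comp_apply fst_conv)
          qed
          show "(g, id) \<in> LP" using g LP_L by simp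
        qed (simp add: \<xi>(2))
        then show ?thesis by simp
      qed
      then show False using nontriv by blast
    qed
  qed
  then show ?thesis by simp
qed

theorem nilpotent:
  assumes type_R: "type_R S A"
    and finite: "\<And>k. k > 0 \<Longrightarrow> reidemeister_number q (f ^^ k) < \<infinity>"
  shows "nilpotent_group S"
proof -
  obtain U \<phi>U where U: "(U, \<phi>U) \<in> A" "\<one> \<in> U" using exists_chart by blast
  interpret lie_chart S A U \<phi>U
    by unfold_locales (use U in auto)
  obtain T w where T: "tri_rep S CARD('n) T"
    "\<And>i j. continuous_on UNIV (\<lambda>s. T s i j)"
    "\<And>s i. i < CARD('n) \<Longrightarrow> w i s > (0::real) \<and> T s i i = complex_of_real (w i s)"
    "\<And>h W. open W \<Longrightarrow> h \<in> W \<Longrightarrow> \<exists>\<epsilon>>0. \<forall>g.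
       (\<forall>i<CARD('n). \<forall>j<CARD('n). cmod (T g i j - (if i = j then 1 else 0)) < \<epsilon>) \<longrightarrow> g \<otimes> h \<otimes> inv g \<in> W"
    by (rule exists_positive_triangular_rep[OF solvable_S conn type_R]) (rule that; assumption)
  interpret T: tri_rep S "CARD('n)" T by (rule T)
  have w_mult: "w i (s \<otimes> t) = w i s * w i t" if "i < CARD('n)" for i s t
    using T.T_diag_mult[of s t i] T(3)[OF that] that by (simp flip: of_real_mult)
  have w_cont: "continuous_on UNIV (w i)" if "i < CARD('n)" for i
  proof -
    have "w i = (\<lambda>s. Re (T s i i))" using T(3)[OF that] by auto
    then show ?thesis using continuous_on_Re[OF T(2)] by simp
  qed
  have "\<exists>T'. tri_rep S CARD('n) T' \<and> (\<forall>s\<in>carrier S. \<forall>i<CARD('n). T' s i i = T s i i)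
     \<and> (\<forall>s\<in>carrier S. (\<forall>a<CARD('n). \<forall>b<CARD('n). T' s a b = (if a = b then 1 else 0)) \<longrightarrow>
          (\<forall>a<CARD('n). \<forall>b<CARD('n). T s a b = (if a = b then 1 else 0)))
     \<and> (\<forall>b<CARD('n). \<forall>a<b. (\<exists>s\<in>carrier S. w a s \<noteq> w b s) \<longrightarrow> (\<forall>s\<in>carrier S. T' s a b = 0))"
    (is "\<exists>T'. ?Q T'")
  proof (rule T.split_weights[where A = "continuous_on UNIV"])
    show "continuous_on UNIV (\<lambda>s. f s + \<kappa> * g s)" if "continuous_on UNIV f" "continuous_on UNIV g"
      for f g :: "'s \<Rightarrow> complex" and \<kappa>
      using that by (intro continuous_intros)
    fix i j and b :: "'s \<Rightarrow> complex"
    assume ij: "i < CARD('n)" "j < CARD('n)" and ne: "\<exists>s\<in>carrier S. w i s \<noteq> w j s"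
      and cont: "continuous_on UNIV (\<lambda>s. b s * complex_of_real (w j s))"
      and b: "\<And>s t. s \<in> carrier S \<Longrightarrow> t \<in> carrier S \<Longrightarrow>
        b (s \<otimes> t) = b s + complex_of_real (w i s / w j s) * b t"
    have pos: "w i s > 0" "w j s > 0" for s using T(3) ij by auto
    have "\<exists>\<kappa>::complex. \<forall>s. b s = \<kappa> * (1 - complex_of_real (w i s / w j s))"
    proof (rule reidemeister_cocycle_coboundary[OF finite T(1) T(4), where \<xi> = "\<lambda>s. w i s / w j s"])
      show "continuous_on UNIV (\<lambda>s. w i s / w j s)"
        using pos(2) by (intro continuous_intros w_cont ij) (auto simp: less_imp_neq[symmetric])
      show "w i (s \<otimes> t) / w j (s \<otimes> t) = w i s / w j s * (w i t / w j t)" for s t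
        by (simp add: w_mult ij)
      show "\<exists>s. w i s / w j s \<noteq> 1"
        using ne pos(2) by (metis UNIV_I carrier_UNIV divide_eq_1_iff order_less_irrefl)
      \<comment> \<open>Continuity is given for the product of b with a weight; dividing by the
        positive weight recovers that of b.\<close>
      have "complex_of_real (w j s) \<noteq> 0" for s using pos(2)[of s] by simp
      then have "b = (\<lambda>s. b s * complex_of_real (w j s) / complex_of_real (w j s))"
        by simp
      moreover have "continuous_on UNIV (\<lambda>s. b s * complex_of_real (w j s) / complex_of_real (w j s))"
        using pos(2) by (intro continuous_intros cont w_cont ij) (auto simp: less_imp_neq[symmetric])
      ultimately show "continuous_on UNIV b" by metis
      show "b (s \<otimes> t) = b s + complex_of_real (w i s / w j s) * b t" for s t
        using b[of s t] by simp
    qed (use pos in auto)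
    then show "\<exists>\<kappa>::complex. \<forall>s\<in>carrier S. b s = \<kappa> * complex_of_real (1 - w i s / w j s)"
      by simp
  qed (use T in auto)
  then obtain T' where "?Q T'" by (rule exE)
  then have T': "tri_rep S CARD('n) T'" "\<And>s i. i < CARD('n) \<Longrightarrow> T' s i i = T s i i"
    "\<And>s. \<forall>a<CARD('n). \<forall>b<CARD('n). T' s a b = (if a = b then 1 else 0) \<Longrightarrow>
       \<forall>a<CARD('n). \<forall>b<CARD('n). T s a b = (if a = b then 1 else 0)"
    "\<And>a b. b < CARD('n) \<Longrightarrow> a < b \<Longrightarrow> \<exists>s. w a s \<noteq> w b s \<Longrightarrow> \<forall>s. T' s a b = 0"
    unfolding carrier_UNIV by (simp, simp, blast, simp)
  show ?thesis
  proof (rule nilpotent_if_split[OF T'(1)])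
    fix a b assume "b < CARD('n)" "a < b" "\<exists>s\<in>carrier S. T' s a a \<noteq> T' s b b"
    then show "\<forall>s\<in>carrier S. T' s a b = 0"
      using T'(4)[of b a] T'(2)[of a] T'(2)[of b] T(3)[of a] T(3)[of b] by auto
  next
    fix x g assume x: "\<forall>a<CARD('n). \<forall>b<CARD('n). T' x a b = (if a = b then 1 else 0)"
    \<comment> \<open>The matrix T x is the identity, so x meets the nearness condition for every
      \<epsilon> and conjugates g into every neighbourhood of g; separation of points leaves only
      g.\<close>
    have "x \<otimes> g \<otimes> inv x = g"
    proof (rule ccontr)
      assume "x \<otimes> g \<otimes> inv x \<noteq> g"
      then obtain W where W: "open W" "g \<in> W" "x \<otimes> g \<otimes> inv x \<notin> W"
        using t1_space[of g "x \<otimes> g \<otimes> inv x"] by metis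
      obtain \<epsilon> where "\<epsilon> > 0" "\<forall>x. (\<forall>i<CARD('n). \<forall>j<CARD('n). cmod (T x i j - (if i = j then 1 else 0)) < \<epsilon>) \<longrightarrow> x \<otimes> g \<otimes> inv x \<in> W"
        using T(4)[OF W(1,2)] by blast
      then show False using T'(3)[OF x] W(3) by auto
    qed
    then have "(x \<otimes> g \<otimes> inv x) \<otimes> x = g \<otimes> x" by simp
    then show "x \<otimes> g = g \<otimes> x" by (simp add: m_assoc)
  qed
qed

end

theorem theorem8p2:
  fixes S :: "'s::{t2_space, second_countable_topology} monoid"
    and A :: "('s, real^'n) atlas"
    and C :: "('s \<Rightarrow> 's) set"
    and P :: "('s \<times> ('s \<Rightarrow> 's)) set"
    and f :: "'s set \<Rightarrow> 's set"
  assumes "infra_solvmanifold_type_R S A C P"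
    and "homeomorphic_map (orbit_space S P) (orbit_space S P) f"
    and "reidemeister_zeta (orbit_map S P) f \<noteq> None"
  shows "infra_nilmanifold S A C P"
proof -
  have S: "infra_solvmanifold S A C P" "type_R S A"
    using assms(1) by (simp_all add: infra_solvmanifold_type_R_def)
  obtain f' where "homeomorphic_maps (orbit_space S P) (orbit_space S P) f f'"
    using assms(2) by (auto simp: homeomorphic_map_maps)
  then interpret infra_homeo S A C P f f'
    using S(1) by unfold_locales
  have "reidemeister_number (orbit_map S P) (f ^^ k) < \<infinity>" if "k > 0" for k
    using assms(3) that by (auto simp: reidemeister_zeta_def split: if_splits)
  then show ?thesis
    using S nilpotent by (simp add: infra_nilmanifold_def)
qed

end
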